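(* Let $\mathcal F$ be a hyperbolic singular holomorphic foliation by curves on a complex manifold $M$ with singular set $E\subset M$, let $g$ be a hermitian metric on $M$, and let $\eta:M\setminus E\to(0,\infty)$ be the modulus of uniformization of $\mathcal F$. Suppose that the space of uniformizations $\mathcal U$ is NCP. Suppose that for each $q\in E$ there exist a neighbourhood $U_q$ of $q$ in $M$ and $k_q\ge 1$ local $\mathcal F$-invariant hypersurfaces $\Sigma_{q,1},\Sigma_{q,2},\ldots,\Sigma_{q,k_q}$ in $U_q$ such that $q\in\bigcap_{i=1}^{k_q}\Sigma_{q,i}\subset U_q$. Then $\eta$ is continuous on $$M\setminus\bigcup_{p\in\bigcup_{q\in E}\left(\bigcap_{i=1}^{k_q}\Sigma_{q,i}\right)}L_p .$$
   Context: A singular holomorphic foliation by curves (shfc) $\mathcal F$ on a complex manifold $M$ with singular set $E$ is a foliation locally generated by holomorphic vector fields whose zero set is $E$, where $E\subset M$ is a complex analytic set of codimension at least $2$; it is a nonsingular holomorphic foliation by Riemann surfaces on $M\setminus E$. Leaves are the leaves on $M\setminus E$; $L_p$ is the leaf through $p\in M\setminus E$, and by convention $L_p=\{p\}$ for $p\in E$. $\mathcal F$ is hyperbolic if every leaf is a hyperbolic Riemann surface (universally covered by the unit disc $\mathbb D$). Modulus of uniformization: let $\mathcal O(\mathbb D,\mathcal F)$ be the set of holomorphic maps $f:\mathbb D\to M\setminus E$ whose image lies in a single leaf. For $z\in M\setminus E$, $\eta(z)=\sup\{|f'(0)|_g : f\in\mathcal O(\mathbb D,\mathcal F),\ f(0)=z\}$,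 where $|\cdot|_g$ is the length with respect to $g$. "$\eta$ is continuous on $A\subset M\setminus E$" means that $\eta:M\setminus E\to(0,\infty)$ is continuous at each point of $A$. $\mathcal U=\{\alpha\in\mathcal O(\mathbb D,\mathcal F): \alpha \text{ is a uniformization (universal covering map) of a leaf of }\mathcal F\}$. $\mathcal U$ is NCP (normal on compact parts) if for every $\mathcal H\subset\mathcal U$ with $\{\alpha(0):\alpha\in\mathcal H\}$ relatively compact in $M$, the family $\mathcal H$ is normal, i.e. every sequence in $\mathcal H$ has a subsequence converging uniformly on compact subsets of $\mathbb D$ to a holomorphic map $\mathbb D\to M$. A local $\mathcal F$-invariant hypersurface in $U_q$ is an analytic hypersurface $\Sigma=\{f=0\}$ of $U_q$, with $f$ holomorphic on $U_q$, such that for each $p\in\Sigma\setminus E$ the leaf through $p$ of the restricted foliation $\mathcal F|_{U_q}$ is contained in $\Sigma$. *)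

theory Defs
  imports "HOL-Analysis.Analysis"
begin

section \<open>Complex manifolds\<close>

text \<open>A complex manifold is a Hausdorff, second countable space, given as a type \<open>'m\<close>, with a
  holomorphic atlas of charts into \<open>\<complex>\<^sup>n\<close>, where \<open>n = CARD('n)\<close>. A chart is a pair of its
  domain and its coordinate map; values of the coordinate map outside the domain are irrelevant.\<close>

type_synonym ('m, 'n) chart = "'m set \<times> ('m \<Rightarrow> (complex, 'n) vec)"

definition holomorphic_Cn_on :: "(complex^'n \<Rightarrow> complex) \<Rightarrow> (complex^'n) set \<Rightarrow> bool" where
  "holomorphic_Cn_on f S \<longleftrightarrow>
     (\<forall>x\<in>S. \<exists>f'. (f has_derivative f') (at x) \<and> (\<forall>c v. f' (c *s v) = c * f' v))"

definition complex_atlas :: "('m::topological_space, 'n::finite) chart set \<Rightarrow> bool" where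
  "complex_atlas A \<longleftrightarrow>
     (\<Union>(U, \<phi>)\<in>A. U) = UNIV \<and>
     (\<forall>(U, \<phi>)\<in>A. open U \<and> open (\<phi> ` U) \<and> homeomorphism U (\<phi> ` U) \<phi> (inv_into U \<phi>)) \<and>
     (\<forall>(U, \<phi>)\<in>A. \<forall>(V, \<psi>)\<in>A. \<forall>i.
        holomorphic_Cn_on (\<lambda>x. \<psi> (inv_into U \<phi> x) $ i) (\<phi> ` (U \<inter> V)))"

text \<open>The maximal atlas: all charts that are compatible with \<open>A\<close>.\<close>

definition charts :: "('m::topological_space, 'n::finite) chart set \<Rightarrow> ('m, 'n) chart set" where
  "charts A = {c. complex_atlas (insert c A)}"

text \<open>The tangent space at \<open>p\<close> is identified with \<open>\<complex>\<^sup>n\<close> through each chart around \<open>p\<close>.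
  \<open>coord_change c d p\<close> is the resulting isomorphism from \<open>c\<close>-coordinates to \<open>d\<close>-coordinates.\<close>

definition coord_change ::
  "('m, 'n::finite) chart \<Rightarrow> ('m, 'n) chart \<Rightarrow> 'm \<Rightarrow> complex^'n \<Rightarrow> complex^'n" where
  "coord_change c d p =
     frechet_derivative (snd d \<circ> inv_into (fst c) (snd c)) (at (snd c p))"

definition holomorphic_fun_on ::
  "('m::topological_space, 'n::finite) chart set \<Rightarrow> ('m \<Rightarrow> complex) \<Rightarrow> 'm set \<Rightarrow> bool" where
  "holomorphic_fun_on A f W \<longleftrightarrow>
     (\<forall>(U, \<phi>)\<in>A. holomorphic_Cn_on (f \<circ> inv_into U \<phi>) (\<phi> ` (U \<inter> W)))"

abbreviation unit_disc :: "complex set" where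
  "unit_disc \<equiv> ball 0 1"

definition holomorphic_disc ::
  "('m::topological_space, 'n::finite) chart set \<Rightarrow> (complex \<Rightarrow> 'm) \<Rightarrow> bool" where
  "holomorphic_disc A h \<longleftrightarrow>
     continuous_on unit_disc h \<and>
     (\<forall>(U, \<phi>)\<in>A. \<forall>i. (\<lambda>z. \<phi> (h z) $ i) holomorphic_on {z \<in> unit_disc. h z \<in> U})"

text \<open>The local equations are required around every point of the manifold, not only
  around the points of \<open>S\<close>, so analytic sets are closed.\<close>

definition analytic_set :: "('m::topological_space, 'n::finite) chart set \<Rightarrow> 'm set \<Rightarrow> bool" where
  "analytic_set A S \<longleftrightarrow>
     (\<forall>p. \<exists>W G. open W \<and> p \<in> W \<and> finite G \<and> (\<forall>f\<in>G. holomorphic_fun_on A f W) \<and>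
        S \<inter> W = {x \<in> W. \<forall>f\<in>G. f x = 0})"

text \<open>The dimension of an analytic set is the supremum of its dimensions at regular points,
  i.e. points near which it is a coordinate slice of codimension \<open>card I\<close>.\<close>

definition codim_at_least ::
  "('m::topological_space, 'n::finite) chart set \<Rightarrow> 'm set \<Rightarrow> nat \<Rightarrow> bool" where
  "codim_at_least A S k \<longleftrightarrow>
     (\<forall>(W, \<psi>)\<in>charts A. \<forall>I. S \<inter> W \<noteq> {} \<and> S \<inter> W = {x \<in> W. \<forall>i\<in>I. \<psi> x $ i = 0} \<longrightarrow> k \<le> card I)"

section \<open>Hermitian metrics\<close>

primrec Ck_on :: "nat \<Rightarrow> ('a::real_normed_vector \<Rightarrow> 'b::real_normed_vector) \<Rightarrow> 'a set \<Rightarrow> bool" where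
  "Ck_on 0 f S \<longleftrightarrow> continuous_on S f"
| "Ck_on (Suc k) f S \<longleftrightarrow>
     (\<forall>x\<in>S. f differentiable (at x)) \<and> (\<forall>v. Ck_on k (\<lambda>x. frechet_derivative f (at x) v) S)"

text \<open>\<open>g c p u v\<close> is the hermitian product at \<open>p\<close> of the tangent vectors with coordinates \<open>u\<close>
  and \<open>v\<close> in the chart \<open>c\<close>.\<close>

type_synonym ('m, 'n) local_forms =
  "('m, 'n) chart \<Rightarrow> 'm \<Rightarrow> (complex, 'n) vec \<Rightarrow> (complex, 'n) vec \<Rightarrow> complex"

definition hermitian_metric ::
  "('m::topological_space, 'n::finite) chart set \<Rightarrow> ('m, 'n) local_forms \<Rightarrow> bool" where
  "hermitian_metric A g \<longleftrightarrow>
     (\<forall>c\<in>A. \<forall>p\<in>fst c.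
        (\<forall>a u v w. g c p (a *s u + w) v = a * g c p u v + g c p w v) \<and>
        (\<forall>u v. g c p v u = cnj (g c p u v)) \<and>
        (\<forall>u. u \<noteq> 0 \<longrightarrow> Re (g c p u u) > 0)) \<and>
     (\<forall>c\<in>A. \<forall>u v k. Ck_on k (\<lambda>x. g c (inv_into (fst c) (snd c) x) u v) (snd c ` fst c)) \<and>
     (\<forall>c\<in>A. \<forall>d\<in>A. \<forall>p\<in>fst c \<inter> fst d. \<forall>u v.
        g c p u v = g d p (coord_change c d p u) (coord_change c d p v))"

text \<open>The length of \<open>f'(0)\<close>; for a hermitian metric it does not depend on the chosen chart.\<close>

definition speed0 ::
  "('m, 'n::finite) chart set \<Rightarrow> ('m, 'n) local_forms \<Rightarrow> (complex \<Rightarrow> 'm) \<Rightarrow> real" where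
  "speed0 A g f =
     (let c = (SOME c. c \<in> A \<and> f 0 \<in> fst c);
          w = (\<chi> i. deriv (\<lambda>z. snd c (f z) $ i) 0)
      in sqrt (Re (g c (f 0) w w)))"

section \<open>Singular holomorphic foliations by curves\<close>

text \<open>A generator \<open>(c, v)\<close> is the vector field on the domain of the chart \<open>c\<close> whose value
  at \<open>p\<close> has coordinates \<open>v p\<close> in the chart \<open>c\<close>.\<close>

type_synonym ('m, 'n) generator = "('m, 'n) chart \<times> ('m \<Rightarrow> (complex, 'n) vec)"

definition shfc ::
  "('m::topological_space, 'n::finite) chart set \<Rightarrow> 'm set \<Rightarrow> ('m, 'n) generator set \<Rightarrow> bool" where
  "shfc A E F \<longleftrightarrow>
     analytic_set A E \<and> codim_at_least A E 2 \<and>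
     (\<Union>(c, v)\<in>F. fst c) = UNIV \<and>
     (\<forall>(c, v)\<in>F. c \<in> charts A \<and> (\<forall>i. holomorphic_fun_on A (\<lambda>p. v p $ i) (fst c)) \<and>
        {p \<in> fst c. v p = 0} = E \<inter> fst c) \<and>
     (\<forall>(c, v)\<in>F. \<forall>(d, w)\<in>F. \<exists>f. holomorphic_fun_on A f (fst c \<inter> fst d) \<and>
        (\<forall>p\<in>fst c \<inter> fst d. f p \<noteq> 0 \<and> coord_change c d p (v p) = f p *s w p))"

definition integral_curve ::
  "('m, 'n::finite) generator set \<Rightarrow> 'm set \<Rightarrow> (complex \<Rightarrow> 'm) \<Rightarrow> real \<Rightarrow> bool" where
  "integral_curve F E h r \<longleftrightarrow>
     r > 0 \<and> (\<exists>(c, v)\<in>F. h ` ball 0 r \<subseteq> fst c - E \<and>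
       (\<forall>t\<in>ball 0 r. \<forall>i. ((\<lambda>s. snd c (h s) $ i) has_field_derivative v (h t) $ i) (at t)))"

text \<open>The leaf topology on the complement of \<open>E\<close>: the images of integral curves are the
  plaques. Leaves are its connected components, and it induces on each leaf the topology of
  the leaf as a Riemann surface, which is in general finer than the one inherited from the manifold.\<close>

definition leaf_topology ::
  "('m, 'n::finite) generator set \<Rightarrow> 'm set \<Rightarrow> 'm topology" where
  "leaf_topology F E = topology_generated_by {h ` ball 0 r | h r. integral_curve F E h r}"

definition leaf :: "('m, 'n::finite) generator set \<Rightarrow> 'm set \<Rightarrow> 'm \<Rightarrow> 'm set" where
  "leaf F E p = (if p \<in> E then {p} else connected_component_of_set (leaf_topology F E) p)"

definition restrict_foliation ::
  "('m, 'n::finite) generator set \<Rightarrow> 'm set \<Rightarrow> ('m, 'n) generator set" where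
  "restrict_foliation F W = {((U \<inter> W, \<phi>), v) | U \<phi> v. ((U, \<phi>), v) \<in> F}"

section \<open>Uniformizations of the leaves\<close>

text \<open>The analogue of \<open>covering_space\<close> for abstract topologies.\<close>

definition covering_map :: "'a topology \<Rightarrow> ('a \<Rightarrow> 'b) \<Rightarrow> 'b topology \<Rightarrow> bool" where
  "covering_map X p Y \<longleftrightarrow>
     continuous_map X Y p \<and> p ` topspace X = topspace Y \<and>
     (\<forall>y\<in>topspace Y. \<exists>T. openin Y T \<and> y \<in> T \<and>
        (\<exists>\<V>. \<Union>\<V> = {x \<in> topspace X. p x \<in> T} \<and> (\<forall>V\<in>\<V>. openin X V) \<and> pairwise disjnt \<V> \<and>
             (\<forall>V\<in>\<V>. homeomorphic_map (subtopology X V) (subtopology Y T) p)))"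

definition leaf_discs ::
  "('m::topological_space, 'n::finite) chart set \<Rightarrow> 'm set \<Rightarrow> ('m, 'n) generator set
     \<Rightarrow> (complex \<Rightarrow> 'm) set" where
  "leaf_discs A E F =
     {f. holomorphic_disc A f \<and> (\<exists>p. p \<notin> E \<and> f ` unit_disc \<subseteq> leaf F E p)}"

text \<open>The disc is simply connected, so every covering of a leaf by it is a universal one.\<close>

definition uniformizes ::
  "('m::topological_space, 'n::finite) chart set \<Rightarrow> 'm set \<Rightarrow> ('m, 'n) generator set
     \<Rightarrow> (complex \<Rightarrow> 'm) \<Rightarrow> 'm set \<Rightarrow> bool" where
  "uniformizes A E F \<alpha> L \<longleftrightarrow>
     \<alpha> \<in> leaf_discs A E F \<and>
     covering_map (top_of_set unit_disc) \<alpha> (subtopology (leaf_topology F E) L)"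

definition hyperbolic ::
  "('m::topological_space, 'n::finite) chart set \<Rightarrow> 'm set \<Rightarrow> ('m, 'n) generator set \<Rightarrow> bool" where
  "hyperbolic A E F \<longleftrightarrow> (\<forall>p. p \<notin> E \<longrightarrow> (\<exists>\<alpha>. uniformizes A E F \<alpha> (leaf F E p)))"

definition uniformizations ::
  "('m::topological_space, 'n::finite) chart set \<Rightarrow> 'm set \<Rightarrow> ('m, 'n) generator set
     \<Rightarrow> (complex \<Rightarrow> 'm) set" where
  "uniformizations A E F = {\<alpha>. \<exists>p. p \<notin> E \<and> uniformizes A E F \<alpha> (leaf F E p)}"

definition modulus_of_uniformization ::
  "('m::topological_space, 'n::finite) chart set \<Rightarrow> ('m, 'n) local_forms \<Rightarrow> 'm set
     \<Rightarrow> ('m, 'n) generator set \<Rightarrow> 'm \<Rightarrow> real" where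
  "modulus_of_uniformization A g E F z = Sup {speed0 A g f | f. f \<in> leaf_discs A E F \<and> f 0 = z}"

text \<open>Uniform convergence on compact sets, measured by a metric that induces the topology of
  the manifold. For a continuous limit the choice of this metric is immaterial.\<close>

definition converges_compactly ::
  "(nat \<Rightarrow> complex \<Rightarrow> 'm::topological_space) \<Rightarrow> (complex \<Rightarrow> 'm) \<Rightarrow> bool" where
  "converges_compactly a h \<longleftrightarrow>
     (\<exists>d. Metric_space UNIV d \<and> Metric_space.mtopology UNIV d = euclidean \<and>
        (\<forall>K. compact K \<and> K \<subseteq> unit_disc \<longrightarrow>
           (\<forall>\<epsilon>>0. \<forall>\<^sub>F k in sequentially. \<forall>z\<in>K. d (a k z) (h z) < \<epsilon>)))"

definition normal_discs ::
  "('m::topological_space, 'n::finite) chart set \<Rightarrow> (complex \<Rightarrow> 'm) set \<Rightarrow> bool" where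
  "normal_discs A H \<longleftrightarrow>
     (\<forall>a :: nat \<Rightarrow> complex \<Rightarrow> 'm. range a \<subseteq> H \<longrightarrow>
        (\<exists>r h. strict_mono r \<and> holomorphic_disc A h \<and> converges_compactly (a \<circ> r) h))"

definition NCP ::
  "('m::topological_space, 'n::finite) chart set \<Rightarrow> (complex \<Rightarrow> 'm) set \<Rightarrow> bool" where
  "NCP A \<U> \<longleftrightarrow>
     (\<forall>H\<subseteq>\<U>. compact (closure ((\<lambda>\<alpha>. \<alpha> 0) ` H)) \<longrightarrow> normal_discs A H)"

section \<open>Local invariant hypersurfaces\<close>

text \<open>An equation \<open>f = 0\<close> defines a hypersurface only if \<open>f\<close> vanishes identically on no
  nonempty open set, i.e. on no component of \<open>W\<close>; this is the condition on the interior.\<close>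

definition invariant_hypersurface ::
  "('m::topological_space, 'n::finite) chart set \<Rightarrow> 'm set \<Rightarrow> ('m, 'n) generator set
     \<Rightarrow> 'm set \<Rightarrow> 'm set \<Rightarrow> bool" where
  "invariant_hypersurface A E F W \<Sigma> \<longleftrightarrow>
     (\<exists>f. holomorphic_fun_on A f W \<and> \<Sigma> = {x \<in> W. f x = 0}) \<and> interior \<Sigma> = {} \<and>
     (\<forall>p\<in>\<Sigma> - E. leaf (restrict_foliation F W) E p \<subseteq> \<Sigma>)"

end

theory Submission
  imports Defs "HOL-Complex_Analysis.Complex_Analysis"
begin

no_notation fps_nth (infixl "$" 75)

text \<open>By lifting to the universal cover and the Schwarz lemma, \<open>\<eta> z\<close> is the speed at \<open>0\<close> of a
  uniformization \<open>\<alpha>\<close> with \<open>\<alpha> 0 = z\<close>. If \<open>z\<^sub>n\<close> tends to \<open>z\<close>, NCP yields a limit \<open>h\<close> of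
  uniformizations \<open>\<alpha>\<^sub>n\<close> with \<open>\<alpha>\<^sub>n 0 = z\<^sub>n\<close> along a subsequence, and it suffices that \<open>\<eta> z\<close> is the
  speed of \<open>h\<close>. By Hurwitz's theorem applied to the equations of the hypersurfaces, \<open>h\<close> cannot
  reach \<open>E\<close> without \<open>z\<close> lying on a leaf through some intersection of hypersurfaces; so \<open>h\<close> maps into
  the leaf of \<open>z\<close>. Plaques lift through the \<open>\<alpha>\<^sub>n\<close>, and by Montel's theorem the lifts converge to lifts
  through \<open>h\<close>. Hence every disc \<open>f\<close> in the leaf with \<open>f 0 = z\<close> lifts through \<open>h\<close>, and the Schwarz lemma
  shows that \<open>h\<close> is extremal.\<close>

section \<open>Holomorphic vector fields on complex Euclidean space\<close>

text \<open>Two notions of leafwise disc must be reconciled. A member of \<open>leaf_discs\<close>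
  is holomorphic into the manifold and has its image in a leaf as a set, whereas lifting needs
  continuity for the finer leaf topology. Both are compared with \<open>tangent\<close> curves,
  whose velocity is everywhere a multiple of a generator. Away from E this means that all 2x2 minors
  of velocity against generator vanish, a condition that survives limits and spreads by the identity
  theorem. The limit h is never shown to be a covering of its leaf. Lifting through h only requires
  that every point over a flow box starts a lift of the plaque, on a time disc that does not depend
  on the point. The flow time of a flow box is the same for all nearby initial points, hence for all
  late \<alpha> in the sequence; the lifts therefore share a domain and a subsequence converges.
  This is why the flow is built by hand with a uniform time and Lipschitz dependence on the initial
  point. Off E a limit of tangent discs is tangent in any case; the hypersurfaces are there to keep
  h off E.\<close>

lemma norm_vec_scale: "norm (c *s (u::complex^'n)) = norm c * norm u"
  by (simp add: norm_vec_def L2_set_def norm_mult power_mult_distrib real_sqrt_mult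
      flip: sum_distrib_left)

lemma has_derivative_vec:
  fixes f :: "'a::real_normed_vector \<Rightarrow> complex^'n"
  assumes "\<And>i. ((\<lambda>x. f x $ i) has_derivative (\<lambda>h. f' h $ i)) (at a)"
  shows "(f has_derivative f') (at a)"
  unfolding has_derivative_componentwise_within[of f f']
proof
  fix b :: "complex^'n" assume "b \<in> Basis"
  then obtain i c where b: "b = axis i c" by (auto simp: Basis_vec_def)
  show "((\<lambda>x. f x \<bullet> b) has_derivative (\<lambda>x. f' x \<bullet> b)) (at a)"
    unfolding b inner_axis by (rule has_derivative_inner_left[OF assms])
qed

lemma has_derivative_curve:
  fixes y :: "complex \<Rightarrow> complex^'n"
  assumes "\<And>i. ((\<lambda>z. y z $ i) has_field_derivative u $ i) (at w)"
  shows "(y has_derivative (\<lambda>s. s *s u)) (at w)"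
  using assms by (intro has_derivative_vec) (simp add: has_field_derivative_def mult_commute_abs)

lemma has_field_derivative_chain_Cn:
  fixes y :: "complex \<Rightarrow> complex^'n"
  assumes "(G has_derivative G') (at (y w))" "\<And>c v. G' (c *s v) = c * G' v"
    and "\<And>i. ((\<lambda>z. y z $ i) has_field_derivative u $ i) (at w)"
  shows "((\<lambda>z. G (y z)) has_field_derivative G' u) (at w)"
  unfolding has_field_derivative_def
  using has_derivative_compose[OF has_derivative_curve[OF assms(3)] assms(1)]
  by (simp add: assms(2) mult_commute_abs)

lemma curve_bound:
  fixes y :: "complex \<Rightarrow> complex^'n"
  assumes "convex S" "\<And>t i. t \<in> S \<Longrightarrow> ((\<lambda>z. y z $ i) has_field_derivative d t $ i) (at t)"
    and "\<And>t. t \<in> S \<Longrightarrow> norm (d t) \<le> K" "a \<in> S" "b \<in> S"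
  shows "norm (y a - y b) \<le> K * norm (a - b)"
proof (rule differentiable_bound[OF assms(1) _ _ assms(4,5)])
  fix t assume t: "t \<in> S"
  show "(y has_derivative (\<lambda>s. s *s d t)) (at t within S)"
    by (rule has_derivative_at_withinI[OF has_derivative_curve[OF assms(2)[OF t]]])
  show "onorm (\<lambda>s. s *s d t) \<le> K"
    by (rule onorm_le) (metis assms(3) t mult.commute mult_right_mono norm_ge_zero norm_vec_scale)
qed

text \<open>Only pointwise complex differentiability is given, so a bound on the derivative has to
  be produced. Continuity bounds f near p, Cauchy's inequality on complex lines turns this into a
  bound on the derivative, and the mean value inequality does the rest.\<close>

lemma holomorphic_Cn_lipschitz:
  fixes f :: "complex^'n \<Rightarrow> complex"
  assumes "holomorphic_Cn_on f W" "open W" "p \<in> W"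
  shows "\<exists>R>0. \<exists>B\<ge>0. ball p R \<subseteq> W \<and> (\<forall>x\<in>ball p R. norm (f x) \<le> B) \<and>
           (\<forall>x\<in>ball p R. \<forall>y\<in>ball p R. norm (f x - f y) \<le> B * norm (x - y))"
proof -
  have "continuous_on W f"
    using assms(1) unfolding holomorphic_Cn_on_def
    by (meson continuous_at_imp_continuous_on has_derivative_continuous)
  then have "open (W \<inter> f -` ball (f p) 1)"
    using assms(2) by (intro continuous_open_preimage) auto
  then obtain r where r: "r > 0" "ball p r \<subseteq> W \<inter> f -` ball (f p) 1"
    using assms(3) by (metis IntI centre_in_ball openE vimageI zero_less_one)
  define M where "M = norm (f p) + 1"
  have M: "norm (f x) \<le> M" if "x \<in> ball p r" for x
    using r(2) that norm_triangle_sub[of "f x" "f p"] by (auto simp: M_def dist_norm norm_minus_commute)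
  \<comment> \<open>Leaves room for a disc of radius R, in any complex direction, around each point
    of \<open>ball p R\<close>.\<close>
  define R where "R = r/2"
  have R: "R > 0" using r by (simp add: R_def)
  \<comment> \<open>The bound on f and the Cauchy bound for its derivative. The latter is taken on
    radius \<open>R/2\<close>, so that the closed disc lies in the open disc of radius R where the
    restricted function is known to be holomorphic.\<close>
  define B where "B = max M (M / (R/2))"
  have "M > 0" unfolding M_def by (simp add: add_nonneg_pos)
  then have B: "B \<ge> 0" by (simp add: B_def)
  have deriv: "\<exists>f'. (f has_derivative f') (at x) \<and> onorm f' \<le> B" if x: "x \<in> ball p R" for x
  proof -
    have "x \<in> W" using x r unfolding R_def by auto
    then obtain f' where f': "(f has_derivative f') (at x)" "\<And>c v. f' (c *s v) = c * f' v"
      using assms(1) unfolding holomorphic_Cn_on_def by blast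
    have "norm (f' u) \<le> B * norm u" for u
    proof (cases "u = 0")
      case True then show ?thesis using f'(2)[of 0 u] by simp
    next
      case False
      \<comment> \<open>Unit vector in the direction of u: f is studied along the complex line
        through x that it spans.\<close>
      define e where "e = complex_of_real (1 / norm u) *s u"
      have ne: "norm e = 1" using False by (simp add: e_def norm_vec_scale norm_divide)
      define g where "g = (\<lambda>s. f (x + s *s e))"
      have in1: "x + s *s e \<in> ball p r" if "norm s < R" for s
      proof -
        have "dist p (x + s *s e) \<le> dist p x + norm (s *s e)"
          by (metis dist_norm dist_triangle dist_commute add_diff_cancel_left')
        then show ?thesis using x that ne by (simp add: norm_vec_scale R_def)
      qed
      have dg: "\<exists>d. (g has_field_derivative d) (at s)" if "norm s < R" for s
      proof -
        have "x + s *s e \<in> W" using in1 that r by auto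
        then obtain G' where G': "(f has_derivative G') (at (x + s *s e))" "\<And>c v. G' (c *s v) = c * G' v"
          using assms(1) unfolding holomorphic_Cn_on_def by blast
        have "(g has_field_derivative G' e) (at s)"
          unfolding g_def
          by (rule has_field_derivative_chain_Cn[where y="\<lambda>s. x + s *s e"])
             (use G' in \<open>auto intro!: derivative_eq_intros\<close>)
        then show ?thesis by blast
      qed
      then have hg: "g holomorphic_on ball 0 R"
        by (simp add: holomorphic_on_open)
      have "(g has_field_derivative f' e) (at 0)"
          unfolding g_def
          by (rule has_field_derivative_chain_Cn[where y="\<lambda>s. x + s *s e"])
             (use f' in \<open>auto intro!: derivative_eq_intros\<close>)
      then have "deriv g 0 = f' e" by (rule DERIV_imp_deriv)
      moreover have "norm ((deriv ^^ 1) g 0) \<le> fact 1 * M / (R/2)^1"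
      proof (rule Cauchy_inequality)
        show "g holomorphic_on ball 0 (R/2)" using hg R by (auto intro: holomorphic_on_subset)
        show "continuous_on (cball 0 (R/2)) g"
          using hg R by (intro holomorphic_on_imp_continuous_on holomorphic_on_subset[OF hg]) auto
        show "norm (g s) \<le> M" if "norm (0 - s) = R/2" for s
          unfolding g_def using that R by (intro M in1) auto
      qed (use R in auto)
      ultimately have "norm (f' e) \<le> B" by (auto simp: B_def)
      moreover have "u = complex_of_real (norm u) *s e" using False by (simp add: e_def vector_smult_assoc)
      then have "norm (f' u) = norm u * norm (f' e)"
        using f'(2)[of "complex_of_real (norm u)" e] by (metis norm_mult norm_of_real abs_norm_cancel)
      ultimately show ?thesis by (metis mult.commute mult_left_mono norm_ge_zero)
    qed
    then show ?thesis using f' onorm_le by blast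
  qed
  then obtain D where D: "\<And>x. x \<in> ball p R \<Longrightarrow> (f has_derivative D x) (at x) \<and> onorm (D x) \<le> B"
    by metis
  have "norm (f x - f y) \<le> B * norm (x - y)" if "x \<in> ball p R" "y \<in> ball p R" for x y
    by (rule differentiable_bound[where S="ball p R" and f'=D])
       (use D that in \<open>auto intro: has_derivative_at_withinI\<close>)
  moreover have "norm (f x) \<le> B" if "x \<in> ball p R" for x
    using M[of x] that R unfolding B_def R_def by auto
  moreover have "ball p R \<subseteq> W" using r unfolding R_def by auto
  ultimately show ?thesis using R B by blast
qed

lemma norm_vec_le_sum: "norm (x::complex^'n) \<le> (\<Sum>i\<in>UNIV. norm (x $ i))"
  unfolding norm_vec_def by (rule L2_set_le_sum) auto

lemma holomorphic_field_lipschitz: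
  fixes V :: "complex^'n \<Rightarrow> complex^'n"
  assumes "\<And>i. holomorphic_Cn_on (\<lambda>x. V x $ i) W" "open W" "p \<in> W"
  obtains R B where "R > 0" "B > 0" "ball p R \<subseteq> W" "\<And>x. x \<in> ball p R \<Longrightarrow> norm (V x) \<le> B"
    "\<And>x y. x \<in> ball p R \<Longrightarrow> y \<in> ball p R \<Longrightarrow> norm (V x - V y) \<le> B * norm (x - y)"
proof -
  have "\<forall>i. \<exists>R>0. \<exists>B\<ge>0. ball p R \<subseteq> W \<and> (\<forall>x\<in>ball p R. norm (V x $ i) \<le> B) \<and>
           (\<forall>x\<in>ball p R. \<forall>y\<in>ball p R. norm (V x $ i - V y $ i) \<le> B * norm (x - y))"
    using holomorphic_Cn_lipschitz[OF assms] by blast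
  then obtain R B where RB: "\<And>i. R i > 0" "\<And>i. B i \<ge> 0" "\<And>i. ball p (R i) \<subseteq> W"
      "\<And>i x. x\<in>ball p (R i) \<Longrightarrow> norm (V x $ i) \<le> B i"
      "\<And>i x y. x\<in>ball p (R i) \<Longrightarrow> y\<in>ball p (R i) \<Longrightarrow> norm (V x $ i - V y $ i) \<le> B i * norm (x - y)"
    by metis
  define R0 where "R0 = Min (range R)"
  have R0: "R0 > 0" "\<And>i. R0 \<le> R i" using RB(1) by (auto simp: R0_def)
  then have sub: "x \<in> ball p R0 \<Longrightarrow> x \<in> ball p (R i)" for x i
    by (meson mem_ball less_le_trans)
  \<comment> \<open>The summand 1 makes the constant positive; it is divided by when radii are
    chosen.\<close>
  define B0 where "B0 = (\<Sum>i\<in>UNIV. B i) + 1"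
  have "norm (V x) \<le> B0" if "x \<in> ball p R0" for x
  proof -
    have "norm (V x) \<le> (\<Sum>i\<in>UNIV. norm (V x $ i))" by (rule norm_vec_le_sum)
    also have "\<dots> \<le> (\<Sum>i\<in>UNIV. B i)" by (intro sum_mono RB sub that)
    finally show ?thesis by (simp add: B0_def)
  qed
  moreover have "norm (V x - V y) \<le> B0 * norm (x - y)" if "x \<in> ball p R0" "y \<in> ball p R0" for x y
  proof -
    have "norm (V x - V y) \<le> (\<Sum>i\<in>UNIV. norm ((V x - V y) $ i))" by (rule norm_vec_le_sum)
    also have "\<dots> \<le> (\<Sum>i\<in>UNIV. B i * norm (x - y))"
      using RB(5) sub that by (intro sum_mono) auto
    also have "\<dots> \<le> B0 * norm (x - y)"
      by (simp add: B0_def sum_distrib_right[symmetric] algebra_simps)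
    finally show ?thesis .
  qed
  moreover have "B0 > 0" unfolding B0_def using RB(2) by (simp add: add_nonneg_pos sum_nonneg)
  moreover have "ball p R0 \<subseteq> W" using sub RB(3) by blast
  ultimately show ?thesis using that R0(1) by blast
qed

text \<open>Takes the place of Gronwall's inequality on discs so small that integration halves suprema.\<close>

lemma absorb_half:
  fixes g :: "'a \<Rightarrow> real"
  assumes "\<And>t. t \<in> S \<Longrightarrow> g t \<le> M"
    and "\<And>s. (\<And>t. t \<in> S \<Longrightarrow> g t \<le> s) \<Longrightarrow> (\<And>t. t \<in> S \<Longrightarrow> g t \<le> a + s/2)" and "t \<in> S"
  shows "g t \<le> 2 * a"
proof -
  define s where "s = Sup (g ` S)"
  have bdd: "bdd_above (g ` S)" by (rule bdd_aboveI2[OF assms(1)])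
  have le: "g t \<le> s" if "t \<in> S" for t unfolding s_def using bdd that by (simp add: cSUP_upper)
  have "s \<le> a + s/2" unfolding s_def
    by (rule cSUP_least) (use assms(3) assms(2)[OF le] in \<open>auto simp: s_def\<close>)
  then show ?thesis using le[OF assms(3)] by simp
qed

section \<open>Holomorphic differential equations: uniqueness, flow, dependence on the initial
  point\<close>

text \<open>By the mean value inequality, a bound s for the difference of the two solutions improves
  to \<open>e * (L * B) * s\<close>, at most \<open>s/2\<close>, so the difference vanishes. The
  factor l is present because a curve in a leaf runs through it with varying complex speed.\<close>

lemma ode_unique_local:
  fixes V :: "complex^'n \<Rightarrow> complex^'n"
  assumes "\<And>x y. x \<in> ball p R \<Longrightarrow> y \<in> ball p R \<Longrightarrow> norm (V x - V y) \<le> B * norm (x - y)"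
    and "\<And>t i. t \<in> ball a e \<Longrightarrow> ((\<lambda>z. y1 z $ i) has_field_derivative (l t *s V (y1 t)) $ i) (at t)"
    and "\<And>t i. t \<in> ball a e \<Longrightarrow> ((\<lambda>z. y2 z $ i) has_field_derivative (l t *s V (y2 t)) $ i) (at t)"
    and "\<And>t. t \<in> ball a e \<Longrightarrow> y1 t \<in> ball p R" "\<And>t. t \<in> ball a e \<Longrightarrow> y2 t \<in> ball p R"
    and "\<And>t. t \<in> ball a e \<Longrightarrow> norm (l t) \<le> L" and "e * (L * B) \<le> 1/2" "B \<ge> 0" "L \<ge> 0"
    and "y1 a = y2 a" and "t \<in> ball a e"
  shows "y1 t = y2 t"
proof -
  have "e > 0" using assms(11) by (metis ball_eq_empty empty_iff not_less)
  have "norm (y1 t - y2 t) \<le> 2 * 0"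
  proof (rule absorb_half[where S="ball a e" and M="2*R" and g="\<lambda>t. norm (y1 t - y2 t)"])
    fix t assume "t \<in> ball a e"
    then show "norm (y1 t - y2 t) \<le> 2*R"
      using assms(4)[of t] assms(5)[of t] dist_triangle_half_l[of "y1 t" p "2*R" "y2 t"]
      by (simp add: dist_norm norm_minus_commute)
  next
    fix s t assume s: "\<And>t. t \<in> ball a e \<Longrightarrow> norm (y1 t - y2 t) \<le> s" and t: "t \<in> ball a e"
    have "s \<ge> 0" using order_trans[OF norm_ge_zero s[OF t]] .
    have "norm ((\<lambda>t. y1 t - y2 t) t - (\<lambda>t. y1 t - y2 t) a) \<le> (L * B * s) * norm (t - a)"
    proof (rule curve_bound[where S="ball a e" and d="\<lambda>t. l t *s V (y1 t) - l t *s V (y2 t)"])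
      fix u assume u: "u \<in> ball a e"
      show "((\<lambda>z. (y1 z - y2 z) $ i) has_field_derivative (l u *s V (y1 u) - l u *s V (y2 u)) $ i) (at u)" for i
        using DERIV_diff[OF assms(2)[OF u, of i] assms(3)[OF u, of i]] by simp
      have "norm (l u *s V (y1 u) - l u *s V (y2 u)) = norm (l u) * norm (V (y1 u) - V (y2 u))"
        by (metis norm_vec_scale vector_ssub_ldistrib)
      also have "\<dots> \<le> L * (B * s)"
        using assms(1)[OF assms(4)[OF u] assms(5)[OF u]] s[OF u] assms(6)[OF u] assms(8,9)
        by (intro mult_mono) (auto intro: order_trans mult_left_mono)
      finally show "norm (l u *s V (y1 u) - l u *s V (y2 u)) \<le> L * B * s" by simp
    qed (use t \<open>e > 0\<close> in auto)
    also have "\<dots> \<le> (L * B * s) * e"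
      using t \<open>s \<ge> 0\<close> assms(8,9) by (intro mult_left_mono) (auto simp: dist_norm norm_minus_commute)
    also have "\<dots> = (e * (L * B)) * s" by simp
    also have "\<dots> \<le> 1/2 * s" using assms(7) \<open>s \<ge> 0\<close> by (rule mult_right_mono)
    finally show "norm (y1 t - y2 t) \<le> 0 + s/2" using assms(10) by simp
  qed (use assms(11) in auto)
  then show ?thesis by simp
qed

text \<open>Picard iteration in complex time. The iterates are primitives of holomorphic functions
  on a disc, so their uniform limit is again holomorphic. It matters that \<rho> serves all initial
  points y at once.\<close>

lemma flow_Cn:
  fixes V :: "complex^'n \<Rightarrow> complex^'n"
  assumes "\<And>i. holomorphic_Cn_on (\<lambda>x. V x $ i) W" "open W" "p \<in> W"
  obtains \<rho> r \<Phi> where "\<rho> > 0" "r > 0" "ball p r \<subseteq> W"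
    "\<And>y. y \<in> ball p r \<Longrightarrow> \<Phi> y 0 = y"
    "\<And>y t. y \<in> ball p r \<Longrightarrow> t \<in> ball 0 \<rho> \<Longrightarrow> \<Phi> y t \<in> W"
    "\<And>y t i. y \<in> ball p r \<Longrightarrow> t \<in> ball 0 \<rho> \<Longrightarrow>
        ((\<lambda>s. \<Phi> y s $ i) has_field_derivative V (\<Phi> y t) $ i) (at t)"
    "\<And>y y' t. y \<in> ball p r \<Longrightarrow> y' \<in> ball p r \<Longrightarrow> t \<in> ball 0 \<rho> \<Longrightarrow>
        norm (\<Phi> y t - \<Phi> y' t) \<le> 2 * norm (y - y')"
proof -
  obtain R B where R: "R > 0" and B: "B > 0" and sub: "ball p R \<subseteq> W"
    and bd: "\<And>x. x \<in> ball p R \<Longrightarrow> norm (V x) \<le> B"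
    and lip: "\<And>x y. x \<in> ball p R \<Longrightarrow> y \<in> ball p R \<Longrightarrow> norm (V x - V y) \<le> B * norm (x - y)"
    using holomorphic_field_lipschitz[OF assms] by blast
  define r where "r = R/2"
  \<comment> \<open>\<open>B * \<rho> \<le> 1/2\<close> makes each integration halve the distance of
    iterates; \<open>B * \<rho> \<le> R/2\<close> keeps solutions that start in the ball of radius
    \<open>R/2\<close> inside \<open>ball p R\<close>.\<close>
  define \<rho> where "\<rho> = min (1/2) (R/2) / B"
  have \<rho>: "\<rho> > 0" "B * \<rho> \<le> 1/2" "B * \<rho> \<le> R/2" using R B by (auto simp: \<rho>_def)
  have inR: "x \<in> ball p R" if "y \<in> ball p r" "norm (x - y) \<le> B * \<rho>" for x y
    using that \<rho>(3) dist_triangle[of p x y] by (auto simp: dist_norm norm_minus_commute r_def)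
  have Vcont: "continuous_on W V"
  proof -
    have "continuous_on W (\<lambda>x. V x $ i)" for i
      using assms(1)[of i] unfolding holomorphic_Cn_on_def
      by (meson continuous_at_imp_continuous_on has_derivative_continuous)
    then have "continuous_on W (\<lambda>x. \<chi> i. V x $ i)" by (rule continuous_on_vec_lambda)
    then show ?thesis by simp
  qed
  have sol: "\<exists>f. f 0 = y \<and> (\<forall>t\<in>ball 0 \<rho>. f t \<in> ball p R \<and>
      (\<forall>i. ((\<lambda>s. f s $ i) has_field_derivative V (f t) $ i) (at t)))" if y: "y \<in> ball p r" for y
  proof -
    \<comment> \<open>Q is the invariant of the iterates, and D relates an iterate to its Picard
      successor.\<close>
    define Q where "Q = (\<lambda>f::complex\<Rightarrow>complex^'n. f 0 = y \<and> (\<forall>t\<in>ball 0 \<rho>. norm (f t - y) \<le> B * \<rho>) \<and>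
        (\<forall>i. (\<lambda>t. f t $ i) holomorphic_on ball 0 \<rho>))"
    define D where "D = (\<lambda>f f'. \<forall>t\<in>ball 0 \<rho>. \<forall>i. ((\<lambda>s. f' s $ i) has_field_derivative V (f t) $ i) (at t))"
    have "\<exists>f. \<forall>n. Q (f n) \<and> D (f n) (f (Suc n))"
    proof (rule dependent_nat_choice)
      show "\<exists>f. Q f" by (rule exI[of _ "\<lambda>_. y"]) (use B \<rho> in \<open>auto simp: Q_def\<close>)
    next
      fix f :: "complex \<Rightarrow> complex^'n" and n :: nat assume Qf: "Q f"
      have inW: "f t \<in> W" "f t \<in> ball p R" if "t \<in> ball 0 \<rho>" for t using inR[OF y] that Qf sub by (auto simp: Q_def)
      have "\<exists>g. \<forall>t\<in>ball 0 \<rho>. (g has_field_derivative V (f t) $ i) (at t)" for i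
      proof -
        have "(\<lambda>t. V (f t) $ i) holomorphic_on ball 0 \<rho>"
        proof (rule holomorphic_onI)
          fix t :: complex assume t: "t \<in> ball 0 \<rho>"
          obtain G' where G': "((\<lambda>x. V x $ i) has_derivative G') (at (f t))" "\<And>c v. G' (c *s v) = c * G' v"
            using assms(1)[of i] inW(1)[OF t] unfolding holomorphic_Cn_on_def by blast
          have "((\<lambda>t. V (f t) $ i) has_field_derivative G' (\<chi> i. deriv (\<lambda>t. f t $ i) t)) (at t)"
            by (rule has_field_derivative_chain_Cn[where y=f, OF G'])
              (use Qf t in \<open>auto simp: Q_def intro!: holomorphic_derivI[where S="ball 0 \<rho>"]\<close>)
          then show "(\<lambda>t. V (f t) $ i) field_differentiable at t within ball 0 \<rho>"
            using field_differentiable_at_within field_differentiable_def by blast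
        qed
        then obtain g where "\<And>t. t \<in> ball 0 \<rho> \<Longrightarrow> (g has_field_derivative V (f t) $ i) (at t within ball 0 \<rho>)"
          using holomorphic_convex_primitive'[OF convex_ball open_ball] by blast
        then show ?thesis by (metis at_within_open open_ball)
      qed
      then obtain g where g: "\<And>i t. t\<in>ball 0 \<rho> \<Longrightarrow> (g i has_field_derivative V (f t) $ i) (at t)" by metis
      define f' where "f' = (\<lambda>t. \<chi> i. y $ i + g i t - g i 0)"
      have Df: "D f f'" unfolding D_def f'_def by (auto intro!: derivative_eq_intros g)
      have f0: "f' 0 = y" by (simp add: f'_def vec_eq_iff)
      have "norm (f' t - y) \<le> B * \<rho>" if t: "t \<in> ball 0 \<rho>" for t
      proof -
        have "norm (f' t - f' 0) \<le> B * norm (t - 0)"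
          by (rule curve_bound[where S="ball 0 \<rho>" and d="\<lambda>t. V (f t)"])
             (use Df t \<rho> bd inW in \<open>auto simp: D_def\<close>)
        also have "\<dots> \<le> B * \<rho>" using t B by (intro mult_left_mono) auto
        finally show ?thesis using f0 by simp
      qed
      moreover have "(\<lambda>t. f' t $ i) holomorphic_on ball 0 \<rho>" for i
        using Df unfolding D_def holomorphic_on_open[OF open_ball] by blast
      ultimately show "\<exists>f'. Q f' \<and> D f f'" using f0 Df unfolding Q_def by blast
    qed
    then obtain f where Qf: "\<And>n. Q (f n)" and Df: "\<And>n. D (f n) (f (Suc n))" by blast
    have inR': "f n t \<in> ball p R" if "t \<in> ball 0 \<rho>" for n t using inR[OF y] that Qf[of n] by (auto simp: Q_def)
    \<comment> \<open>The induction starts from the fact that the first two iterates are both within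
      \<open>R/2\<close> of y.\<close>
    have step: "norm (f (Suc n) t - f n t) \<le> R * (1/2)^n" if "t \<in> ball 0 \<rho>" for n t
      using that
    proof (induction n arbitrary: t)
      case 0
      have "norm (f (Suc 0) t - y) \<le> R/2" "norm (f 0 t - y) \<le> R/2"
        using 0 Qf[of 0] Qf[of "Suc 0"] \<rho>(3) by (force simp: Q_def)+
      then show ?case using norm_triangle_ineq4[of "f (Suc 0) t - y" "f 0 t - y"] by simp
    next
      case (Suc n)
      have "norm ((\<lambda>t. f (Suc (Suc n)) t - f (Suc n) t) t - (\<lambda>t. f (Suc (Suc n)) t - f (Suc n) t) 0)
          \<le> (B * (R * (1/2)^n)) * norm (t - 0)"
      proof (rule curve_bound[where S="ball 0 \<rho>" and d="\<lambda>t. V (f (Suc n) t) - V (f n t)"])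
        fix u :: complex assume u: "u \<in> ball 0 \<rho>"
        show "((\<lambda>z. (f (Suc (Suc n)) z - f (Suc n) z) $ i) has_field_derivative
          (V (f (Suc n) u) - V (f n u)) $ i) (at u)" for i
          using Df[of n] Df[of "Suc n"] u unfolding D_def by (auto intro!: DERIV_diff)
        show "norm (V (f (Suc n) u) - V (f n u)) \<le> B * (R * (1 / 2) ^ n)"
          using order_trans[OF lip[OF inR'[OF u] inR'[OF u]] mult_left_mono[OF Suc.IH[OF u]]] B by simp
      qed (use Suc.prems \<rho> in auto)
      also have "\<dots> \<le> (B * (R * (1/2)^n)) * \<rho>"
        using Suc.prems B R by (intro mult_left_mono) auto
      also have "\<dots> = (B * \<rho>) * (R * (1/2)^n)" by simp
      also have "\<dots> \<le> 1/2 * (R * (1/2)^n)" using \<rho>(2) R by (intro mult_right_mono) auto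
      finally show ?case using Qf[of "Suc (Suc n)"] Qf[of "Suc n"] by (simp add: Q_def)
    qed
    \<comment> \<open>The terms before the series reduce to \<open>f 0 t\<close>, so the partial
      sums telescope to \<open>f n t\<close>.\<close>
    define \<Phi> where "\<Phi> = (\<lambda>t. y + (f 0 t - y) + (\<Sum>n. f (Suc n) t - f n t))"
    have "uniform_limit (ball 0 \<rho>) (\<lambda>n t. \<Sum>i<n. f (Suc i) t - f i t) (\<lambda>t. \<Sum>i. f (Suc i) t - f i t) sequentially"
      by (rule Weierstrass_m_test[where M="\<lambda>n. R * (1/2)^n"]) (auto intro: step summable_mult)
    then have "uniform_limit (ball 0 \<rho>) (\<lambda>n t. f n t - f 0 t) (\<lambda>t. \<Sum>i. f (Suc i) t - f i t) sequentially"
      by (simp add: sum_lessThan_telescope[where f="\<lambda>n. f n t" for t])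
    then have ul: "uniform_limit (ball 0 \<rho>) f \<Phi> sequentially"
      unfolding uniform_limit_iff dist_norm by (simp add: \<Phi>_def diff_diff_eq add.commute)
    have lim: "(\<lambda>n. f n t) \<longlonglongrightarrow> \<Phi> t" if "t \<in> ball 0 \<rho>" for t
      using ul that by (rule tendsto_uniform_limitI)
    have \<Phi>in: "\<Phi> t \<in> ball p R" if "t \<in> ball 0 \<rho>" for t
    proof (rule inR[OF y])
      show "norm (\<Phi> t - y) \<le> B * \<rho>"
        by (rule Lim_norm_ubound[OF _ tendsto_diff[OF lim[OF that] tendsto_const]])
           (use Qf that in \<open>auto simp: Q_def\<close>)
    qed
    have "((\<lambda>s. \<Phi> s $ i) has_field_derivative V (\<Phi> t) $ i) (at t)" if t: "t \<in> ball 0 \<rho>" for t i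
    proof -
      \<comment> \<open>Applied to the shifted sequence \<open>f (Suc n)\<close>, whose derivative
        is V along \<open>f n\<close>. The limit of these derivatives is then identified by the
        continuity of V.\<close>
      have "\<exists>g'. \<forall>x\<in>ball 0 \<rho>. ((\<lambda>s. \<Phi> s $ i) has_field_derivative g' x) (at x) \<and> (\<lambda>n. V (f n x) $ i) \<longlonglongrightarrow> g' x"
      proof (rule has_complex_derivative_uniform_sequence[where f="\<lambda>n s. f (Suc n) s $ i"])
        show "((\<lambda>s. f (Suc n) s $ i) has_field_derivative V (f n x) $ i) (at x)" if "x \<in> ball 0 \<rho>" for n x
          using Df[of n] that by (auto simp: D_def)
        fix x :: complex assume "x \<in> ball 0 \<rho>"
        then obtain d where d: "d > 0" "cball x d \<subseteq> ball 0 \<rho>" using open_contains_cball open_ball by meson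
        have "uniform_limit (cball x d) (\<lambda>n. f (Suc n)) \<Phi> sequentially"
          by (rule uniform_limit_on_subset[OF _ d(2)])
            (rule filterlim_compose[OF ul filterlim_Suc])
        then have "uniform_limit (cball x d) (\<lambda>n s. f (Suc n) s $ i) (\<lambda>s. \<Phi> s $ i) sequentially"
          by (rule bounded_linear.uniform_limit[OF bounded_linear_vec_nth])
        then show "\<exists>d>0. cball x d \<subseteq> ball 0 \<rho> \<and> uniform_limit (cball x d) (\<lambda>n s. f (Suc n) s $ i) (\<lambda>s. \<Phi> s $ i) sequentially"
          using d by blast
      qed auto
      then obtain d where d: "((\<lambda>s. \<Phi> s $ i) has_field_derivative d) (at t)" "(\<lambda>n. V (f n t) $ i) \<longlonglongrightarrow> d" using t by blast
      have "(\<lambda>n. V (f n t)) \<longlonglongrightarrow> V (\<Phi> t)"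
        by (rule continuous_on_tendsto_compose[OF Vcont lim[OF t]]) (use \<Phi>in sub t inR' in \<open>auto intro!: always_eventually\<close>)
      then have "(\<lambda>n. V (f n t) $ i) \<longlonglongrightarrow> V (\<Phi> t) $ i" by (rule tendsto_vec_nth)
      then show ?thesis using d LIMSEQ_unique by blast
    qed
    moreover have "\<Phi> 0 = y" using lim[of 0] Qf \<rho> LIMSEQ_unique[of "\<lambda>n. f n 0"] by (auto simp: Q_def)
    ultimately show ?thesis using \<Phi>in by blast
  qed
  then obtain \<Phi> where \<Phi>: "\<And>y. y \<in> ball p r \<Longrightarrow> \<Phi> y 0 = y \<and> (\<forall>t\<in>ball 0 \<rho>. \<Phi> y t \<in> ball p R \<and>
      (\<forall>i. ((\<lambda>s. \<Phi> y s $ i) has_field_derivative V (\<Phi> y t) $ i) (at t)))" by metis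
  \<comment> \<open>A bound s for the distance of the two solutions improves to
    \<open>norm (y - y') + s/2\<close>, which is where the factor 2 comes from.\<close>
  have dep: "norm (\<Phi> y t - \<Phi> y' t) \<le> 2 * norm (y - y')"
    if y: "y \<in> ball p r" "y' \<in> ball p r" "t \<in> ball 0 \<rho>" for y y' t
  proof (rule absorb_half[where S="ball 0 \<rho>" and M="2*R" and g="\<lambda>t. norm (\<Phi> y t - \<Phi> y' t)"])
    fix t :: complex assume t: "t \<in> ball 0 \<rho>"
    have "dist (\<Phi> y t) (\<Phi> y' t) < 2 * R"
      by (rule dist_triangle_half_l[of _ p]) (use \<Phi> y t in \<open>auto simp: dist_commute\<close>)
    then show "norm (\<Phi> y t - \<Phi> y' t) \<le> 2*R" by (simp add: dist_norm)
  next
    fix s and t :: complex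
    assume s: "\<And>t. t \<in> ball 0 \<rho> \<Longrightarrow> norm (\<Phi> y t - \<Phi> y' t) \<le> s" and t: "t \<in> ball 0 \<rho>"
    have "s \<ge> 0" using order_trans[OF norm_ge_zero s[OF t]] .
    have "norm ((\<lambda>t. \<Phi> y t - \<Phi> y' t) t - (\<lambda>t. \<Phi> y t - \<Phi> y' t) 0) \<le> (B * s) * norm (t - 0)"
    proof (rule curve_bound[where S="ball 0 \<rho>" and d="\<lambda>t. V (\<Phi> y t) - V (\<Phi> y' t)"])
      fix u :: complex assume u: "u \<in> ball 0 \<rho>"
      show "((\<lambda>z. (\<Phi> y z - \<Phi> y' z) $ i) has_field_derivative (V (\<Phi> y u) - V (\<Phi> y' u)) $ i) (at u)" for i
        using \<Phi>[OF y(1)] \<Phi>[OF y(2)] u by (auto intro!: DERIV_diff)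
      show "norm (V (\<Phi> y u) - V (\<Phi> y' u)) \<le> B * s"
        using order_trans[OF lip mult_left_mono[OF s[OF u]]] \<Phi>[OF y(1)] \<Phi>[OF y(2)] u B by simp
    qed (use t \<rho> in auto)
    also have "\<dots> \<le> (B * s) * \<rho>" using t \<open>s \<ge> 0\<close> B by (intro mult_left_mono) auto
    also have "\<dots> = (B * \<rho>) * s" by simp
    also have "\<dots> \<le> 1/2 * s" using \<rho>(2) \<open>s \<ge> 0\<close> by (rule mult_right_mono)
    finally show "norm (\<Phi> y t - \<Phi> y' t) \<le> norm (y - y') + s/2"
      using \<Phi>[OF y(1)] \<Phi>[OF y(2)] norm_triangle_sub[of "\<Phi> y t - \<Phi> y' t" "y - y'"] by simp
  qed (use y in auto)
  show ?thesis
    by (rule that[of \<rho> r \<Phi>]) (use \<rho> R sub \<Phi> dep in \<open>auto simp: r_def\<close>)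
qed

section \<open>Lifting maps of discs\<close>

lemma eq_on_connected:
  fixes p q :: "'a::topological_space \<Rightarrow> 'b::t2_space"
  assumes "connected S" "continuous_on S p" "continuous_on S q" and a: "a \<in> S" "p a = q a" and "w \<in> S"
    and loc: "\<And>x. x \<in> S \<Longrightarrow> p x = q x \<Longrightarrow> \<exists>N. openin (top_of_set S) N \<and> x \<in> N \<and> (\<forall>z\<in>N. p z = q z)"
  shows "p w = q w"
proof -
  let ?Z = "{w \<in> S. p w = q w}"
  have "openin (top_of_set S) ?Z"
  proof (subst openin_subopen, intro ballI)
    fix x assume "x \<in> ?Z"
    then obtain N where N: "openin (top_of_set S) N" "x \<in> N" "\<forall>z\<in>N. p z = q z" using loc by blast
    moreover have "N \<subseteq> ?Z" using N openin_imp_subset by blast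
    ultimately show "\<exists>N. openin (top_of_set S) N \<and> x \<in> N \<and> N \<subseteq> ?Z" by blast
  qed
  moreover have "closedin (top_of_set S) ?Z"
  proof -
    have "closedin (top_of_set S) (S \<inter> (\<lambda>w. (p w, q w)) -` {z. \<exists>x. z = (x, x)})"
      by (intro continuous_closedin_preimage continuous_on_Pair assms closed_diagonal)
    moreover have "S \<inter> (\<lambda>w. (p w, q w)) -` {z. \<exists>x. z = (x, x)} = ?Z" by auto
    ultimately show ?thesis by simp
  qed
  ultimately have "?Z = S" using assms(1) a unfolding connected_clopen by blast
  then show ?thesis using \<open>w \<in> S\<close> by auto
qed

text \<open>Local injectivity of \<alpha> on T replaces evenly covered neighbourhoods, so the lemma
  also applies to maps that are not known to be coverings.\<close>

lemma lift_unique: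
  fixes p q :: "'a::topological_space \<Rightarrow> 'b::t2_space"
  assumes "connected S" "continuous_on S p" "continuous_on S q" "p ` S \<subseteq> T" "q ` S \<subseteq> T"
    and inj: "\<And>x. x \<in> T \<Longrightarrow> \<exists>N. open N \<and> x \<in> N \<and> inj_on \<alpha> (N \<inter> T)"
    and eq: "\<And>w. w \<in> S \<Longrightarrow> \<alpha> (p w) = \<alpha> (q w)" and a: "a \<in> S" "p a = q a" and "w \<in> S"
  shows "p w = q w"
proof (rule eq_on_connected[where p=p and q=q, OF assms(1-3) a \<open>w \<in> S\<close>])
  fix x assume x: "x \<in> S" "p x = q x"
  then obtain N where N: "open N" "p x \<in> N" "inj_on \<alpha> (N \<inter> T)" using inj assms(4) by blast
  let ?O = "(S \<inter> p -` N) \<inter> (S \<inter> q -` N)"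
  have "openin (top_of_set S) ?O"
    by (intro openin_Int continuous_openin_preimage_gen assms N)
  moreover have "x \<in> ?O" using x N by auto
  moreover have "p y = q y" if "y \<in> ?O" for y
  proof -
    have "p y \<in> N \<inter> T" "q y \<in> N \<inter> T" "y \<in> S" using that assms(4,5) by auto
    then show ?thesis using inj_onD[OF N(3) eq] by auto
  qed
  ultimately show "\<exists>N. openin (top_of_set S) N \<and> x \<in> N \<and> (\<forall>z\<in>N. p z = q z)" by blast
qed

definition lift_on :: "('b::topological_space \<Rightarrow> 'c) \<Rightarrow> 'b set \<Rightarrow> ('a::topological_space \<Rightarrow> 'c) \<Rightarrow> 'a set \<Rightarrow> ('a \<Rightarrow> 'b) \<Rightarrow> bool" where
  "lift_on \<alpha> T f B \<psi> \<longleftrightarrow> continuous_on B \<psi> \<and> \<psi> ` B \<subseteq> T \<and> (\<forall>w\<in>B. \<alpha> (\<psi> w) = f w)"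

lemma glue_lifts:
  fixes \<psi> :: "'i \<Rightarrow> 'a::topological_space \<Rightarrow> 'b::t2_space"
  assumes op: "\<And>i. i \<in> I \<Longrightarrow> open (B i)" and S: "S = (\<Union>i\<in>I. B i)"
    and lift: "\<And>i. i \<in> I \<Longrightarrow> lift_on \<alpha> T f (B i) (\<psi> i)"
    and agree: "\<And>i j w. i \<in> I \<Longrightarrow> j \<in> I \<Longrightarrow> w \<in> B i \<Longrightarrow> w \<in> B j \<Longrightarrow> \<psi> i w = \<psi> j w"
  obtains g where "lift_on \<alpha> T f S g" "\<And>i w. i \<in> I \<Longrightarrow> w \<in> B i \<Longrightarrow> g w = \<psi> i w"
proof -
  note lift = lift[unfolded lift_on_def]
  have inS: "B i \<subseteq> S" if "i \<in> I" for i using S that by blast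
  obtain g where g: "continuous_map (top_of_set S) euclidean g"
     and geq: "\<And>x i. \<lbrakk>i \<in> I; x \<in> topspace (top_of_set S) \<inter> B i\<rbrakk> \<Longrightarrow> g x = \<psi> i x"
  proof (rule pasting_lemma_exists[where X="top_of_set S" and I=I and T=B and Y=euclidean and f=\<psi>])
    show "topspace (top_of_set S) \<subseteq> \<Union> (B ` I)" using S by simp
    show "openin (top_of_set S) (B i)" if "i \<in> I" for i using op inS that by (simp add: open_subset)
    show "continuous_map (subtopology (top_of_set S) (B i)) euclidean (\<psi> i)" if "i \<in> I" for i
      using lift[OF that] inS[OF that] by (simp add: subtopology_subtopology Int_absorb1)
    show "\<psi> i x = \<psi> j x" if "i \<in> I" "j \<in> I" "x \<in> topspace (top_of_set S) \<inter> B i \<inter> B j" for i j x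
      using that by (intro agree) simp_all
  qed (rule that)
  have geq': "g w = \<psi> i w" if "i \<in> I" "w \<in> B i" for i w using geq[OF that(1)] that inS by auto
  show ?thesis
  proof (rule that)
    have "g ` S \<subseteq> T" using lift geq' S by fastforce
    moreover have "\<alpha> (g w) = f w" if "w \<in> S" for w using that lift geq' S by fastforce
    ultimately show "lift_on \<alpha> T f S g" using g by (simp add: lift_on_def)
  qed (use geq' in blast)
qed

text \<open>A lift on a disc of radius \<open>s < r\<close> extends: local lifts of a uniform radius, centred at points of
  modulus at most \<open>s - \<delta>/2\<close>, agree at the midpoint of their centres whenever they overlap.\<close>

lemma disc_lifting:
  fixes f :: "complex \<Rightarrow> 'a" and \<alpha> :: "'b::t2_space \<Rightarrow> 'a"
  assumes loc: "\<And>w0. w0 \<in> ball 0 r \<Longrightarrow> \<exists>\<epsilon>>0. ball w0 \<epsilon> \<subseteq> ball 0 r \<and>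
      (\<forall>w\<in>ball w0 \<epsilon>. \<forall>x\<in>T. \<alpha> x = f w \<longrightarrow> (\<exists>\<psi>. lift_on \<alpha> T f (ball w0 \<epsilon>) \<psi> \<and> \<psi> w = x))"
    and inj: "\<And>x. x \<in> T \<Longrightarrow> \<exists>N. open N \<and> x \<in> N \<and> inj_on \<alpha> (N \<inter> T)"
    and "x0 \<in> T" "\<alpha> x0 = f 0" "r > 0"
  obtains \<beta> where "lift_on \<alpha> T f (ball 0 r) \<beta>" "\<beta> 0 = x0"
proof -
  note L_def = lift_on_def[of \<alpha> T f]
  let ?L = "lift_on \<alpha> T f"
  define P where "P = (\<lambda>R \<psi>. ?L (ball 0 R) \<psi> \<and> \<psi> 0 = x0)"
  have uniq: "\<psi> w = \<psi>' w" if "?L B \<psi>" "?L B' \<psi>'" "connected S" "S \<subseteq> B" "S \<subseteq> B'" "a \<in> S" "\<psi> a = \<psi>' a" "w \<in> S"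
    for B B' S \<psi> \<psi>' a w
  proof (rule lift_unique[where \<alpha>=\<alpha> and T=T and p=\<psi> and q=\<psi>', OF that(3) _ _ _ _ inj _ that(6,7,8)])
    show "continuous_on S \<psi>" "continuous_on S \<psi>'" using that(1-5) unfolding L_def by (meson continuous_on_subset)+
    show "\<psi> ` S \<subseteq> T" "\<psi>' ` S \<subseteq> T" "\<And>w. w \<in> S \<Longrightarrow> \<alpha> (\<psi> w) = \<alpha> (\<psi>' w)"
      using that(1,2,4,5) unfolding L_def by (blast, blast, auto simp: subset_iff)
  qed
  \<comment> \<open>Radii of the discs around 0 that carry a lift with the prescribed value at 0.
    Their supremum s is attained by gluing, and s = r follows because such a lift could otherwise be
    extended.\<close>
  define I where "I = {R. 0 < R \<and> R \<le> r \<and> (\<exists>\<psi>. P R \<psi>)}"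
  define s where "s = Sup I"
  obtain e where e: "e > 0" "ball (0::complex) e \<subseteq> ball 0 r" "\<exists>\<psi>. P e \<psi>"
  proof -
    have "(0::complex) \<in> ball 0 r" using assms(5) by simp
    from loc[OF this] obtain e where e: "e > 0" "ball (0::complex) e \<subseteq> ball 0 r" and
      *: "\<forall>w\<in>ball 0 e. \<forall>x\<in>T. \<alpha> x = f w \<longrightarrow> (\<exists>\<psi>. ?L (ball 0 e) \<psi> \<and> \<psi> w = x)"
      by (elim exE conjE) (rule that)
    have "\<exists>\<psi>. P e \<psi>"
    proof -
      have "0 \<in> ball (0::complex) e" using e(1) by simp
      from *[rule_format, OF this assms(3,4)] obtain \<psi> where "?L (ball 0 e) \<psi>" "\<psi> 0 = x0"
        by blast
      then show ?thesis unfolding P_def by blast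
    qed
    then show ?thesis using e that by blast
  qed
  have "e \<le> r"
  proof -
    have "ball (0::complex) e \<subseteq> ball 0 r" using e by simp
    then show ?thesis using e(1) by (simp add: ball_subset_ball_iff)
  qed
  then have eI: "e \<in> I" using e by (auto simp: I_def)
  have bdd: "bdd_above I" by (rule bdd_aboveI[of _ r]) (auto simp: I_def)
  have s: "0 < s" "s \<le> r"
    using cSup_upper[OF eI bdd] e(1) eI unfolding s_def by (auto intro: cSup_least simp: I_def)
  have "\<forall>R\<in>I. \<exists>\<psi>. P R \<psi>" by (simp add: I_def)
  then obtain \<psi> where \<psi>: "\<And>R. R \<in> I \<Longrightarrow> P R (\<psi> R)" by metis
  have I0: "R > 0" if "R \<in> I" for R using that by (auto simp: I_def)
  have union: "ball (0::complex) s = (\<Union>R\<in>I. ball 0 R)"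
  proof (intro equalityI subsetI)
    fix w :: complex assume "w \<in> ball 0 s"
    then show "w \<in> (\<Union>R\<in>I. ball 0 R)" using eI less_cSup_iff[of I "norm w"] bdd by (auto simp: s_def)
  next
    fix w :: complex assume "w \<in> (\<Union>R\<in>I. ball 0 R)"
    then show "w \<in> ball 0 s" using cSup_upper[OF _ bdd] unfolding s_def by fastforce
  qed
  obtain g where Lg: "?L (ball 0 s) g"
    and gv: "\<And>R w. R \<in> I \<Longrightarrow> w \<in> ball 0 R \<Longrightarrow> g w = \<psi> R w"
  proof (rule glue_lifts[where B="ball 0" and I=I and \<psi>=\<psi> and S="ball 0 s" and T=T and \<alpha>=\<alpha> and f=f])
    fix R R' :: real and w :: complex assume R: "R \<in> I" "R' \<in> I" "w \<in> ball 0 R" "w \<in> ball 0 R'"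
    show "\<psi> R w = \<psi> R' w"
    proof (rule uniq[where B="ball 0 R" and B'="ball 0 R'" and S="ball 0 R \<inter> ball 0 R'" and a=0])
      show "connected (ball (0::complex) R \<inter> ball 0 R')" by (intro convex_connected convex_Int convex_ball)
    qed (use R \<psi>[OF R(1)] \<psi>[OF R(2)] I0 in \<open>auto simp: P_def\<close>)
  qed (use union \<psi> in \<open>auto simp: P_def\<close>)
  have g0: "g 0 = x0" using gv[OF eI, of 0] e(1) \<psi>[OF eI] by (auto simp: P_def)
  note g = Lg[unfolded L_def]
  have "s = r"
  proof (rule ccontr)
    assume "s \<noteq> r"
    then have sr: "s < r" using s by simp
    \<comment> \<open>Discs on which a lift may start at any point of T over any of their points. A
      Lebesgue number of this cover of the compact disc of radius s gives one radius for all
      centres.\<close>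
    define C where "C = {ball w0 \<epsilon> | w0 \<epsilon>. w0 \<in> ball 0 r \<and> ball w0 \<epsilon> \<subseteq> ball 0 r \<and> \<epsilon> > 0 \<and>
      (\<forall>w\<in>ball w0 \<epsilon>. \<forall>x\<in>T. \<alpha> x = f w \<longrightarrow> (\<exists>\<psi>. ?L (ball w0 \<epsilon>) \<psi> \<and> \<psi> w = x))}"
    have "\<exists>e>0. \<forall>x\<in>cball 0 s. \<exists>G\<in>C. ball x e \<subseteq> G"
    proof (rule Heine_Borel_lemma[of "cball 0 s" C])
      show "cball 0 s \<subseteq> \<Union>C"
      proof
        fix w0 :: complex assume "w0 \<in> cball 0 s"
        then have "w0 \<in> ball 0 r" using sr by auto
        then obtain \<epsilon> where \<epsilon>: "\<epsilon> > 0" "ball w0 \<epsilon> \<subseteq> ball 0 r"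
          "\<forall>w\<in>ball w0 \<epsilon>. \<forall>x\<in>T. \<alpha> x = f w \<longrightarrow> (\<exists>\<psi>. ?L (ball w0 \<epsilon>) \<psi> \<and> \<psi> w = x)"
          using loc[of w0] by blast
        then have "ball w0 \<epsilon> \<in> C" unfolding C_def using \<open>w0 \<in> ball 0 r\<close> by blast
        then show "w0 \<in> \<Union>C" using \<epsilon>(1) by (meson UnionI centre_in_ball)
      qed
    qed (auto simp: C_def)
    then obtain \<delta>0 where \<delta>0: "\<delta>0 > 0" "\<And>x. x \<in> cball 0 s \<Longrightarrow> \<exists>G\<in>C. ball x \<delta>0 \<subseteq> G" by blast
    \<comment> \<open>The bound s keeps the radius \<open>s - \<delta>/2\<close> of J positive; the
      bound \<open>r - s\<close> keeps the extended disc of radius \<open>s + \<delta>/2\<close>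
      inside the given one.\<close>
    define \<delta> where "\<delta> = min \<delta>0 (min s (r - s))"
    have \<delta>: "\<delta> > 0" "\<delta> \<le> s" "\<delta> \<le> r - s" "\<delta> \<le> \<delta>0" using \<delta>0(1) s sr by (auto simp: \<delta>_def)
    define J where "J = cball (0::complex) (s - \<delta>/2)"
    have Js: "w \<in> ball 0 s" if "w \<in> J" for w using that \<delta> by (auto simp: J_def)
    have "\<exists>\<psi>. ?L (ball w \<delta>) \<psi> \<and> \<psi> w = g w" if w: "w \<in> J" for w
    proof -
      have ws: "w \<in> ball 0 s" using Js w .
      then have "w \<in> cball 0 s" by auto
      then obtain w0 \<epsilon> where *: "ball w \<delta>0 \<subseteq> ball w0 \<epsilon>"
        "\<forall>w\<in>ball w0 \<epsilon>. \<forall>x\<in>T. \<alpha> x = f w \<longrightarrow> (\<exists>\<psi>. ?L (ball w0 \<epsilon>) \<psi> \<and> \<psi> w = x)"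
        using \<delta>0(2)[of w] unfolding C_def by blast
      have "w \<in> ball w0 \<epsilon>" using *(1) \<delta>0(1) by (meson centre_in_ball subsetD)
      moreover have "g w \<in> T" "\<alpha> (g w) = f w" using g ws by auto
      ultimately obtain \<psi> where "?L (ball w0 \<epsilon>) \<psi>" "\<psi> w = g w" using * by blast
      moreover have "ball w \<delta> \<subseteq> ball w0 \<epsilon>" using *(1) \<delta>(4) subset_ball by blast
      ultimately show ?thesis unfolding L_def by (meson continuous_on_subset image_mono subset_trans subsetD)
    qed
    then obtain \<theta> where \<theta>: "\<And>w. w \<in> J \<Longrightarrow> ?L (ball w \<delta>) (\<theta> w)" "\<And>w. w \<in> J \<Longrightarrow> \<theta> w w = g w" by metis
    have \<theta>g: "\<theta> w m = g m" if "w \<in> J" "m \<in> ball w \<delta>" "m \<in> ball 0 s" for w m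
    proof (rule uniq[where B="ball w \<delta>" and B'="ball 0 s" and S="ball w \<delta> \<inter> ball 0 s" and a=w])
      show "connected (ball w \<delta> \<inter> ball 0 s)" by (intro convex_connected convex_Int convex_ball)
    qed (use that Js[OF that(1)] \<delta> \<theta> Lg in auto)
    have cover: "ball (0::complex) (s + \<delta>/2) = (\<Union>w\<in>J. ball w \<delta>)"
    proof (intro equalityI subsetI)
      fix w :: complex assume w: "w \<in> ball 0 (s + \<delta>/2)"
      show "w \<in> (\<Union>w\<in>J. ball w \<delta>)"
      proof (cases "w \<in> J")
        case True then show ?thesis using \<delta> by force
      next
        case False
        \<comment> \<open>Scales w radially onto the boundary circle of J, which brings it less than
          \<delta> away from a point of J.\<close>
        define t where "t = (s - \<delta>/2) / norm w"
        have n: "norm w > s - \<delta>/2" using False by (auto simp: J_def)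
        have nz: "norm w > 0" using n \<delta> by linarith
        have "norm (t *\<^sub>R w) = s - \<delta>/2" using nz \<delta> by (simp add: t_def)
        then have "t *\<^sub>R w \<in> J" by (simp add: J_def)
        moreover have "t *\<^sub>R w - w = (t - 1) *\<^sub>R w" by (simp add: algebra_simps)
        then have "dist (t *\<^sub>R w) w = \<bar>t - 1\<bar> * norm w" by (simp add: dist_norm)
        moreover have "t < 1" using n nz by (simp add: t_def)
        then have "\<bar>t - 1\<bar> * norm w = norm w - (s - \<delta>/2)" using nz by (simp add: t_def field_simps)
        ultimately show ?thesis using w by (intro UN_I[of "t *\<^sub>R w"]) auto
      qed
    next
      fix w :: complex assume "w \<in> (\<Union>w\<in>J. ball w \<delta>)"
      then obtain w' where "norm w' \<le> s - \<delta>/2" "dist w' w < \<delta>" by (auto simp: J_def)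
      then show "w \<in> ball 0 (s + \<delta>/2)" using norm_triangle_ineq2[of w w'] by (simp add: dist_norm norm_minus_commute)
    qed
    obtain k where k: "?L (ball 0 (s + \<delta>/2)) k" and kv: "\<And>R w. R \<in> J \<Longrightarrow> w \<in> ball R \<delta> \<Longrightarrow> k w = \<theta> R w"
    proof (rule glue_lifts[where B="\<lambda>w. ball w \<delta>" and I=J and \<psi>=\<theta> and S="ball 0 (s + \<delta>/2)" and T=T and \<alpha>=\<alpha> and f=f])
      fix a b w assume ab: "a \<in> J" "b \<in> J" "w \<in> ball a \<delta>" "w \<in> ball b \<delta>"
      define m where "m = midpoint a b"
      have "dist a b < 2 * \<delta>" by (rule dist_triangle_half_l[of _ w]) (use ab in \<open>auto simp: dist_commute\<close>)
      then have m: "m \<in> ball a \<delta>" "m \<in> ball b \<delta>" by (auto simp: m_def dist_midpoint)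
      have "m \<in> J" using ab norm_triangle_ineq[of a b] by (simp add: J_def m_def midpoint_def)
      then have "\<theta> a m = \<theta> b m" using \<theta>g ab m Js by metis
      moreover have "connected (ball a \<delta> \<inter> ball b \<delta>)" by (intro convex_connected convex_Int convex_ball)
      ultimately show "\<theta> a w = \<theta> b w"
        using uniq[OF \<theta>(1)[OF ab(1)] \<theta>(1)[OF ab(2)], of "ball a \<delta> \<inter> ball b \<delta>" m w] ab m by blast
    qed (use cover \<theta>(1) in auto)
    have "0 \<in> J" using \<delta> by (simp add: J_def)
    then have "k 0 = x0" using kv[of 0 0] \<theta>g[of 0 0] g0 \<delta>(1) s by auto
    then have "P (s + \<delta>/2) k" using k by (simp add: P_def)
    then have "s + \<delta>/2 \<in> I" using \<delta> s unfolding I_def by (auto intro!: exI[of _ k])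
    then show False using cSup_upper[OF _ bdd, of "s + \<delta>/2"] \<delta>(1) by (simp add: s_def)
  qed
  then show ?thesis using that Lg g0 by blast
qed

section \<open>Covering maps of abstract topologies\<close>

lemma covering_mapE:
  assumes "covering_map X p Y" "y \<in> topspace Y"
  obtains T \<V> where "openin Y T" "y \<in> T" "\<Union>\<V> = {x \<in> topspace X. p x \<in> T}"
    "\<And>V. V \<in> \<V> \<Longrightarrow> openin X V" "pairwise disjnt \<V>"
    "\<And>V. V \<in> \<V> \<Longrightarrow> homeomorphic_map (subtopology X V) (subtopology Y T) p"
  using assms(1)[unfolded covering_map_def, THEN conjunct2, THEN conjunct2, THEN bspec, OF assms(2)]
  by (elim exE conjE) (rule that, (assumption | erule (1) bspec)+)

lemma covering_map_local_inj:
  assumes "covering_map X p Y" "x \<in> topspace X"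
  obtains V where "openin X V" "x \<in> V" "inj_on p V"
proof -
  have px: "p x \<in> topspace Y" using assms unfolding covering_map_def by blast
  obtain W \<V> where W: "p x \<in> W" "\<Union>\<V> = {x \<in> topspace X. p x \<in> W}" "\<And>V. V \<in> \<V> \<Longrightarrow> openin X V"
      "\<And>V. V \<in> \<V> \<Longrightarrow> homeomorphic_map (subtopology X V) (subtopology Y W) p"
    by (rule covering_mapE[OF assms(1) px]) (rule that, assumption+)
  then obtain V where V: "V \<in> \<V>" "x \<in> V" using assms(2) by blast
  then have "V \<subseteq> topspace X" "openin X V" using W(3) openin_subset by blast+
  moreover have "inj_on p V"
    using homeomorphic_imp_injective_map[OF W(4)[OF V(1)]] \<open>V \<subseteq> topspace X\<close>
    by (simp add: Int_absorb1)
  ultimately show ?thesis using that V by blast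
qed

text \<open>Over an evenly covered set, f followed by the inverse of the sheet through x is a local
  lift through x; the sheets also give local injectivity. The base Y is an abstract topology because
  it will be a leaf with its leaf topology.\<close>

lemma covering_disc_lifting:
  fixes S :: "complex set" and f :: "complex \<Rightarrow> 'b"
  assumes cov: "covering_map (top_of_set S) p Y" and S: "open S"
    and f: "continuous_map (top_of_set (ball 0 r)) Y f" and "r > 0" "x0 \<in> S" "p x0 = f 0"
  obtains \<beta> where "lift_on p S f (ball 0 r) \<beta>" "\<beta> 0 = x0"
proof (rule disc_lifting[where r=r and T=S and \<alpha>=p and f=f and ?x0.0=x0])
  fix x assume "x \<in> S"
  then obtain V where V: "openin (top_of_set S) V" "x \<in> V" "inj_on p V"
    using covering_map_local_inj[OF cov] by auto
  then have "open V" using S openin_open_eq by blast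
  moreover have "inj_on p (V \<inter> S)" using V(3) by (rule inj_on_subset) auto
  ultimately show "\<exists>N. open N \<and> x \<in> N \<and> inj_on p (N \<inter> S)" using V by blast
next
  fix w0 :: complex assume w0: "w0 \<in> ball 0 r"
  then have fw0: "f w0 \<in> topspace Y" using f unfolding continuous_map_def by auto
  obtain T \<V> where T: "openin Y T" "f w0 \<in> T" "\<Union>\<V> = {x \<in> S. p x \<in> T}"
      "\<And>V. V \<in> \<V> \<Longrightarrow> openin (top_of_set S) V"
      "\<And>V. V \<in> \<V> \<Longrightarrow> homeomorphic_map (subtopology (top_of_set S) V) (subtopology Y T) p"
    by (rule covering_mapE[OF cov fw0, unfolded topspace_euclidean_subtopology]) (rule that, assumption+)
  have "openin (top_of_set (ball 0 r)) {w \<in> ball 0 r. f w \<in> T}"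
    using openin_continuous_map_preimage[OF f T(1)] by simp
  then have "open {w \<in> ball 0 r. f w \<in> T}" using openin_open_eq[OF open_ball] by blast
  then obtain e where e: "e > 0" "ball w0 e \<subseteq> {w \<in> ball 0 r. f w \<in> T}"
    using T(2) w0 by (metis (mono_tags, lifting) mem_Collect_eq openE)
  have "\<exists>\<psi>. lift_on p S f (ball w0 e) \<psi> \<and> \<psi> w = x"
    if w: "w \<in> ball w0 e" and x: "x \<in> S" "p x = f w" for w x
  proof -
    have "p x \<in> T" using e w x by auto
    then obtain V where V: "V \<in> \<V>" "x \<in> V" using T(3) x(1) by blast
    then have VS: "V \<subseteq> S" using T(4) openin_imp_subset by blast
    obtain g where g: "homeomorphic_maps (subtopology (top_of_set S) V) (subtopology Y T) p g"
      using T(5) V(1) homeomorphic_map_maps by blast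
    have g1: "continuous_map (subtopology Y T) (top_of_set V) g"
      using g VS by (simp add: homeomorphic_maps_def subtopology_subtopology Int_absorb1)
    have gp: "g (p y) = y" if "y \<in> V" for y using g that VS by (auto simp: homeomorphic_maps_def)
    have pg: "p (g y) = y" if "y \<in> T" for y
      using g that openin_subset[OF T(1)] by (auto simp: homeomorphic_maps_def)
    have "continuous_map (top_of_set (ball w0 e)) (subtopology Y T) f"
      using e(2) by (intro continuous_map_into_subtopology continuous_map_from_subtopology_mono[OF f]) auto
    then have c: "continuous_map (top_of_set (ball w0 e)) (top_of_set V) (g \<circ> f)"
      using g1 continuous_map_compose by blast
    show ?thesis
    proof (intro exI[of _ "g \<circ> f"] conjI)
      have "continuous_on (ball w0 e) (g \<circ> f)" "(g \<circ> f) ` ball w0 e \<subseteq> S" using c VS by auto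
      moreover have "p ((g \<circ> f) w') = f w'" if "w' \<in> ball w0 e" for w' using pg that e by auto
      ultimately show "lift_on p S f (ball w0 e) (g \<circ> f)" by (simp add: lift_on_def)
      show "(g \<circ> f) w = x" using gp[OF V(2)] x by simp
    qed
  qed
  then show "\<exists>\<epsilon>>0. ball w0 \<epsilon> \<subseteq> ball 0 r \<and> (\<forall>w\<in>ball w0 \<epsilon>. \<forall>x\<in>S. p x = f w \<longrightarrow>
      (\<exists>\<psi>. lift_on p S f (ball w0 \<epsilon>) \<psi> \<and> \<psi> w = x))"
    using e by (intro exI[of _ e]) auto
qed (use assms that in auto)

text \<open>The sheets of the composition are the preimages under m of the sheets of p. This allows
  a uniformization to be reparametrized by an automorphism of the disc.\<close>

lemma covering_map_compose_homeomorphic_map: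
  assumes cov: "covering_map X p Y" and m: "homeomorphic_map Z X m"
  shows "covering_map Z (p \<circ> m) Y"
proof -
  have cm: "continuous_map Z X m" "m ` topspace Z = topspace X"
    using m by (auto simp: homeomorphic_imp_continuous_map homeomorphic_imp_surjective_map)
  have "\<exists>T. openin Y T \<and> y \<in> T \<and> (\<exists>\<V>. \<Union>\<V> = {x \<in> topspace Z. (p \<circ> m) x \<in> T} \<and> (\<forall>V\<in>\<V>. openin Z V) \<and>
      pairwise disjnt \<V> \<and> (\<forall>V\<in>\<V>. homeomorphic_map (subtopology Z V) (subtopology Y T) (p \<circ> m)))"
    if y: "y \<in> topspace Y" for y
  proof -
    obtain T \<V> where T: "openin Y T" "y \<in> T" "\<Union>\<V> = {x \<in> topspace X. p x \<in> T}" "\<And>V. V \<in> \<V> \<Longrightarrow> openin X V"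
      "pairwise disjnt \<V>" "\<And>V. V \<in> \<V> \<Longrightarrow> homeomorphic_map (subtopology X V) (subtopology Y T) p"
      by (rule covering_mapE[OF cov y]) (rule that, assumption+)
    define pre where "pre = (\<lambda>V. {x \<in> topspace Z. m x \<in> V})"
    have "\<Union>(pre ` \<V>) = {x \<in> topspace Z. m x \<in> \<Union>\<V>}" by (auto simp: pre_def)
    also have "\<dots> = {x \<in> topspace Z. (p \<circ> m) x \<in> T}" using T(3) cm(2) by auto
    finally have 1: "\<Union>(pre ` \<V>) = {x \<in> topspace Z. (p \<circ> m) x \<in> T}" .
    have 2: "openin Z W" if "W \<in> pre ` \<V>" for W
      using that T(4) openin_continuous_map_preimage[OF cm(1)] by (auto simp: pre_def)
    have 3: "pairwise disjnt (pre ` \<V>)"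
      using T(5) by (auto simp: pairwise_def disjnt_def pre_def)
    have 4: "homeomorphic_map (subtopology Z W) (subtopology Y T) (p \<circ> m)" if W: "W \<in> pre ` \<V>" for W
    proof -
      obtain V where V: "V \<in> \<V>" "W = pre V" using W by blast
      have "V \<subseteq> topspace X" using V T(4) openin_subset by blast
      then have "m ` (topspace Z \<inter> W) = topspace X \<inter> V" using cm(2) V by (auto simp: pre_def)
      then have "homeomorphic_map (subtopology Z W) (subtopology X V) m"
        by (rule homeomorphic_map_subtopologies[OF m])
      then show ?thesis using T(6) V homeomorphic_map_compose by blast
    qed
    show ?thesis by (intro exI[of _ T] exI[of _ "pre ` \<V>"] conjI ballI T(1,2) 1 2 3 4)
  qed
  moreover have "continuous_map Z Y (p \<circ> m)"
    using cov[unfolded covering_map_def, THEN conjunct1] by (rule continuous_map_compose[OF cm(1)])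
  moreover have "(p \<circ> m) ` topspace Z = topspace Y"
    using cm(2) cov[unfolded covering_map_def, THEN conjunct2, THEN conjunct1] by (simp flip: image_image)
  ultimately show ?thesis unfolding covering_map_def by (intro conjI ballI)
qed

section \<open>Holomorphic curves in complex manifolds\<close>

text \<open>Continuity is demanded separately: the coordinate map is arbitrary outside the chart
  domain, so differentiable coordinates alone would not force f to stay in the chart near w.\<close>

definition has_velocity ::
  "(complex \<Rightarrow> 'm::topological_space) \<Rightarrow> ('m, 'n::finite) chart \<Rightarrow> complex^'n \<Rightarrow> complex \<Rightarrow> bool" where
  "has_velocity f c u w \<longleftrightarrow>
     isCont f w \<and> f w \<in> fst c \<and> (\<forall>i. ((\<lambda>z. snd c (f z) $ i) has_field_derivative u $ i) (at w))"

lemma has_velocity_cong: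
  assumes "has_velocity f c u w" "open S" "w \<in> S" "\<And>z. z \<in> S \<Longrightarrow> f z = f' z"
  shows "has_velocity f' c u w"
proof -
  have "isCont f w = isCont f' w"
    using assms(2-4) by (intro isCont_cong) (auto simp: eventually_nhds)
  moreover have "((\<lambda>z. snd c (f' z) $ i) has_field_derivative d) (at w)"
    if "((\<lambda>z. snd c (f z) $ i) has_field_derivative d) (at w)" for i d
    by (rule has_field_derivative_transform_within_open[OF that assms(2,3)]) (simp add: assms(4))
  ultimately show ?thesis using assms by (simp add: has_velocity_def)
qed

lemma has_velocity_comp:
  assumes "has_velocity f c u (\<beta> w)" "(\<beta> has_field_derivative b) (at w)"
  shows "has_velocity (\<lambda>z. f (\<beta> z)) c (b *s u) w"
  unfolding has_velocity_def
proof (intro conjI allI)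
  show "isCont (\<lambda>z. f (\<beta> z)) w"
    using assms DERIV_isCont isCont_o2 unfolding has_velocity_def by blast
  fix i
  have "((\<lambda>z. snd c (f z) $ i) has_field_derivative u $ i) (at (\<beta> w))"
    using assms(1) by (simp add: has_velocity_def)
  from DERIV_chain2[OF this assms(2)]
  show "((\<lambda>z. snd c (f (\<beta> z)) $ i) has_field_derivative (b *s u) $ i) (at w)"
    by (simp add: mult.commute)
qed (use assms in \<open>simp add: has_velocity_def\<close>)

lemma has_velocity_unique: "has_velocity f c u w \<Longrightarrow> has_velocity f c u' w \<Longrightarrow> u = u'"
  unfolding has_velocity_def vec_eq_iff using DERIV_unique by blast

lemma isCont_open_preimage:
  assumes "isCont f w" "open B" "f w \<in> B"
  obtains S where "open S" "w \<in> S" "\<And>z. z \<in> S \<Longrightarrow> f z \<in> B"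
  using assms by (auto simp: continuous_at_open)

abbreviation param :: "('m, 'n) chart \<Rightarrow> complex^'n \<Rightarrow> 'm" where
  "param c \<equiv> inv_into (fst c) (snd c)"

section \<open>Charts of the maximal atlas and velocities\<close>

locale complex_mfd =
  fixes A :: "('m::{t2_space,second_countable_topology}, 'n::finite) chart set"
  assumes atlas: "complex_atlas A"
begin

lemma atlas_subset_charts: "a \<in> A \<Longrightarrow> a \<in> charts A"
  using atlas by (simp add: charts_def insert_absorb)

lemma chart_exists: "\<exists>a\<in>A. p \<in> fst a"
proof -
  have "p \<in> (\<Union>(U, \<phi>)\<in>A. U)" using atlas by (simp add: complex_atlas_def)
  then show ?thesis by force
qed

lemma chart_homeomorphism:
  assumes "c \<in> charts A"
  shows "open (fst c)" "open (snd c ` fst c)" "homeomorphism (fst c) (snd c ` fst c) (snd c) (param c)"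
  using assms by (auto simp: charts_def complex_atlas_def split_beta)

lemma param_chart [simp]: "c \<in> charts A \<Longrightarrow> p \<in> fst c \<Longrightarrow> param c (snd c p) = p"
  using chart_homeomorphism(3) by (simp add: homeomorphism_def)

lemma chart_isCont: "c \<in> charts A \<Longrightarrow> p \<in> fst c \<Longrightarrow> isCont (snd c) p"
  using chart_homeomorphism(1,3) by (metis continuous_on_eq_continuous_at homeomorphism_cont1)

lemma param_isCont: "c \<in> charts A \<Longrightarrow> x \<in> snd c ` fst c \<Longrightarrow> isCont (param c) x"
  using chart_homeomorphism(2,3) by (metis continuous_on_eq_continuous_at homeomorphism_cont2)

lemma chart_image_open:
  assumes "c \<in> charts A" "open S"
  shows "open (snd c ` (fst c \<inter> S))"
proof -
  have "snd c ` (fst c \<inter> S) = (snd c ` fst c) \<inter> param c -` S"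
    using assms(1) by auto
  moreover have "open ((snd c ` fst c) \<inter> param c -` S)"
    using chart_homeomorphism[OF assms(1)] assms(2)
    by (intro continuous_open_preimage) (auto simp: homeomorphism_def)
  ultimately show ?thesis by simp
qed

lemma transition_holomorphic:
  assumes "c \<in> charts A" "a \<in> A"
  shows "holomorphic_Cn_on (\<lambda>x. snd a (param c x) $ i) (snd c ` (fst c \<inter> fst a))"
    "holomorphic_Cn_on (\<lambda>x. snd c (param a x) $ i) (snd a ` (fst a \<inter> fst c))"
  using assms by (auto simp: charts_def complex_atlas_def split_beta)

lemma transition_derivative_atlas:
  assumes "c \<in> charts A" "a \<in> A" "p \<in> fst c" "p \<in> fst a"
  obtains D where "((\<lambda>x. snd a (param c x)) has_derivative D) (at (snd c p))" "\<And>k v. D (k *s v) = k *s D v"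
proof -
  have "snd c p \<in> snd c ` (fst c \<inter> fst a)" using assms by blast
  then have "\<exists>D. ((\<lambda>x. snd a (param c x) $ i) has_derivative D) (at (snd c p)) \<and> (\<forall>k v. D (k *s v) = k * D v)" for i
    using transition_holomorphic(1)[OF assms(1,2), of i] unfolding holomorphic_Cn_on_def by blast
  then obtain D where D: "\<And>i. ((\<lambda>x. snd a (param c x) $ i) has_derivative D i) (at (snd c p))"
     "\<And>i k v. D i (k *s v) = k * D i v" by metis
  show ?thesis
  proof (rule that)
    show "((\<lambda>x. snd a (param c x)) has_derivative (\<lambda>h. \<chi> i. D i h)) (at (snd c p))"
      by (rule has_derivative_vec) (use D in simp)
  qed (simp add: D(2) vec_eq_iff)
qed

text \<open>\<open>holomorphic_fun_on\<close> speaks only of the charts in A, while generators live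
  in charts of the maximal atlas. The transition map to a chart of A around p bridges the
  two.\<close>

lemma holomorphic_fun_in_chart:
  assumes "holomorphic_fun_on A G W" "c \<in> charts A" "p \<in> fst c" "p \<in> W"
  obtains G' where "((\<lambda>x. G (param c x)) has_derivative G') (at (snd c p))" "\<And>k v. G' (k *s v) = k * G' v"
proof -
  obtain a where a: "a \<in> A" "p \<in> fst a" using chart_exists by blast
  have ac: "a \<in> charts A" using a by (simp add: atlas_subset_charts)
  obtain D where D: "((\<lambda>x. snd a (param c x)) has_derivative D) (at (snd c p))" "\<And>k v. D (k *s v) = k *s D v"
    using transition_derivative_atlas[OF assms(2) a(1) assms(3) a(2)] by blast
  have "holomorphic_Cn_on (G \<circ> param a) (snd a ` (fst a \<inter> W))"
    using assms(1) a unfolding holomorphic_fun_on_def by (auto simp: split_beta)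
  moreover have "snd a p \<in> snd a ` (fst a \<inter> W)" using a assms by blast
  ultimately obtain H where H: "((G \<circ> param a) has_derivative H) (at (snd a p))" "\<And>k v. H (k *s v) = k * H v"
    unfolding holomorphic_Cn_on_def by blast
  have "((\<lambda>x. (G \<circ> param a) (snd a (param c x))) has_derivative (\<lambda>h. H (D h))) (at (snd c p))"
    by (rule has_derivative_compose[OF D(1)]) (use H(1) assms in \<open>simp add: o_def\<close>)
  then have "((\<lambda>x. G (param c x)) has_derivative (\<lambda>h. H (D h))) (at (snd c p))"
    by (rule has_derivative_transform_within_open[OF _ chart_image_open[OF assms(2) chart_homeomorphism(1)[OF ac]]])
      (use assms a ac in auto)
  then show ?thesis using that D(2) H(2) by simp
qed

lemma chart_holomorphic: "c \<in> charts A \<Longrightarrow> holomorphic_fun_on A (\<lambda>p. snd c p $ i) (fst c)"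
  using transition_holomorphic(2)[of c _ i] unfolding holomorphic_fun_on_def by (auto simp: o_def)

lemma coord_change_derivative:
  assumes "c \<in> charts A" "d \<in> charts A" "p \<in> fst c" "p \<in> fst d"
  shows "((\<lambda>x. snd d (param c x)) has_derivative coord_change c d p) (at (snd c p))"
    "coord_change c d p (k *s v) = k *s coord_change c d p v"
proof -
  have "\<exists>D. ((\<lambda>x. snd d (param c x) $ i) has_derivative D) (at (snd c p)) \<and> (\<forall>k v. D (k *s v) = k * D v)" for i
    using holomorphic_fun_in_chart[OF chart_holomorphic[OF assms(2)] assms(1,3,4)] by metis
  then obtain D where D: "\<And>i. ((\<lambda>x. snd d (param c x) $ i) has_derivative D i) (at (snd c p))"
     "\<And>i k v. D i (k *s v) = k * D i v" by metis
  have D': "((\<lambda>x. snd d (param c x)) has_derivative (\<lambda>h. \<chi> i. D i h)) (at (snd c p))"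
    by (rule has_derivative_vec) (use D in simp)
  then have eq: "coord_change c d p = (\<lambda>h. \<chi> i. D i h)"
    unfolding coord_change_def o_def by (rule frechet_derivative_at[symmetric])
  show "((\<lambda>x. snd d (param c x)) has_derivative coord_change c d p) (at (snd c p))"
    using D' unfolding eq .
  show "coord_change c d p (k *s v) = k *s coord_change c d p v"
    unfolding eq by (simp add: D(2) vec_eq_iff)
qed

lemma velocity_holomorphic_fun:
  assumes "has_velocity f c u w" "c \<in> charts A" "((\<lambda>x. G (param c x)) has_derivative G') (at (snd c (f w)))"
    "\<And>k v. G' (k *s v) = k * G' v"
  shows "((\<lambda>z. G (f z)) has_field_derivative G' u) (at w)"
proof -
  have f: "isCont f w" "f w \<in> fst c" "\<And>i. ((\<lambda>z. snd c (f z) $ i) has_field_derivative u $ i) (at w)"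
    using assms(1) by (auto simp: has_velocity_def)
  obtain S where S: "open S" "w \<in> S" "\<And>z. z \<in> S \<Longrightarrow> f z \<in> fst c"
    using isCont_open_preimage[OF f(1) chart_homeomorphism(1)[OF assms(2)] f(2)] by blast
  have "((\<lambda>z. G (param c (snd c (f z)))) has_field_derivative G' u) (at w)"
    by (rule has_field_derivative_chain_Cn[where G="\<lambda>x. G (param c x)" and y="\<lambda>z. snd c (f z)"])
      (use assms f in auto)
  then show ?thesis
    by (rule has_field_derivative_transform_within_open[OF _ S(1,2)]) (use S(3) assms(2) in auto)
qed

lemma velocity_holomorphic_fun_differentiable:
  assumes "has_velocity f c u w" "c \<in> charts A" "holomorphic_fun_on A G W" "f w \<in> W"
  shows "(\<lambda>z. G (f z)) field_differentiable at w"
proof -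
  have "f w \<in> fst c" using assms(1) by (simp add: has_velocity_def)
  from holomorphic_fun_in_chart[OF assms(3,2) this assms(4)] velocity_holomorphic_fun[OF assms(1,2)]
  show ?thesis unfolding field_differentiable_def by metis
qed

lemma velocity_coord_change:
  assumes "has_velocity f c u w" "c \<in> charts A" "d \<in> charts A" "f w \<in> fst d"
  shows "has_velocity f d (coord_change c d (f w) u) w"
proof -
  have f: "isCont f w" "f w \<in> fst c" using assms(1) by (auto simp: has_velocity_def)
  have D: "((\<lambda>x. snd d (param c x)) has_derivative coord_change c d (f w)) (at (snd c (f w)))"
    by (rule coord_change_derivative(1)[OF assms(2,3) f(2) assms(4)])
  have "((\<lambda>z. snd d (f z) $ i) has_field_derivative coord_change c d (f w) u $ i) (at w)" for i
    by (rule velocity_holomorphic_fun[OF assms(1,2), where G="\<lambda>p. snd d p $ i" and G'="\<lambda>h. coord_change c d (f w) h $ i"])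
       (use bounded_linear.has_derivative[OF bounded_linear_vec_nth D] coord_change_derivative(2)[OF assms(2,3) f(2) assms(4)] in auto)
  then show ?thesis using assms(4) f by (simp add: has_velocity_def)
qed

lemma holomorphic_fun_isCont:
  assumes "holomorphic_fun_on A G W" "p \<in> W"
  shows "isCont G p"
proof -
  obtain a where a: "a \<in> A" "p \<in> fst a" using chart_exists by blast
  have ac: "a \<in> charts A" using a by (simp add: atlas_subset_charts)
  obtain G' where "((\<lambda>x. G (param a x)) has_derivative G') (at (snd a p))"
    by (rule holomorphic_fun_in_chart[OF assms(1) ac a(2) assms(2)])
  then have "isCont (\<lambda>x. G (param a x)) (snd a p)" by (rule has_derivative_continuous)
  then have "isCont (\<lambda>q. G (param a (snd a q))) p"
    by (rule isCont_o2[OF chart_isCont[OF ac a(2)]])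
  moreover have "isCont (\<lambda>q. G (param a (snd a q))) p = isCont G p"
    by (rule isCont_cong, rule eventually_mono[OF eventually_nhds_in_open[OF chart_homeomorphism(1)[OF ac] a(2)]])
       (simp add: ac)
  ultimately show ?thesis by simp
qed

text \<open>Once f is known to stay in the chart, its continuity follows from that of its
  coordinates, since f is \<open>param c\<close> applied to them. Integral curves are defined by
  coordinates alone and get their continuity here.\<close>

lemma velocity_from_coords:
  assumes "c \<in> charts A" "open S" "\<And>z. z \<in> S \<Longrightarrow> f z \<in> fst c"
    "\<And>z i. z \<in> S \<Longrightarrow> ((\<lambda>z. snd c (f z) $ i) has_field_derivative u z $ i) (at z)" "w \<in> S"
  shows "has_velocity f c (u w) w"
proof -
  have "isCont (\<lambda>z. snd c (f z)) w"
    by (rule has_derivative_continuous[OF has_derivative_curve]) (rule assms(4)[OF assms(5)])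
  moreover have "isCont (param c) (snd c (f w))" using assms by (intro param_isCont) auto
  ultimately have "isCont (\<lambda>z. param c (snd c (f z))) w" by (rule isCont_o2)
  moreover have "isCont (\<lambda>z. param c (snd c (f z))) w = isCont f w"
    by (rule isCont_cong, rule eventually_mono[OF eventually_nhds_in_open[OF assms(2,5)]])
       (simp add: assms(1,3))
  ultimately show ?thesis using assms by (simp add: has_velocity_def)
qed

section \<open>Holomorphic and immersed curves\<close>

definition hol_curve :: "(complex \<Rightarrow> 'm) \<Rightarrow> complex set \<Rightarrow> bool" where
  "hol_curve f S \<longleftrightarrow> (\<forall>w\<in>S. \<exists>c\<in>charts A. \<exists>u. has_velocity f c u w)"

lemma hol_curve_velocity:
  assumes "hol_curve f S" "w \<in> S" "c \<in> charts A" "f w \<in> fst c"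
  obtains u where "has_velocity f c u w"
  using assms velocity_coord_change unfolding hol_curve_def by meson

lemma hol_curve_isCont: "hol_curve f S \<Longrightarrow> w \<in> S \<Longrightarrow> isCont f w"
  unfolding hol_curve_def has_velocity_def by blast

lemma hol_curve_continuous_on: "hol_curve f S \<Longrightarrow> continuous_on S f"
  by (simp add: hol_curve_isCont continuous_at_imp_continuous_on)

lemma hol_curve_holomorphic:
  assumes "hol_curve f S" "open S" "holomorphic_fun_on A G W" "\<And>z. z \<in> S \<Longrightarrow> f z \<in> W"
  shows "(\<lambda>z. G (f z)) holomorphic_on S"
proof (rule holomorphic_onI)
  fix z assume z: "z \<in> S"
  then obtain c u where "c \<in> charts A" "has_velocity f c u z" using assms(1) unfolding hol_curve_def by blast
  then have "(\<lambda>z. G (f z)) field_differentiable at z"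
    using velocity_holomorphic_fun_differentiable assms(3,4) z by blast
  then show "(\<lambda>z. G (f z)) field_differentiable at z within S" by (rule field_differentiable_at_within)
qed

lemma hol_curve_subset: "hol_curve f S \<Longrightarrow> T \<subseteq> S \<Longrightarrow> hol_curve f T"
  unfolding hol_curve_def by blast

lemma hol_curve_compose:
  assumes "hol_curve f S" "\<beta> holomorphic_on T" "open T" "\<beta> ` T \<subseteq> S"
  shows "hol_curve (\<lambda>z. f (\<beta> z)) T"
  unfolding hol_curve_def
proof
  fix w assume w: "w \<in> T"
  then obtain c u where "c \<in> charts A" "has_velocity f c u (\<beta> w)" using assms unfolding hol_curve_def by blast
  moreover have "(\<beta> has_field_derivative deriv \<beta> w) (at w)" using assms w holomorphic_derivI by blast
  ultimately show "\<exists>c\<in>charts A. \<exists>u. has_velocity (\<lambda>z. f (\<beta> z)) c u w" using has_velocity_comp by blast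
qed

text \<open>On the right, a single compatible chart around each value suffices; on the left, all
  charts of A are tested. The change of coordinates of velocities makes up the difference.\<close>

lemma holomorphic_disc_iff: "holomorphic_disc A f \<longleftrightarrow> hol_curve f unit_disc"
proof
  assume f: "holomorphic_disc A f"
  show "hol_curve f unit_disc"
    unfolding hol_curve_def
  proof
    fix w :: complex assume w: "w \<in> unit_disc"
    obtain a where a: "a \<in> A" "f w \<in> fst a" using chart_exists by blast
    have ac: "a \<in> charts A" using a by (simp add: atlas_subset_charts)
    have c: "continuous_on unit_disc f" using f by (simp add: holomorphic_disc_def)
    have "open (unit_disc \<inter> f -` fst a)"
      by (rule continuous_open_preimage[OF c open_ball chart_homeomorphism(1)[OF ac]])
    moreover have "unit_disc \<inter> f -` fst a = {z \<in> unit_disc. f z \<in> fst a}" by blast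
    ultimately have op: "open {z \<in> unit_disc. f z \<in> fst a}" by simp
    have "(\<lambda>z. snd a (f z) $ i) holomorphic_on {z \<in> unit_disc. f z \<in> fst a}" for i
      using f a(1) unfolding holomorphic_disc_def by (auto simp: split_beta)
    then have "((\<lambda>z. snd a (f z) $ i) has_field_derivative deriv (\<lambda>z. snd a (f z) $ i) w) (at w)" for i
      using holomorphic_derivI op a(2) w by blast
    moreover have "isCont f w" using c w by (simp add: continuous_on_eq_continuous_at)
    ultimately have "has_velocity f a (\<chi> i. deriv (\<lambda>z. snd a (f z) $ i) w) w"
      using a by (simp add: has_velocity_def)
    then show "\<exists>c\<in>charts A. \<exists>u. has_velocity f c u w" by (intro bexI[OF _ ac] exI)
  qed
next
  assume f: "hol_curve f unit_disc"
  have "(\<lambda>z. snd c (f z) $ i) holomorphic_on {z \<in> unit_disc. f z \<in> fst c}" if c: "c \<in> A" for c i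
  proof (rule holomorphic_onI)
    fix w assume w: "w \<in> {z \<in> unit_disc. f z \<in> fst c}"
    then obtain u where "has_velocity f c u w" using hol_curve_velocity[OF f] atlas_subset_charts[OF c] by blast
    then show "(\<lambda>z. snd c (f z) $ i) field_differentiable at w within {z \<in> unit_disc. f z \<in> fst c}"
      unfolding has_velocity_def using field_differentiable_at_within field_differentiable_def by blast
  qed
  then show "holomorphic_disc A f"
    using hol_curve_continuous_on[OF f] unfolding holomorphic_disc_def by auto
qed

text \<open>Some component j of the velocity is nonzero, and the one-variable inverse function
  theorem applies to the j-th coordinate of f. The inverse g recovers the parameter from the
  position, and is the tool by which curves in a plaque are factored.\<close>

lemma curve_coordinate_inverse:
  assumes "hol_curve f S" "open S" "w0 \<in> S" "c \<in> charts A" "has_velocity f c u w0" "u \<noteq> 0"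
  obtains \<rho> j g where "\<rho> > 0" "ball w0 \<rho> \<subseteq> S" "\<And>z. z \<in> ball w0 \<rho> \<Longrightarrow> f z \<in> fst c"
    "open ((\<lambda>z. snd c (f z) $ j) ` ball w0 \<rho>)" "g holomorphic_on ((\<lambda>z. snd c (f z) $ j) ` ball w0 \<rho>)"
    "\<And>z. z \<in> ball w0 \<rho> \<Longrightarrow> g (snd c (f z) $ j) = z"
proof -
  obtain j where j: "u $ j \<noteq> 0" using assms(6) by (auto simp: vec_eq_iff)
  let ?k = "\<lambda>z. snd c (f z) $ j"
  obtain S1 where S1: "open S1" "w0 \<in> S1" "\<And>z. z \<in> S1 \<Longrightarrow> f z \<in> fst c"
    using isCont_open_preimage[where f=f and w=w0 and B="fst c"] assms(5) chart_homeomorphism(1)[OF assms(4)]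
    unfolding has_velocity_def by blast
  have k: "?k holomorphic_on S \<inter> S1"
    using hol_curve_holomorphic[OF hol_curve_subset[OF assms(1)] _ chart_holomorphic[OF assms(4)], of "S \<inter> S1"] S1 assms(2)
    by auto
  have "deriv ?k w0 = u $ j" using assms(5) unfolding has_velocity_def by (blast intro: DERIV_imp_deriv)
  with j have "deriv ?k w0 \<noteq> 0" by simp
  then obtain \<rho> where \<rho>: "\<rho> > 0" "ball w0 \<rho> \<subseteq> S \<inter> S1" "open (?k ` ball w0 \<rho>)" "inj_on ?k (ball w0 \<rho>)"
    using has_complex_derivative_locally_invertible[OF k, of w0] assms S1 by blast
  obtain g where g: "g holomorphic_on (?k ` ball w0 \<rho>)" "\<And>z. z \<in> ball w0 \<rho> \<Longrightarrow> g (?k z) = z"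
    by (rule holomorphic_has_inverse[OF holomorphic_on_subset[OF k \<rho>(2)] open_ball \<rho>(4)], rule that)
  show ?thesis by (rule that[OF \<rho>(1) _ _ \<rho>(3) g]) (use \<rho>(2) S1(3) in auto)
qed

definition immersed :: "(complex \<Rightarrow> 'm) \<Rightarrow> complex set \<Rightarrow> bool" where
  "immersed f S \<longleftrightarrow> (\<forall>w\<in>S. \<exists>c\<in>charts A. \<exists>u. u \<noteq> 0 \<and> has_velocity f c u w)"

lemma immersed_imp_hol_curve: "immersed f S \<Longrightarrow> hol_curve f S"
  unfolding immersed_def hol_curve_def by blast

lemma immersed_local_inj:
  assumes "immersed f S" "open S" "x \<in> S"
  shows "\<exists>N. open N \<and> x \<in> N \<and> inj_on f (N \<inter> S)"
proof -
  obtain c u where "c \<in> charts A" "u \<noteq> 0" "has_velocity f c u x" using assms unfolding immersed_def by blast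
  from curve_coordinate_inverse[OF immersed_imp_hol_curve[OF assms(1)] assms(2,3) this(1,3,2)]
  obtain \<rho> j g where g: "\<rho> > 0" "\<And>z. z \<in> ball x \<rho> \<Longrightarrow> g (snd c (f z) $ j) = z" by metis
  then have "inj_on f (ball x \<rho>)" by (metis inj_onI)
  then show ?thesis using g(1) by (intro exI[of _ "ball x \<rho>"]) (auto intro: inj_on_subset)
qed

text \<open>Near w the continuous lift \<beta> equals g applied to the j-th coordinate of f, with g
  the local coordinate inverse of \<alpha> at \<open>\<beta> w\<close>; hence it is
  differentiable.\<close>

lemma lift_holomorphic:
  assumes \<alpha>: "immersed \<alpha> S" "open S" and f: "hol_curve f T" "open T"
    and \<beta>: "continuous_on T \<beta>" "\<beta> ` T \<subseteq> S" "\<And>w. w \<in> T \<Longrightarrow> \<alpha> (\<beta> w) = f w"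
  shows "\<beta> holomorphic_on T"
proof (rule holomorphic_onI)
  fix w assume w: "w \<in> T"
  then have bw: "\<beta> w \<in> S" using \<beta> by blast
  then obtain c u where c: "c \<in> charts A" "u \<noteq> 0" "has_velocity \<alpha> c u (\<beta> w)" using \<alpha> unfolding immersed_def by blast
  obtain \<rho> j g where g: "\<rho> > 0" "ball (\<beta> w) \<rho> \<subseteq> S" "\<And>z. z \<in> ball (\<beta> w) \<rho> \<Longrightarrow> \<alpha> z \<in> fst c"
    "open ((\<lambda>z. snd c (\<alpha> z) $ j) ` ball (\<beta> w) \<rho>)" "g holomorphic_on ((\<lambda>z. snd c (\<alpha> z) $ j) ` ball (\<beta> w) \<rho>)"
    "\<And>z. z \<in> ball (\<beta> w) \<rho> \<Longrightarrow> g (snd c (\<alpha> z) $ j) = z"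
    by (rule curve_coordinate_inverse[OF immersed_imp_hol_curve[OF \<alpha>(1)] \<alpha>(2) bw c(1,3,2)], rule that)
  have "isCont \<beta> w" using \<beta>(1) f(2) w by (simp add: continuous_on_eq_continuous_at)
  then obtain N where N: "open N" "w \<in> N" "\<And>z. z \<in> N \<Longrightarrow> \<beta> z \<in> ball (\<beta> w) \<rho>"
    using isCont_open_preimage[where f=\<beta> and w=w and B="ball (\<beta> w) \<rho>"] g(1) by auto
  have eq: "g (snd c (f z) $ j) = \<beta> z" if "z \<in> N \<inter> T" for z using g(6)[OF N(3)[of z]] \<beta>(3)[of z] that by simp
  have "f w \<in> fst c" using g(1) g(3)[of "\<beta> w"] \<beta>(3)[OF w] by auto
  then obtain u' where "has_velocity f c u' w" using hol_curve_velocity[OF f(1) w c(1)] by blast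
  then have 1: "((\<lambda>z. snd c (f z) $ j) has_field_derivative u' $ j) (at w)" by (simp add: has_velocity_def)
  have "snd c (f w) $ j \<in> (\<lambda>z. snd c (\<alpha> z) $ j) ` ball (\<beta> w) \<rho>"
    using \<beta>(3)[OF w] g(1) by (intro image_eqI[of _ _ "\<beta> w"]) auto
  then obtain g' where "(g has_field_derivative g') (at (snd c (f w) $ j))"
    using holomorphic_derivI[OF g(5,4)] by blast
  from DERIV_chain2[OF this 1] have "((\<lambda>z. g (snd c (f z) $ j)) has_field_derivative g' * u' $ j) (at w)" .
  then have "(\<beta> has_field_derivative g' * u' $ j) (at w)"
    by (rule has_field_derivative_transform_within_open[of _ _ _ "N \<inter> T"]) (use N f w eq in auto)
  then show "\<beta> field_differentiable at w within T"
    using field_differentiable_at_within field_differentiable_def by blast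
qed

end

section \<open>Leafwise curves\<close>

lemma integral_curveI:
  assumes "r > 0" "(c, v) \<in> F" "\<And>t. t \<in> ball 0 r \<Longrightarrow> h t \<in> fst c" "\<And>t. t \<in> ball 0 r \<Longrightarrow> h t \<notin> E"
    "\<And>t i. t \<in> ball 0 r \<Longrightarrow> ((\<lambda>s. snd c (h s) $ i) has_field_derivative v (h t) $ i) (at t)"
  shows "integral_curve F E h r"
  unfolding integral_curve_def
proof (intro conjI bexI[OF _ assms(2)])
  have "h ` ball 0 r \<subseteq> fst c - E" using assms(3,4) by blast
  then show "case (c, v) of (c, v) \<Rightarrow> h ` ball 0 r \<subseteq> fst c - E \<and>
     (\<forall>t\<in>ball 0 r. \<forall>i. ((\<lambda>s. snd c (h s) $ i) has_field_derivative v (h t) $ i) (at t))"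
    using assms(5) by simp
qed (rule assms(1))

lemma integral_curveE:
  assumes "integral_curve F E h r"
  obtains c v where "r > 0" "(c, v) \<in> F" "\<And>t. t \<in> ball 0 r \<Longrightarrow> h t \<in> fst c" "\<And>t. t \<in> ball 0 r \<Longrightarrow> h t \<notin> E"
    "\<And>t i. t \<in> ball 0 r \<Longrightarrow> ((\<lambda>s. snd c (h s) $ i) has_field_derivative v (h t) $ i) (at t)"
proof -
  obtain c v where c: "r > 0" "(c, v) \<in> F" "h ` ball 0 r \<subseteq> fst c - E"
    "\<forall>t\<in>ball 0 r. \<forall>i. ((\<lambda>s. snd c (h s) $ i) has_field_derivative v (h t) $ i) (at t)"
    using assms unfolding integral_curve_def by auto
  show ?thesis
  proof (rule that[OF c(1,2)])
    show "h t \<in> fst c" "h t \<notin> E" if "t \<in> ball 0 r" for t using c(3) imageI[OF that, of h] by blast+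
  qed (use c(4) in blast)
qed

lemma integral_curve_restrict:
  "integral_curve (restrict_foliation F W) E h r \<longleftrightarrow> integral_curve F E h r \<and> h ` ball 0 r \<subseteq> W"
proof
  assume "integral_curve (restrict_foliation F W) E h r"
  then obtain c v where c: "r > 0" "(c, v) \<in> restrict_foliation F W" "\<And>t. t \<in> ball 0 r \<Longrightarrow> h t \<in> fst c"
    "\<And>t. t \<in> ball 0 r \<Longrightarrow> h t \<notin> E"
    "\<And>t i. t \<in> ball 0 r \<Longrightarrow> ((\<lambda>s. snd c (h s) $ i) has_field_derivative v (h t) $ i) (at t)"
    by (rule integral_curveE) (rule that)
  obtain U \<phi> where U: "c = (U \<inter> W, \<phi>)" "((U, \<phi>), v) \<in> F"
    using c(2) unfolding restrict_foliation_def by blast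
  have "integral_curve F E h r"
    by (rule integral_curveI[OF c(1) U(2)]) (use c(3-5) U(1) in auto)
  then show "integral_curve F E h r \<and> h ` ball 0 r \<subseteq> W" using c(3) U(1) by auto
next
  assume *: "integral_curve F E h r \<and> h ` ball 0 r \<subseteq> W"
  then have h: "integral_curve F E h r" by blast
  obtain c v where c: "r > 0" "(c, v) \<in> F" "\<And>t. t \<in> ball 0 r \<Longrightarrow> h t \<in> fst c"
    "\<And>t. t \<in> ball 0 r \<Longrightarrow> h t \<notin> E"
    "\<And>t i. t \<in> ball 0 r \<Longrightarrow> ((\<lambda>s. snd c (h s) $ i) has_field_derivative v (h t) $ i) (at t)"
    by (rule integral_curveE[OF h]) (rule that)
  have "((fst c \<inter> W, snd c), v) \<in> restrict_foliation F W"
    unfolding restrict_foliation_def using c(2) by (cases c) auto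
  then show "integral_curve (restrict_foliation F W) E h r"
    by (rule integral_curveI[OF c(1)]) (use c(3-5) * in auto)
qed

lemma topspace_leaf_topology: "topspace (leaf_topology F E) = (\<Union>{h ` ball 0 r | h r. integral_curve F E h r})"
  by (simp add: leaf_topology_def topology_generated_by_topspace)

lemma topspace_leaf_topology_disjoint: "p \<in> topspace (leaf_topology F E) \<Longrightarrow> p \<notin> E"
  unfolding topspace_leaf_topology integral_curve_def by blast

lemma leaf_memD:
  assumes "x \<in> leaf F E p" "p \<notin> E"
  shows "x \<notin> E" "leaf F E x = leaf F E p"
proof -
  have x: "connected_component_of (leaf_topology F E) p x" using assms by (simp add: leaf_def)
  then have "x \<in> topspace (leaf_topology F E)" by (rule conjunct2[OF connected_component_in_topspace])
  then show xE: "x \<notin> E" by (rule topspace_leaf_topology_disjoint)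
  have "connected_component_of (leaf_topology F E) p = connected_component_of (leaf_topology F E) x"
    using x unfolding connected_component_of_equiv[of _ p x] by blast
  then show "leaf F E x = leaf F E p" using xE assms(2) by (simp add: leaf_def)
qed

locale foliation = complex_mfd A for A :: "('m::{t2_space,second_countable_topology}, 'n::finite) chart set" +
  fixes E :: "'m set" and F :: "('m, 'n) generator set"
  assumes shfc: "shfc A E F"
begin

lemma generator_exists: obtains c v where "(c, v) \<in> F" "p \<in> fst c"
proof -
  have "p \<in> (\<Union>(c, v)\<in>F. fst c)" using shfc by (simp add: shfc_def)
  then show ?thesis using that by auto
qed

lemma generatorD:
  assumes "(c, v) \<in> F"
  shows "c \<in> charts A" "holomorphic_fun_on A (\<lambda>p. v p $ i) (fst c)" "p \<in> fst c \<Longrightarrow> v p = 0 \<longleftrightarrow> p \<in> E"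
proof -
  have "\<forall>(c, v)\<in>F. c \<in> charts A \<and> (\<forall>i. holomorphic_fun_on A (\<lambda>p. v p $ i) (fst c)) \<and>
        {p \<in> fst c. v p = 0} = E \<inter> fst c"
    using shfc unfolding shfc_def by (elim conjE)
  from bspec[OF this assms]
  have *: "c \<in> charts A" "\<And>i. holomorphic_fun_on A (\<lambda>p. v p $ i) (fst c)" "{p \<in> fst c. v p = 0} = E \<inter> fst c"
    by simp_all
  show "c \<in> charts A" "holomorphic_fun_on A (\<lambda>p. v p $ i) (fst c)" by (rule *)+
  show "v p = 0 \<longleftrightarrow> p \<in> E" if "p \<in> fst c" using *(3) that by blast
qed

lemma generator_compat:
  assumes "(c, v) \<in> F" "(d, w) \<in> F" "p \<in> fst c" "p \<in> fst d"
  obtains k where "k \<noteq> 0" "coord_change c d p (v p) = k *s w p"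
proof -
  have "\<forall>(c, v)\<in>F. \<forall>(d, w)\<in>F. \<exists>f. holomorphic_fun_on A f (fst c \<inter> fst d) \<and>
        (\<forall>p\<in>fst c \<inter> fst d. f p \<noteq> 0 \<and> coord_change c d p (v p) = f p *s w p)"
    using shfc unfolding shfc_def by (elim conjE)
  from bspec[OF this assms(1)]
  have "\<forall>(d, w)\<in>F. \<exists>f. holomorphic_fun_on A f (fst c \<inter> fst d) \<and>
        (\<forall>p\<in>fst c \<inter> fst d. f p \<noteq> 0 \<and> coord_change c d p (v p) = f p *s w p)" by simp
  from bspec[OF this assms(2)]
  obtain f where "\<And>p. p\<in>fst c \<inter> fst d \<Longrightarrow> f p \<noteq> 0 \<and> coord_change c d p (v p) = f p *s w p" by auto
  from this[OF IntI[OF assms(3,4)]] show ?thesis using that by blast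
qed

lemma generator_isCont:
  assumes "(c, v) \<in> F" "p \<in> fst c"
  shows "isCont (\<lambda>p. v p $ i) p"
  by (rule holomorphic_fun_isCont[OF generatorD(2)[OF assms(1)] assms(2)])

lemma generator_field_holomorphic:
  assumes "(c, v) \<in> F"
  shows "holomorphic_Cn_on (\<lambda>x. v (param c x) $ i) (snd c ` fst c)"
  unfolding holomorphic_Cn_on_def
proof
  fix x assume "x \<in> snd c ` fst c"
  then obtain p where p: "p \<in> fst c" "x = snd c p" by blast
  obtain G' where "((\<lambda>x. v (param c x) $ i) has_derivative G') (at (snd c p))" "\<And>k v. G' (k *s v) = k * G' v"
    by (rule holomorphic_fun_in_chart[OF generatorD(2)[OF assms] generatorD(1)[OF assms] p(1) p(1)]) (rule that)
  then show "\<exists>f'. ((\<lambda>x. v (param c x) $ i) has_derivative f') (at x) \<and> (\<forall>k v. f' (k *s v) = k * f' v)"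
    unfolding p(2) by blast
qed

text \<open>Near a point off E some component of a generator is nonzero, and it stays nonzero by
  continuity.\<close>

lemma closed_singular_set: "closed E"
proof -
  have "open (- E)"
  proof (subst open_subopen, intro ballI)
    fix p assume p: "p \<in> - E"
    obtain c v where c: "(c, v) \<in> F" "p \<in> fst c" by (rule generator_exists)
    then have "v p \<noteq> 0" using generatorD(3) p by blast
    then obtain j where j: "v p $ j \<noteq> 0" by (auto simp: vec_eq_iff)
    obtain T where T: "open T" "p \<in> T" "\<And>q. q \<in> T \<Longrightarrow> v q $ j \<in> - {0}"
      using generator_isCont[OF c, of j] j unfolding continuous_at_open
      by (metis (no_types, lifting) ComplI open_Compl closed_singleton singletonD)
    have "open (T \<inter> fst c)" using T(1) chart_homeomorphism(1)[OF generatorD(1)[OF c(1)]] by blast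
    moreover have "T \<inter> fst c \<subseteq> - E"
    proof
      fix q assume q: "q \<in> T \<inter> fst c"
      then have "v q $ j \<noteq> 0" using T(3)[of q] by simp
      then have "v q \<noteq> 0" by auto
      then show "q \<in> - E" using generatorD(3)[OF c(1)] q by blast
    qed
    ultimately show "\<exists>T. open T \<and> p \<in> T \<and> T \<subseteq> - E" using T(2) c(2) by blast
  qed
  then show ?thesis by (simp add: closed_def)
qed

section \<open>Curves tangent to the foliation\<close>

text \<open>The factor l may be zero, since competitors in the extremal problem, such as constant
  discs, need not be immersed.\<close>

definition tangent :: "(complex \<Rightarrow> 'm) \<Rightarrow> complex set \<Rightarrow> bool" where
  "tangent f S \<longleftrightarrow> (\<forall>z\<in>S. f z \<notin> E \<and> (\<exists>c v l. (c, v) \<in> F \<and> has_velocity f c (l *s v (f z)) z))"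

lemma tangent_imp_hol_curve: "tangent f S \<Longrightarrow> hol_curve f S"
  unfolding tangent_def hol_curve_def using generatorD(1) by blast

lemma generator_velocity_change:
  assumes "has_velocity f c (l *s v (f z)) z" "(c, v) \<in> F" "(d, w) \<in> F" "f z \<in> fst d"
  obtains k where "k \<noteq> 0" "has_velocity f d ((l * k) *s w (f z)) z"
proof -
  have fc: "f z \<in> fst c" using assms(1) by (simp add: has_velocity_def)
  obtain k where k: "k \<noteq> 0" "coord_change c d (f z) (v (f z)) = k *s w (f z)"
    by (rule generator_compat[OF assms(2,3) fc assms(4)])
  have "has_velocity f d (coord_change c d (f z) (l *s v (f z))) z"
    by (rule velocity_coord_change[OF assms(1) generatorD(1)[OF assms(2)] generatorD(1)[OF assms(3)] assms(4)])
  also have "coord_change c d (f z) (l *s v (f z)) = (l * k) *s w (f z)"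
    by (simp add: coord_change_derivative(2)[OF generatorD(1)[OF assms(2)] generatorD(1)[OF assms(3)] fc assms(4)] k(2))
  finally show ?thesis by (rule that[OF k(1)])
qed

text \<open>The vanishing of the 2x2 minors is a form of tangency without division, hence stable
  under limits and analytic continuation. Off E the generator has a nonzero component, and dividing
  by it recovers the factor l.\<close>

lemma parallel_velocity:
  assumes "has_velocity f c u w" "(c, v) \<in> F" "f w \<notin> E"
    and eq: "\<And>i j. u $ i * v (f w) $ j = u $ j * v (f w) $ i"
  obtains l where "has_velocity f c (l *s v (f w)) w"
proof -
  have "f w \<in> fst c" using assms(1) by (simp add: has_velocity_def)
  then have "v (f w) \<noteq> 0" using generatorD(3)[OF assms(2)] assms(3) by blast
  then obtain j where j: "v (f w) $ j \<noteq> 0" by (auto simp: vec_eq_iff)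
  have "u = (u $ j / v (f w) $ j) *s v (f w)"
    using eq[of _ j] j by (simp add: vec_eq_iff field_simps)
  then show ?thesis using assms(1) that by metis
qed

lemma tangent_velocity:
  assumes "tangent f S" "z \<in> S" "(c, v) \<in> F" "f z \<in> fst c"
  obtains l where "has_velocity f c (l *s v (f z)) z"
proof -
  obtain d w l where d: "(d, w) \<in> F" "has_velocity f d (l *s w (f z)) z"
    using assms(1,2) unfolding tangent_def by blast
  show ?thesis by (rule generator_velocity_change[where w=v, OF d(2,1) assms(3,4)], rule that)
qed

lemma integral_curveD:
  assumes "integral_curve F E h r"
  obtains c v where "(c, v) \<in> F" "\<And>t. t \<in> ball 0 r \<Longrightarrow> h t \<in> fst c" "\<And>t. t \<in> ball 0 r \<Longrightarrow> h t \<notin> E"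
    "\<And>t. t \<in> ball 0 r \<Longrightarrow> has_velocity h c (v (h t)) t"
proof -
  obtain c v where c: "(c, v) \<in> F" "\<And>t. t \<in> ball 0 r \<Longrightarrow> h t \<in> fst c" "\<And>t. t \<in> ball 0 r \<Longrightarrow> h t \<notin> E"
    "\<And>t i. t \<in> ball 0 r \<Longrightarrow> ((\<lambda>s. snd c (h s) $ i) has_field_derivative v (h t) $ i) (at t)"
    by (rule integral_curveE[OF assms]) (rule that)
  have "has_velocity h c (v (h t)) t" if "t \<in> ball 0 r" for t
    by (rule velocity_from_coords[where u="\<lambda>t. v (h t)" and S="ball 0 r", OF generatorD(1)[OF c(1)] open_ball c(2,4) that])
  then show ?thesis using that[OF c(1-3)] by blast
qed

lemma integral_curve_tangent:
  assumes "integral_curve F E h r"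
  shows "tangent h (ball 0 r)"
proof -
  obtain c v where c: "(c, v) \<in> F" "\<And>t. t \<in> ball 0 r \<Longrightarrow> h t \<in> fst c" "\<And>t. t \<in> ball 0 r \<Longrightarrow> h t \<notin> E"
    "\<And>t. t \<in> ball 0 r \<Longrightarrow> has_velocity h c (v (h t)) t" by (rule integral_curveD[OF assms], rule that)
  show ?thesis
    unfolding tangent_def
  proof (intro ballI conjI)
    fix t :: complex assume t: "t \<in> ball 0 r"
    have "has_velocity h c (1 *s v (h t)) t" using c(4)[OF t] by simp
    then show "\<exists>c v l. (c, v) \<in> F \<and> has_velocity h c (l *s v (h t)) t" using c(1) by blast
  qed (rule c(3))
qed

lemma integral_curve_shift:
  assumes "integral_curve F E h r" "0 < r'" "norm t0 + r' \<le> r"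
  shows "integral_curve F E (\<lambda>t. h (t0 + t)) r'"
proof -
  have sub: "t0 + t \<in> ball 0 r" if "t \<in> ball 0 r'" for t
    using norm_triangle_ineq[of t0 t] that assms(3) by simp
  obtain c v where c: "(c, v) \<in> F" "\<And>t. t \<in> ball 0 r \<Longrightarrow> h t \<in> fst c" "\<And>t. t \<in> ball 0 r \<Longrightarrow> h t \<notin> E"
    "\<And>t i. t \<in> ball 0 r \<Longrightarrow> ((\<lambda>s. snd c (h s) $ i) has_field_derivative v (h t) $ i) (at t)"
    by (rule integral_curveE[OF assms(1)]) (rule that)
  have "((\<lambda>s. snd c (h (t0 + s)) $ i) has_field_derivative v (h (t0 + t)) $ i) (at t)" if "t \<in> ball 0 r'" for t i
  proof -
    have 1: "((\<lambda>s. snd c (h s) $ i) has_field_derivative v (h (t0 + t)) $ i) (at (t0 + t))"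
      by (rule c(4)[OF sub[OF that]])
    have 2: "((\<lambda>s. t0 + s) has_field_derivative 1) (at t)" by (auto intro!: derivative_eq_intros)
    from DERIV_chain2[OF 1 2] show ?thesis by simp
  qed
  then show ?thesis by (intro integral_curveI[OF assms(2) c(1)] c(2,3) sub)
qed

text \<open>Locally l is the quotient of a coordinate derivative by a component of the field that
  does not vanish, hence holomorphic. Its primitive C is the complex flow time elapsed along f since
  w0.\<close>

lemma tangent_speed:
  assumes f: "tangent f S" "open S" "w0 \<in> S" and cv: "(c, v) \<in> F" "f w0 \<in> fst c"
  obtains \<epsilon> l C where "\<epsilon> > 0" "ball w0 \<epsilon> \<subseteq> S" "l holomorphic_on ball w0 \<epsilon>"
    "\<And>w. w \<in> ball w0 \<epsilon> \<Longrightarrow> f w \<in> fst c"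
    "\<And>w. w \<in> ball w0 \<epsilon> \<Longrightarrow> has_velocity f c (l w *s v (f w)) w"
    "\<And>w. w \<in> ball w0 \<epsilon> \<Longrightarrow> (C has_field_derivative l w) (at w)" "C w0 = 0"
proof -
  have "f w0 \<notin> E" using f unfolding tangent_def by blast
  then have "v (f w0) \<noteq> 0" using generatorD(3) cv by blast
  then obtain j where j: "v (f w0) $ j \<noteq> 0" by (auto simp: vec_eq_iff)
  have fc: "isCont f w0" by (rule hol_curve_isCont[OF tangent_imp_hol_curve[OF f(1)] f(3)])
  obtain S1 where S1: "open S1" "w0 \<in> S1" "\<And>z. z \<in> S1 \<Longrightarrow> f z \<in> fst c"
    by (rule isCont_open_preimage[OF fc chart_homeomorphism(1)[OF generatorD(1)[OF cv(1)]] cv(2)], rule that)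
  have "isCont (\<lambda>z. v (f z) $ j) w0" by (rule isCont_o2[OF fc generator_isCont[OF cv]])
  then obtain S2 where S2: "open S2" "w0 \<in> S2" "\<And>z. z \<in> S2 \<Longrightarrow> v (f z) $ j \<in> - {0}"
    by (rule isCont_open_preimage[of _ _ "-{0}"]) (use j in auto)
  have "open (S \<inter> S1 \<inter> S2)" "w0 \<in> S \<inter> S1 \<inter> S2" using S1 S2 f by auto
  then obtain \<epsilon> where \<epsilon>: "\<epsilon> > 0" "ball w0 \<epsilon> \<subseteq> S \<inter> S1 \<inter> S2" by (meson openE)
  define l where "l = (\<lambda>w. deriv (\<lambda>z. snd c (f z) $ j) w / v (f w) $ j)"
  have hb: "hol_curve f (ball w0 \<epsilon>)" using hol_curve_subset[OF tangent_imp_hol_curve[OF f(1)]] \<epsilon>(2) by blast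
  have fb: "f w \<in> fst c" if "w \<in> ball w0 \<epsilon>" for w using S1(3) \<epsilon>(2) that by blast
  have nz: "v (f w) $ j \<noteq> 0" if "w \<in> ball w0 \<epsilon>" for w using S2(3)[of w] \<epsilon>(2) that by blast
  have l: "l holomorphic_on ball w0 \<epsilon>"
    unfolding l_def
  proof (intro holomorphic_on_divide holomorphic_deriv open_ball)
    show "(\<lambda>z. snd c (f z) $ j) holomorphic_on ball w0 \<epsilon>"
      by (rule hol_curve_holomorphic[OF hb open_ball chart_holomorphic[OF generatorD(1)[OF cv(1)]] fb])
    show "(\<lambda>w. v (f w) $ j) holomorphic_on ball w0 \<epsilon>"
      by (rule hol_curve_holomorphic[OF hb open_ball generatorD(2)[OF cv(1)] fb])
  qed (rule nz)
  have vel: "has_velocity f c (l w *s v (f w)) w" if w: "w \<in> ball w0 \<epsilon>" for w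
  proof -
    have "w \<in> S" using w \<epsilon>(2) by blast
    then obtain l' where l': "has_velocity f c (l' *s v (f w)) w"
      using tangent_velocity[OF f(1) _ cv(1) fb[OF w]] by blast
    then have "((\<lambda>z. snd c (f z) $ j) has_field_derivative (l' *s v (f w)) $ j) (at w)"
      unfolding has_velocity_def by blast
    then have "deriv (\<lambda>z. snd c (f z) $ j) w = l' * v (f w) $ j" using DERIV_imp_deriv by fastforce
    then have "l w = l'" using nz[OF w] by (simp add: l_def)
    then show ?thesis using l' by simp
  qed
  obtain C0 where C0: "\<And>w. w \<in> ball w0 \<epsilon> \<Longrightarrow> (C0 has_field_derivative l w) (at w within ball w0 \<epsilon>)"
    using holomorphic_convex_primitive'[OF convex_ball open_ball l] by blast
  have C0': "((\<lambda>w. C0 w - C0 w0) has_field_derivative l w) (at w)" if "w \<in> ball w0 \<epsilon>" for w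
    using C0[OF that] that by (auto intro!: derivative_eq_intros simp: at_within_open[OF _ open_ball])
  show ?thesis
    by (rule that[of \<epsilon> l "\<lambda>w. C0 w - C0 w0"]) (use \<epsilon> l fb vel C0' in auto)
qed

text \<open>Both curves solve the same equation with speed l, so agreement at one point spreads to a
  neighbourhood by local uniqueness in the chart, and to S by connectedness.\<close>

lemma leafwise_unique:
  assumes cv: "(c, v) \<in> F" and S: "open S" "connected S" and l: "l holomorphic_on S"
    and v1: "\<And>w. w \<in> S \<Longrightarrow> has_velocity f1 c (l w *s v (f1 w)) w"
    and v2: "\<And>w. w \<in> S \<Longrightarrow> has_velocity f2 c (l w *s v (f2 w)) w"
    and a: "a \<in> S" "f1 a = f2 a" and "w \<in> S"
  shows "f1 w = f2 w"
proof (rule eq_on_connected[where p=f1 and q=f2, OF S(2) _ _ a \<open>w \<in> S\<close>])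
  note cA = generatorD(1)[OF cv]
  show "continuous_on S f1" "continuous_on S f2"
    using v1 v2 unfolding has_velocity_def by (auto intro: continuous_at_imp_continuous_on)
  fix w assume wS: "w \<in> S" and eq: "f1 w = f2 w"
  have w1: "f1 w \<in> fst c" using v1[OF wS] by (simp add: has_velocity_def)
  define p where "p = snd c (f1 w)"
  have "p \<in> snd c ` fst c" unfolding p_def using w1 by blast
  from holomorphic_field_lipschitz[where V="\<lambda>x. v (param c x)", OF generator_field_holomorphic[OF cv] chart_homeomorphism(2)[OF cA] this]
  obtain R B where R: "R > 0" "B > 0" "\<And>x y. x \<in> ball p R \<Longrightarrow> y \<in> ball p R \<Longrightarrow>
      norm (v (param c x) - v (param c y)) \<le> B * norm (x - y)" by metis
  have in_ball: "\<exists>N. open N \<and> w \<in> N \<and> (\<forall>z\<in>N. snd c (f z) \<in> ball p R)"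
    if "has_velocity f c u w" "snd c (f w) = p" for f u
  proof -
    have "isCont f w" "f w \<in> fst c" using that(1) by (simp_all add: has_velocity_def)
    then have "isCont (\<lambda>z. snd c (f z)) w" by (rule isCont_o2[where f=f and g="snd c", OF _ chart_isCont[OF cA]])
    moreover have "snd c (f w) \<in> ball p R" using that(2) R(1) by simp
    ultimately obtain N where "open N" "w \<in> N" "\<And>z. z \<in> N \<Longrightarrow> snd c (f z) \<in> ball p R"
      by (rule isCont_open_preimage[where B="ball p R", OF _ open_ball]) (rule that)
    then show ?thesis by blast
  qed
  obtain N1 where N1: "open N1" "w \<in> N1" "\<forall>z\<in>N1. snd c (f1 z) \<in> ball p R"
    using in_ball[OF v1[OF wS]] p_def by blast
  obtain N2 where N2: "open N2" "w \<in> N2" "\<forall>z\<in>N2. snd c (f2 z) \<in> ball p R"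
    using in_ball[OF v2[OF wS]] p_def eq by auto
  have "isCont l w"
    using holomorphic_on_imp_continuous_on[OF l] S(1) wS by (simp add: continuous_on_eq_continuous_at)
  then obtain N3 where N3: "open N3" "w \<in> N3" "\<And>z. z \<in> N3 \<Longrightarrow> l z \<in> ball (l w) 1"
    by (rule isCont_open_preimage[where B="ball (l w) 1", OF _ open_ball]) (simp, rule that)
  define L where "L = norm (l w) + 1"
  have L: "norm (l z) \<le> L" if "z \<in> N3" for z
    using N3(3)[OF that] norm_triangle_sub[of "l z" "l w"] by (simp add: L_def dist_norm norm_minus_commute)
  have L0: "L > 0" by (simp add: L_def add_nonneg_pos)
  have "open (S \<inter> N1 \<inter> N2 \<inter> N3)" "w \<in> S \<inter> N1 \<inter> N2 \<inter> N3" using S N1 N2 N3 wS by auto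
  then obtain e0 where e0: "e0 > 0" "ball w e0 \<subseteq> S \<inter> N1 \<inter> N2 \<inter> N3" by (meson openE)
  \<comment> \<open>The second term gives \<open>e * (L * B) \<le> 1/2\<close>, where L bounds the
    speed l near w and B is the Lipschitz constant of the field in coordinates.\<close>
  define e where "e = min e0 (1 / (2 * (L * B)))"
  have e: "e > 0" "e \<le> e0" "e \<le> 1 / (2 * (L * B))" using e0 L0 R(2) by (auto simp: e_def)
  have "e * (L * B) \<le> 1 / (2 * (L * B)) * (L * B)" using L0 R(2) e(3) by (intro mult_right_mono) auto
  then have eLB: "e * (L * B) \<le> 1/2" using L0 R(2) by simp
  have be: "ball w e \<subseteq> S \<inter> N1 \<inter> N2 \<inter> N3" using e(2) e0(2) subset_ball by blast
  have "f1 z = f2 z" if z: "z \<in> ball w e" for z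
  proof -
    have inc: "f1 t \<in> fst c" "f2 t \<in> fst c" if "t \<in> ball w e" for t
      using v1[of t] v2[of t] subsetD[OF be that] unfolding has_velocity_def by simp_all
    have d: "((\<lambda>z. snd c (f1 z) $ i) has_field_derivative (l t *s v (param c (snd c (f1 t)))) $ i) (at t)"
      "((\<lambda>z. snd c (f2 z) $ i) has_field_derivative (l t *s v (param c (snd c (f2 t)))) $ i) (at t)"
      if "t \<in> ball w e" for t i
      using v1[of t] v2[of t] subsetD[OF be that] inc[OF that] cA unfolding has_velocity_def by simp_all
    have "snd c (f1 z) = snd c (f2 z)"
    proof (rule ode_unique_local[where V="\<lambda>x. v (param c x)" and ?y1.0="\<lambda>z. snd c (f1 z)" and ?y2.0="\<lambda>z. snd c (f2 z)"
          and p=p and R=R and B=B and L=L and l=l and e=e and a=w])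
      show "norm (v (param c x) - v (param c y)) \<le> B * norm (x - y)" if "x \<in> ball p R" "y \<in> ball p R" for x y
        by (rule R(3)[OF that])
      show "snd c (f1 t) \<in> ball p R" "snd c (f2 t) \<in> ball p R" "norm (l t) \<le> L" if "t \<in> ball w e" for t
        using subsetD[OF be that] N1(3) N2(3) L by blast+
    qed (use eLB R(2) L0 eq z d in auto)
    then show ?thesis using inc[OF z] param_chart[OF cA] by metis
  qed
  moreover have "openin (top_of_set S) (ball w e)" using be by (intro open_subset) auto
  ultimately show "\<exists>N. openin (top_of_set S) N \<and> w \<in> N \<and> (\<forall>z\<in>N. f1 z = f2 z)"
    using e(1) by (intro exI[of _ "ball w e"]) auto
qed

text \<open>With the elapsed time added to t0 as the parameter of h, one obtains a curve with the
  same speed as f and the same value at w0. So a tangent curve that meets a plaque stays in it for a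
  while.\<close>

lemma tangent_factor:
  assumes f: "tangent f S" "open S" "w0 \<in> S" and h: "integral_curve F E h r" and t0: "t0 \<in> ball 0 r" "h t0 = f w0"
  obtains e C where "e > 0" "ball w0 e \<subseteq> S" "C ` ball w0 e \<subseteq> ball 0 r" "\<And>w. w \<in> ball w0 e \<Longrightarrow> f w = h (C w)"
proof -
  obtain c v where c: "(c, v) \<in> F" "\<And>t. t \<in> ball 0 r \<Longrightarrow> h t \<in> fst c"
    "\<And>t. t \<in> ball 0 r \<Longrightarrow> has_velocity h c (v (h t)) t" by (rule integral_curveD[OF h], rule that)
  have "f w0 \<in> fst c" using c(2)[OF t0(1)] t0(2) by simp
  then obtain \<epsilon> l C where C: "\<epsilon> > 0" "ball w0 \<epsilon> \<subseteq> S" "l holomorphic_on ball w0 \<epsilon>"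
    "\<And>w. w \<in> ball w0 \<epsilon> \<Longrightarrow> has_velocity f c (l w *s v (f w)) w"
    "\<And>w. w \<in> ball w0 \<epsilon> \<Longrightarrow> (C has_field_derivative l w) (at w)" "C w0 = 0"
    by (rule tangent_speed[OF f c(1)]) (rule that)
  have "isCont (\<lambda>w. t0 + C w) w0" using DERIV_isCont[OF C(5)] C(1) by simp
  then obtain N where N: "open N" "w0 \<in> N" "\<And>w. w \<in> N \<Longrightarrow> t0 + C w \<in> ball 0 r"
    by (rule isCont_open_preimage[of _ _ "ball 0 r"]) (use t0 C(6) in auto)
  have "open (N \<inter> ball w0 \<epsilon>)" "w0 \<in> N \<inter> ball w0 \<epsilon>" using N C(1) by auto
  then obtain e where e: "e > 0" "ball w0 e \<subseteq> N \<inter> ball w0 \<epsilon>" by (meson openE)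
  have eq: "f w = h (t0 + C w)" if w: "w \<in> ball w0 e" for w
  proof (rule leafwise_unique[OF c(1) open_ball connected_ball, of l w0 e f "\<lambda>w. h (t0 + C w)" w0 w])
    show "l holomorphic_on ball w0 e" using C(3) e(2) holomorphic_on_subset by blast
    fix z assume z: "z \<in> ball w0 e"
    show "has_velocity f c (l z *s v (f z)) z" using C(4) e(2) z by blast
    have "((\<lambda>w. t0 + C w) has_field_derivative l z) (at z)"
      using C(5)[of z] e(2) z by (auto intro!: derivative_eq_intros)
    moreover have "has_velocity h c (v (h (t0 + C z))) (t0 + C z)" using c(3) N(3) e(2) z by blast
    ultimately show "has_velocity (\<lambda>w. h (t0 + C w)) c (l z *s v (h (t0 + C z))) z"
      by (rule has_velocity_comp[rotated])
  qed (use e(1) t0(2) C(6) w in auto)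
  show ?thesis
    by (rule that[OF e(1), of "\<lambda>w. t0 + C w"]) (use e(2) C(2) N(3) eq in auto)
qed

section \<open>Flow boxes, plaques and the leaf topology\<close>

lemma flow_box:
  assumes "p \<notin> E" "(c, v) \<in> F" "p \<in> fst c"
  obtains N \<rho> \<Phi> where "open N" "p \<in> N" "N \<subseteq> fst c" "\<rho> > 0" "\<And>y. y \<in> N \<Longrightarrow> \<Phi> y 0 = y"
    "\<And>y. y \<in> N \<Longrightarrow> integral_curve F E (\<Phi> y) \<rho>"
    "\<And>y t. y \<in> N \<Longrightarrow> t \<in> ball 0 \<rho> \<Longrightarrow> has_velocity (\<Phi> y) c (v (\<Phi> y t)) t"
    "\<And>t. t \<in> ball 0 \<rho> \<Longrightarrow> continuous_on N (\<lambda>y. \<Phi> y t)"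
proof -
  note cA = generatorD(1)[OF assms(2)]
  define V where "V = (\<lambda>x. v (param c x))"
  \<comment> \<open>E is removed from the coordinate domain, so the flow lines obtained in W avoid
    it and are integral curves.\<close>
  define W where "W = snd c ` (fst c \<inter> - E)"
  have W: "open W" unfolding W_def using closed_singular_set by (intro chart_image_open cA) auto
  have hol: "holomorphic_Cn_on (\<lambda>x. V x $ i) W" for i
    using generator_field_holomorphic[OF assms(2), of i] unfolding holomorphic_Cn_on_def W_def V_def by blast
  have pW: "snd c p \<in> W" using assms by (auto simp: W_def)
  have Win: "x \<in> snd c ` fst c" "param c x \<in> fst c" "param c x \<notin> E" "snd c (param c x) = x" if "x \<in> W" for x
    using that cA by (auto simp: W_def)
  obtain \<rho> r \<phi> where \<phi>: "\<rho> > 0" "r > 0" "ball (snd c p) r \<subseteq> W"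
    "\<And>y. y \<in> ball (snd c p) r \<Longrightarrow> \<phi> y 0 = y"
    "\<And>y t. y \<in> ball (snd c p) r \<Longrightarrow> t \<in> ball 0 \<rho> \<Longrightarrow> \<phi> y t \<in> W"
    "\<And>y t i. y \<in> ball (snd c p) r \<Longrightarrow> t \<in> ball 0 \<rho> \<Longrightarrow>
        ((\<lambda>s. \<phi> y s $ i) has_field_derivative V (\<phi> y t) $ i) (at t)"
    "\<And>y y' t. y \<in> ball (snd c p) r \<Longrightarrow> y' \<in> ball (snd c p) r \<Longrightarrow> t \<in> ball 0 \<rho> \<Longrightarrow>
        norm (\<phi> y t - \<phi> y' t) \<le> 2 * norm (y - y')"
    by (rule flow_Cn[OF hol W pW], rule that)
  define N where "N = fst c \<inter> snd c -` ball (snd c p) r"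
  define \<Phi> where "\<Phi> = (\<lambda>y t. param c (\<phi> (snd c y) t))"
  have contc: "continuous_on (fst c) (snd c)" using chart_homeomorphism(3)[OF cA] by (rule homeomorphism_cont1)
  have Nb: "snd c y \<in> ball (snd c p) r" "y \<in> fst c" if "y \<in> N" for y using that by (auto simp: N_def)
  have der: "((\<lambda>s. snd c (\<Phi> y s) $ i) has_field_derivative v (\<Phi> y t) $ i) (at t)"
    if y: "y \<in> N" and t: "t \<in> ball 0 \<rho>" for y t i
  proof (rule has_field_derivative_transform_within_open[OF _ open_ball t])
    show "((\<lambda>s. \<phi> (snd c y) s $ i) has_field_derivative v (\<Phi> y t) $ i) (at t)"
      using \<phi>(6)[OF Nb(1)[OF y] t] by (simp add: V_def \<Phi>_def)
    show "\<phi> (snd c y) s $ i = snd c (\<Phi> y s) $ i" if "s \<in> ball 0 \<rho>" for s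
      using Win(4)[OF \<phi>(5)[OF Nb(1)[OF y] that]] by (simp add: \<Phi>_def)
  qed
  have im: "\<Phi> y t \<in> fst c" "\<Phi> y t \<notin> E" if "y \<in> N" "t \<in> ball 0 \<rho>" for y t
    unfolding \<Phi>_def using Win(2,3)[OF \<phi>(5)[OF Nb(1)[OF that(1)] that(2)]] .
  show ?thesis
  proof (rule that[of N \<rho> \<Phi>])
    show "open N" unfolding N_def
      by (rule continuous_open_preimage[OF contc chart_homeomorphism(1)[OF cA] open_ball])
    show "p \<in> N" "N \<subseteq> fst c" using assms(3) \<phi>(2) by (auto simp: N_def)
    show "\<rho> > 0" by (rule \<phi>(1))
    show "\<Phi> y 0 = y" if "y \<in> N" for y
      using \<phi>(4)[OF Nb(1)[OF that]] Nb(2)[OF that] cA by (simp add: \<Phi>_def)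
    show "integral_curve F E (\<Phi> y) \<rho>" if "y \<in> N" for y
      by (rule integral_curveI[OF \<phi>(1) assms(2) im[OF that] der[OF that]])
    show "has_velocity (\<Phi> y) c (v (\<Phi> y t)) t" if "y \<in> N" "t \<in> ball 0 \<rho>" for y t
      by (rule velocity_from_coords[where u="\<lambda>t. v (\<Phi> y t)", OF cA open_ball im(1)[OF that(1)] der[OF that(1)] that(2)])
    fix t :: complex assume t: "t \<in> ball 0 \<rho>"
    have c1: "continuous_on (ball (snd c p) r) (\<lambda>y. \<phi> y t)"
    proof (rule continuous_onI)
      fix x e assume x: "x \<in> ball (snd c p) r" and e: "(e::real) > 0"
      show "\<exists>d>0. \<forall>x'\<in>ball (snd c p) r. dist x' x < d \<longrightarrow> dist (\<phi> x' t) (\<phi> x t) \<le> e"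
      proof (intro exI[of _ "e/2"] conjI ballI impI)
        fix x' assume x': "x' \<in> ball (snd c p) r" "dist x' x < e/2"
        show "dist (\<phi> x' t) (\<phi> x t) \<le> e" using \<phi>(7)[OF x'(1) x t] x'(2) by (simp add: dist_norm)
      qed (use e in simp)
    qed
    have "continuous_on N (\<lambda>y. \<phi> (snd c y) t)"
      by (rule continuous_on_compose2[OF c1 continuous_on_subset[OF contc]]) (auto simp: N_def)
    then show "continuous_on N (\<lambda>y. \<Phi> y t)" unfolding \<Phi>_def
      by (rule continuous_on_compose2[OF homeomorphism_cont2[OF chart_homeomorphism(3)[OF cA]]])
        (use Win(1)[OF \<phi>(5)[OF _ t]] Nb in blast)
  qed
qed

lemma integral_curve_exists:
  assumes "p \<notin> E" "open W" "p \<in> W"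
  obtains h r where "integral_curve F E h r" "h 0 = p" "h ` ball 0 r \<subseteq> W"
proof -
  obtain c v where cv: "(c, v) \<in> F" "p \<in> fst c" by (rule generator_exists)
  obtain N \<rho> \<Phi> where \<Phi>: "p \<in> N" "\<rho> > 0" "\<And>y. y \<in> N \<Longrightarrow> \<Phi> y 0 = y" "\<And>y. y \<in> N \<Longrightarrow> integral_curve F E (\<Phi> y) \<rho>"
    by (rule flow_box[OF assms(1) cv]) (rule that)
  have "hol_curve (\<Phi> p) (ball 0 \<rho>)"
    by (rule tangent_imp_hol_curve[OF integral_curve_tangent[OF \<Phi>(4)[OF \<Phi>(1)]]])
  then have "isCont (\<Phi> p) 0" using \<Phi>(2) hol_curve_isCont by simp
  then obtain M where M: "open M" "0 \<in> M" "\<And>z. z \<in> M \<Longrightarrow> \<Phi> p z \<in> W"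
    by (rule isCont_open_preimage[OF _ assms(2)]) (use \<Phi> assms(3) in auto)
  obtain e where e: "e > 0" "ball 0 e \<subseteq> M" using M by (meson openE)
  have "integral_curve F E (\<lambda>t. \<Phi> p (0 + t)) (min e \<rho>)"
    by (rule integral_curve_shift[OF \<Phi>(4)[OF \<Phi>(1)]]) (use e \<Phi>(2) in auto)
  moreover have "\<Phi> p ` ball 0 (min e \<rho>) \<subseteq> W"
  proof
    fix q assume "q \<in> \<Phi> p ` ball 0 (min e \<rho>)"
    then obtain t where "t \<in> ball 0 e" "q = \<Phi> p t" by auto
    then show "q \<in> W" using e(2) M(3) by blast
  qed
  ultimately show ?thesis using that[of "\<Phi> p" "min e \<rho>"] \<Phi>(3)[OF \<Phi>(1)] by simp
qed

text \<open>Plaques generate the leaf topology, and their preimages under a tangent curve are open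
  by \<open>tangent_factor\<close>. The version restricted to W is needed for leaves inside the
  neighbourhoods of singular points; \<open>W = UNIV\<close> gives the leaves themselves.\<close>

lemma tangent_continuous_map_restrict:
  assumes "tangent f S" "open S" "open W" "f ` S \<subseteq> W"
  shows "continuous_map (top_of_set S) (leaf_topology (restrict_foliation F W) E) f"
  unfolding leaf_topology_def
proof (rule continuous_on_generated_topo)
  let ?P = "{h ` ball 0 r |h r. integral_curve (restrict_foliation F W) E h r}"
  show "f ` topspace (top_of_set S) \<subseteq> \<Union> ?P"
  proof
    fix y assume "y \<in> f ` topspace (top_of_set S)"
    then have "y \<notin> E" "y \<in> W" using assms(1,4) unfolding tangent_def by auto
    then obtain h r where h: "integral_curve F E h r" "h 0 = y" "h ` ball 0 r \<subseteq> W"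
      using integral_curve_exists[OF _ assms(3)] by blast
    then have "r > 0" by (simp add: integral_curve_def)
    then have "y \<in> h ` ball 0 r" using h(2) by (intro image_eqI[of _ _ 0]) auto
    moreover have "h ` ball 0 r \<in> ?P"
      using h(1,3) by (auto simp: integral_curve_restrict)
    ultimately show "y \<in> \<Union> ?P" by blast
  qed
  fix U assume "U \<in> ?P"
  then obtain h r where U: "U = h ` ball 0 r" "integral_curve F E h r"
    by (auto simp: integral_curve_restrict)
  have "open (f -` U \<inter> S)"
  proof (subst open_subopen, intro ballI)
    fix w assume w: "w \<in> f -` U \<inter> S"
    then obtain t where t: "t \<in> ball 0 r" "h t = f w" unfolding U(1) by auto
    obtain e C where e: "e > 0" "ball w e \<subseteq> S" "C ` ball w e \<subseteq> ball 0 r" "\<And>z. z \<in> ball w e \<Longrightarrow> f z = h (C z)"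
      by (rule tangent_factor[OF assms(1,2) _ U(2) t]) (use w in auto)
    have "ball w e \<subseteq> f -` U \<inter> S" using e unfolding U(1) by blast
    then show "\<exists>T. open T \<and> w \<in> T \<and> T \<subseteq> f -` U \<inter> S" using e(1) by (intro exI[of _ "ball w e"]) auto
  qed
  then show "openin (top_of_set S) (f -` U \<inter> topspace (top_of_set S))" by (simp add: open_subset)
qed

lemma tangent_in_leaf_restrict:
  assumes "tangent f S" "open S" "connected S" "open W" "f ` S \<subseteq> W" "a \<in> S"
  shows "f ` S \<subseteq> leaf (restrict_foliation F W) E (f a)"
proof -
  have "connectedin (leaf_topology (restrict_foliation F W) E) (f ` S)"
    by (rule connectedin_continuous_map_image[OF tangent_continuous_map_restrict[OF assms(1,2,4,5)]])
       (simp add: connectedin_subtopology assms(3))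
  then have "f ` S \<subseteq> connected_component_of_set (leaf_topology (restrict_foliation F W) E) (f a)"
    by (rule connected_component_of_maximal) (use assms(6) in blast)
  moreover have "f a \<notin> E" using assms(1,6) unfolding tangent_def by blast
  ultimately show ?thesis by (simp add: leaf_def)
qed

lemma restrict_foliation_UNIV: "restrict_foliation F UNIV = F"
  by (auto simp: restrict_foliation_def)

lemma tangent_continuous_map:
  "tangent f S \<Longrightarrow> open S \<Longrightarrow> continuous_map (top_of_set S) (leaf_topology F E) f"
  using tangent_continuous_map_restrict[of f S UNIV] by (simp add: restrict_foliation_UNIV)

lemma tangent_in_leaf:
  "tangent f S \<Longrightarrow> open S \<Longrightarrow> connected S \<Longrightarrow> a \<in> S \<Longrightarrow> f ` S \<subseteq> leaf F E (f a)"
  using tangent_in_leaf_restrict[of f S UNIV a] by (simp add: restrict_foliation_UNIV)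

lemma self_in_leaf:
  assumes "p \<notin> E"
  shows "p \<in> leaf F E p"
proof -
  obtain h r where h: "integral_curve F E h r" "h 0 = p"
    by (rule integral_curve_exists[OF assms open_UNIV UNIV_I]) (rule that)
  then have "r > 0" by (simp add: integral_curve_def)
  then have "h 0 \<in> h ` ball 0 r" by auto
  then show ?thesis
    using tangent_in_leaf[OF integral_curve_tangent[OF h(1)] open_ball connected_ball, of 0] \<open>r > 0\<close> h(2) by auto
qed

text \<open>Uniformizations are given as coverings for the leaf topology, and this turns topology
  into velocities. Continuity makes f run in a single plaque near w, so f is h of a holomorphic
  parameter C; local injectivity of f makes C injective, and an injective holomorphic function has
  nonzero derivative.\<close>

lemma leaf_continuous_imp_tangent_immersed:
  assumes f: "hol_curve f S" "open S" "continuous_map (top_of_set S) (leaf_topology F E) f"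
    and inj: "\<And>x. x \<in> S \<Longrightarrow> \<exists>N. open N \<and> x \<in> N \<and> inj_on f (N \<inter> S)"
  shows "tangent f S" "immersed f S"
proof -
  have *: "f w \<notin> E \<and> (\<exists>c v l. (c, v) \<in> F \<and> has_velocity f c (l *s v (f w)) w \<and> l \<noteq> 0)" if w: "w \<in> S" for w
  proof -
    have pE: "f w \<notin> E"
      using f(3) w topspace_leaf_topology_disjoint[of "f w" F E] unfolding continuous_map_def by auto
    obtain h r where h: "integral_curve F E h r" "h 0 = f w"
      by (rule integral_curve_exists[OF pE open_UNIV UNIV_I]) (rule that)
    obtain c v where c: "(c, v) \<in> F" "\<And>t. t \<in> ball 0 r \<Longrightarrow> h t \<in> fst c"
      "\<And>t. t \<in> ball 0 r \<Longrightarrow> has_velocity h c (v (h t)) t" by (rule integral_curveD[OF h(1)], rule that)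
    have cA: "c \<in> charts A" using generatorD(1)[OF c(1)] .
    have r: "0 \<in> ball (0::complex) r" using h(1) by (simp add: integral_curve_def)
    have "v (h 0) \<noteq> 0" using generatorD(3)[OF c(1) c(2)[OF r]] h(2) pE by simp
    note inv = curve_coordinate_inverse[OF tangent_imp_hol_curve[OF integral_curve_tangent[OF h(1)]] open_ball r cA c(3)[OF r] this]
    obtain \<rho> j g where g: "\<rho> > 0" "ball 0 \<rho> \<subseteq> ball (0::complex) r" "open ((\<lambda>z. snd c (h z) $ j) ` ball 0 \<rho>)"
      "g holomorphic_on ((\<lambda>z. snd c (h z) $ j) ` ball 0 \<rho>)"
      "\<And>z. z \<in> ball 0 \<rho> \<Longrightarrow> g (snd c (h z) $ j) = z"
      by (rule inv) (rule that, assumption+)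
    have "\<rho> \<le> r" using g(1,2) by (simp add: ball_subset_ball_iff)
    \<comment> \<open>The shrunken plaque, on which the coordinate inverse g exists, is again a
      generator of the leaf topology and thus open.\<close>
    then have "integral_curve F E (\<lambda>t. h (0 + t)) \<rho>"
      by (intro integral_curve_shift[OF h(1) g(1)]) simp
    then have "openin (leaf_topology F E) (h ` ball 0 \<rho>)"
      unfolding leaf_topology_def by (intro topology_generated_by_Basis) auto
    then have "openin (top_of_set S) {z \<in> S. f z \<in> h ` ball 0 \<rho>}"
      using openin_continuous_map_preimage[OF f(3)] by simp
    then have op: "open {z \<in> S. f z \<in> h ` ball 0 \<rho>}" using openin_open_eq[OF f(2)] by blast
    obtain N0 where N0: "open N0" "w \<in> N0" "inj_on f (N0 \<inter> S)" using inj[OF w] by blast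
    define N where "N = N0 \<inter> {z \<in> S. f z \<in> h ` ball 0 \<rho>}"
    have N: "open N" "w \<in> N" "N \<subseteq> S" using op N0 w g(1) h(2) unfolding N_def
      by (auto intro!: image_eqI[of _ _ 0])
    define C where "C = (\<lambda>z. g (snd c (f z) $ j))"
    have hC: "C z \<in> ball 0 \<rho>" "f z = h (C z)" if z: "z \<in> N" for z
    proof -
      obtain t where t: "t \<in> ball 0 \<rho>" "f z = h t" using z unfolding N_def by blast
      have "C z = t" unfolding C_def t(2) using g(5)[OF t(1)] .
      then show "C z \<in> ball 0 \<rho>" "f z = h (C z)" using t by auto
    qed
    have "(\<lambda>z. snd c (f z) $ j) holomorphic_on N"
      by (rule hol_curve_holomorphic[OF hol_curve_subset[OF f(1) N(3)] N(1) chart_holomorphic[OF cA]])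
        (use hC c(2) g(2) in \<open>auto simp: subset_iff\<close>)
    moreover have "(\<lambda>z. snd c (f z) $ j) ` N \<subseteq> (\<lambda>z. snd c (h z) $ j) ` ball 0 \<rho>"
      using hC by auto
    ultimately have Chol: "C holomorphic_on N"
      unfolding C_def using holomorphic_on_compose_gen[OF _ g(4)] by (simp add: o_def)
    have "inj_on C N"
    proof (rule inj_onI)
      fix x y assume "x \<in> N" "y \<in> N" "C x = C y"
      moreover from this have "f x = f y" using hC(2) by metis
      ultimately show "x = y" using inj_onD[OF N0(3)] unfolding N_def by blast
    qed
    then have nz: "deriv C w \<noteq> 0" by (rule holomorphic_injective_imp_regular[OF Chol N(1) _ N(2)])
    have "has_velocity h c (v (h (C w))) (C w)" using c(3) hC(1)[OF N(2)] g(2) by blast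
    moreover have "(C has_field_derivative deriv C w) (at w)" by (rule holomorphic_derivI[OF Chol N(1,2)])
    ultimately have "has_velocity (\<lambda>z. h (C z)) c (deriv C w *s v (h (C w))) w" by (rule has_velocity_comp)
    then have "has_velocity f c (deriv C w *s v (h (C w))) w"
      by (rule has_velocity_cong[OF _ N(1,2)]) (simp add: hC(2))
    then show ?thesis using pE c(1) nz hC(2)[OF N(2)] by metis
  qed
  then show "tangent f S" unfolding tangent_def by blast
  show "immersed f S"
    unfolding immersed_def
  proof
    fix w assume w: "w \<in> S"
    from *[OF w] obtain c v l where c: "f w \<notin> E" "(c, v) \<in> F" "has_velocity f c (l *s v (f w)) w" "l \<noteq> 0" by blast
    have "f w \<in> fst c" using c(3) by (simp add: has_velocity_def)
    then have "v (f w) \<noteq> 0" using generatorD(3)[OF c(2)] c(1) by blast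
    then have "l *s v (f w) \<noteq> 0" using c(4) by (simp add: vec_eq_iff)
    then show "\<exists>c\<in>charts A. \<exists>u. u \<noteq> 0 \<and> has_velocity f c u w" using c(3) generatorD(1)[OF c(2)] by blast
  qed
qed

end

section \<open>Uniformizations and the extremal problem\<close>

lemma interior_of_countable_closed_cover:
  fixes T :: "'a::complete_space set"
  assumes "closed T" "countable \<G>" "\<And>G. G \<in> \<G> \<Longrightarrow> closedin (top_of_set T) G" "T = \<Union>\<G>" "T \<noteq> {}"
  obtains G where "G \<in> \<G>" "top_of_set T interior_of G \<noteq> {}"
proof -
  have "completely_metrizable_space (top_of_set T)"
    by (rule completely_metrizable_space_closedin[OF completely_metrizable_space_euclidean]) (simp add: assms(1))
  then have "\<exists>G\<in>\<G>. top_of_set T interior_of G \<noteq> {}"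
    using Baire_category_alt[of "top_of_set T" \<G>] assms(2-5)
    by (metis interior_of_topspace topspace_euclidean_subtopology)
  then show ?thesis using that by blast
qed

context foliation
begin

section \<open>Uniformizations as tangent, immersed coverings\<close>

lemma uniformizesD:
  assumes "uniformizes A E F \<alpha> (leaf F E p)"
  shows "hol_curve \<alpha> unit_disc"
    "covering_map (top_of_set unit_disc) \<alpha> (subtopology (leaf_topology F E) (leaf F E p))"
    "tangent \<alpha> unit_disc" "immersed \<alpha> unit_disc"
proof -
  show h: "hol_curve \<alpha> unit_disc" using assms by (simp add: uniformizes_def leaf_discs_def holomorphic_disc_iff)
  show cov: "covering_map (top_of_set unit_disc) \<alpha> (subtopology (leaf_topology F E) (leaf F E p))"
    using assms by (simp add: uniformizes_def)
  have c: "continuous_map (top_of_set unit_disc) (leaf_topology F E) \<alpha>"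
    using cov[unfolded covering_map_def, THEN conjunct1] by (rule continuous_map_into_fulltopology)
  have inj: "\<exists>N. open N \<and> x \<in> N \<and> inj_on \<alpha> (N \<inter> unit_disc)" if x: "x \<in> unit_disc" for x
  proof -
    obtain V where V: "openin (top_of_set unit_disc) V" "x \<in> V" "inj_on \<alpha> V"
      by (rule covering_map_local_inj[OF cov, of x]) (use x in auto)
    have "open V" using V(1) openin_open_eq[OF open_ball] by blast
    moreover have "inj_on \<alpha> (V \<inter> unit_disc)" using V(3) by (rule inj_on_subset) auto
    ultimately show ?thesis using V(2) by blast
  qed
  show "tangent \<alpha> unit_disc" "immersed \<alpha> unit_disc"
    using leaf_continuous_imp_tangent_immersed[OF h open_ball c inj] by blast+
qed

lemma uniformizes_image:
  assumes "uniformizes A E F \<alpha> (leaf F E p)" "p \<notin> E"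
  shows "\<alpha> ` unit_disc = leaf F E p"
proof -
  have "leaf F E p \<subseteq> topspace (leaf_topology F E)"
    using assms(2) by (auto simp: leaf_def dest: connected_component_in_topspace)
  then show ?thesis
    using uniformizesD(2)[OF assms(1), unfolded covering_map_def, THEN conjunct2, THEN conjunct1]
    by (simp add: Int_absorb1)
qed

lemma uniformizationE:
  assumes "\<alpha> \<in> uniformizations A E F"
  obtains p where "p \<notin> E" "uniformizes A E F \<alpha> (leaf F E p)"
  using assms unfolding uniformizations_def by blast

text \<open>A tangent disc that starts on the leaf stays on it and is continuous for the leaf
  topology, which is what lifting through the covering requires.\<close>

lemma lift_through_uniformization:
  assumes \<alpha>: "\<alpha> \<in> uniformizations A E F" and f: "tangent f (ball 0 r)" "r > 0" and x0: "x0 \<in> unit_disc" "\<alpha> x0 = f 0"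
  obtains \<beta> where "\<beta> holomorphic_on ball 0 r" "\<beta> ` ball 0 r \<subseteq> unit_disc" "\<beta> 0 = x0"
    "\<And>w. w \<in> ball 0 r \<Longrightarrow> \<alpha> (\<beta> w) = f w"
proof -
  obtain p where p: "p \<notin> E" "uniformizes A E F \<alpha> (leaf F E p)" by (rule uniformizationE[OF \<alpha>])
  have 0: "0 \<in> ball (0::complex) r" using f(2) by simp
  have "f 0 \<in> leaf F E p" using imageI[OF x0(1), of \<alpha>] uniformizes_image[OF p(2,1)] x0(2) by simp
  then have "leaf F E (f 0) = leaf F E p" by (rule leaf_memD(2)[OF _ p(1)])
  then have "f ` ball 0 r \<subseteq> leaf F E p" using tangent_in_leaf[OF f(1) open_ball connected_ball 0] by simp
  then have cm: "continuous_map (top_of_set (ball 0 r)) (subtopology (leaf_topology F E) (leaf F E p)) f"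
    using tangent_continuous_map[OF f(1) open_ball] by (simp add: continuous_map_in_subtopology image_subset_iff_funcset)
  obtain \<beta> where l: "lift_on \<alpha> unit_disc f (ball 0 r) \<beta>" "\<beta> 0 = x0"
    by (rule covering_disc_lifting[OF uniformizesD(2)[OF p(2)] open_ball cm f(2) x0]) (rule that)
  then have \<beta>: "continuous_on (ball 0 r) \<beta>" "\<beta> ` ball 0 r \<subseteq> unit_disc" "\<And>w. w \<in> ball 0 r \<Longrightarrow> \<alpha> (\<beta> w) = f w"
    by (simp_all add: lift_on_def)
  from \<beta>(1) have "\<beta> holomorphic_on ball 0 r"
    by (rule lift_holomorphic[OF uniformizesD(4)[OF p(2)] open_ball tangent_imp_hol_curve[OF f(1)] open_ball _ \<beta>(2,3)])
  then show ?thesis using \<beta>(2) l(2) \<beta>(3) by (rule that)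
qed

section \<open>Tangency of arbitrary discs in a leaf\<close>

lemma tangent_compose:
  assumes "tangent \<alpha> S" "\<beta> holomorphic_on T" "open T" "\<beta> ` T \<subseteq> S"
  shows "tangent (\<lambda>z. \<alpha> (\<beta> z)) T"
  unfolding tangent_def
proof (intro ballI conjI)
  fix z assume z: "z \<in> T"
  then have bz: "\<beta> z \<in> S" using assms(4) by blast
  then show "\<alpha> (\<beta> z) \<notin> E" using assms(1) unfolding tangent_def by blast
  obtain c v l where c: "(c, v) \<in> F" "has_velocity \<alpha> c (l *s v (\<alpha> (\<beta> z))) (\<beta> z)"
    using assms(1) bz unfolding tangent_def by blast
  have "has_velocity (\<lambda>z. \<alpha> (\<beta> z)) c (deriv \<beta> z *s (l *s v (\<alpha> (\<beta> z)))) z"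
    by (rule has_velocity_comp[OF c(2) holomorphic_derivI[OF assms(2,3) z]])
  then have "has_velocity (\<lambda>z. \<alpha> (\<beta> z)) c ((deriv \<beta> z * l) *s v (\<alpha> (\<beta> z))) z"
    by (simp add: vector_smult_assoc)
  then show "\<exists>c v l. (c, v) \<in> F \<and> has_velocity (\<lambda>z. \<alpha> (\<beta> z)) c (l *s v (\<alpha> (\<beta> z))) z"
    using c(1) by blast
qed

lemma tangent_cong:
  assumes "tangent f S" "open S" "\<And>z. z \<in> S \<Longrightarrow> f z = f' z"
  shows "tangent f' S"
  unfolding tangent_def
proof (intro ballI conjI)
  fix z assume z: "z \<in> S"
  then show "f' z \<notin> E" using assms(1,3) unfolding tangent_def by fastforce
  obtain c v l where c: "(c, v) \<in> F" "has_velocity f c (l *s v (f z)) z"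
    using assms(1) z unfolding tangent_def by blast
  have "has_velocity f' c (l *s v (f z)) z" by (rule has_velocity_cong[OF c(2) assms(2) z assms(3)])
  then show "\<exists>c v l. (c, v) \<in> F \<and> has_velocity f' c (l *s v (f' z)) z" using c(1) assms(3)[OF z] by metis
qed

text \<open>The minors of velocity against generator are holomorphic along f and vanish on V, hence
  on all of the connected set S by the identity theorem.\<close>

lemma tangent_extend:
  assumes f: "hol_curve f S" "open S" "connected S" and V: "open V" "V \<noteq> {}" "V \<subseteq> S" "tangent f V"
    and cv: "(c, v) \<in> F" "\<And>z. z \<in> S \<Longrightarrow> f z \<in> fst c" and w: "w \<in> S" "f w \<notin> E"
  obtains l where "has_velocity f c (l *s v (f w)) w"
proof -
  note cA = generatorD(1)[OF cv(1)]
  define d where "d = (\<lambda>i. deriv (\<lambda>z. snd c (f z) $ i))"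
  have hc: "(\<lambda>z. snd c (f z) $ i) holomorphic_on S" for i
    by (rule hol_curve_holomorphic[OF f(1,2) chart_holomorphic[OF cA] cv(2)])
  have hd: "d i holomorphic_on S" for i unfolding d_def by (rule holomorphic_deriv[OF hc f(2)])
  have hv: "(\<lambda>z. v (f z) $ i) holomorphic_on S" for i
    by (rule hol_curve_holomorphic[OF f(1,2) generatorD(2)[OF cv(1)] cv(2)])
  have eqV: "d i z * v (f z) $ j = d j z * v (f z) $ i" if z: "z \<in> V" for i j z
  proof -
    have "f z \<in> fst c" using cv(2) z V(3) by blast
    then obtain l where l: "has_velocity f c (l *s v (f z)) z" by (rule tangent_velocity[OF V(4) z cv(1)])
    have "d k z = l * v (f z) $ k" for k
      unfolding d_def using l unfolding has_velocity_def by (auto intro: DERIV_imp_deriv)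
    then show ?thesis by simp
  qed
  have eq: "d i w * v (f w) $ j = d j w * v (f w) $ i" for i j
    by (rule analytic_continuation_open[OF V(1) f(2) V(2) f(3) V(3) holomorphic_on_mult[OF hd hv] holomorphic_on_mult[OF hd hv] eqV w(1)])
  obtain u where u: "has_velocity f c u w" by (rule hol_curve_velocity[OF f(1) w(1) cA cv(2)[OF w(1)]])
  have du: "d i w = u $ i" for i
    unfolding d_def using u unfolding has_velocity_def by (auto intro: DERIV_imp_deriv)
  show ?thesis by (rule parallel_velocity[OF u cv(1) w(2) eq[unfolded du]]) (rule that)
qed

text \<open>A leaf may meet a chart in a dense set of plaques. It is covered by countably many compact pieces
  \<open>\<alpha> ` cball x \<rho>\<close>, so by Baire's theorem \<open>f\<close> maps some nonempty open set into a single piece, where it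
  factors through \<open>\<alpha>\<close>; tangency then spreads by analytic continuation.\<close>

lemma leaf_disc_tangent:
  assumes "hyperbolic A E F" "f \<in> leaf_discs A E F"
  shows "tangent f unit_disc"
proof -
  have f: "hol_curve f unit_disc" using assms(2) by (simp add: leaf_discs_def holomorphic_disc_iff)
  obtain p where p: "p \<notin> E" "f ` unit_disc \<subseteq> leaf F E p" using assms(2) by (auto simp: leaf_discs_def)
  obtain \<alpha> where \<alpha>: "uniformizes A E F \<alpha> (leaf F E p)" using assms(1) p(1) unfolding hyperbolic_def by blast
  note \<alpha>D = uniformizesD[OF \<alpha>]
  have fE: "f w \<notin> E" if "w \<in> unit_disc" for w using leaf_memD(1)[OF _ p(1)] p(2) that by blast
  \<comment> \<open>The data of a local coordinate inverse of \<alpha> around x, packaged so that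
    one can be chosen for every x.\<close>
  define P where "P = (\<lambda>x \<rho> c j g. \<rho> > 0 \<and> c \<in> charts A \<and> ball x \<rho> \<subseteq> unit_disc \<and> (\<forall>z\<in>ball x \<rho>. \<alpha> z \<in> fst c) \<and>
     open ((\<lambda>z. snd c (\<alpha> z) $ j) ` ball x \<rho>) \<and> g holomorphic_on ((\<lambda>z. snd c (\<alpha> z) $ j) ` ball x \<rho>) \<and>
     (\<forall>z\<in>ball x \<rho>. g (snd c (\<alpha> z) $ j) = z))"
  have "\<exists>\<rho> c j g. P x \<rho> c j g" if x: "x \<in> unit_disc" for x
  proof -
    obtain c u where c: "c \<in> charts A" "u \<noteq> 0" "has_velocity \<alpha> c u x" using \<alpha>D(4) x unfolding immersed_def by blast
    obtain \<rho> j g where "\<rho> > 0" "ball x \<rho> \<subseteq> unit_disc" "\<And>z. z \<in> ball x \<rho> \<Longrightarrow> \<alpha> z \<in> fst c"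
    "open ((\<lambda>z. snd c (\<alpha> z) $ j) ` ball x \<rho>)" "g holomorphic_on ((\<lambda>z. snd c (\<alpha> z) $ j) ` ball x \<rho>)"
    "\<And>z. z \<in> ball x \<rho> \<Longrightarrow> g (snd c (\<alpha> z) $ j) = z"
      by (rule curve_coordinate_inverse[OF \<alpha>D(1) open_ball x c(1,3,2)]) (rule that)
    then have "P x \<rho> c j g" unfolding P_def using c(1) by blast
    then show ?thesis by blast
  qed
  then obtain \<rho> C J G where "\<And>x. x \<in> unit_disc \<Longrightarrow> P x (\<rho> x) (C x) (J x) (G x)" by metis
  note R = this[unfolded P_def]
  \<comment> \<open>Half the radius, so that the closed discs, whose images are compact, still lie
    in the domains of the coordinate inverses. Lindelof's theorem leaves countably many.\<close>
  define B where "B = (\<lambda>x. ball x (\<rho> x / 2))"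
  obtain \<B> where \<B>: "\<B> \<subseteq> B ` unit_disc" "countable \<B>" "\<Union>\<B> = \<Union>(B ` unit_disc)"
    using Lindelof[of "B ` unit_disc"] by (auto simp: B_def)
  obtain X where X: "X \<subseteq> unit_disc" "countable X" "\<B> = B ` X" using \<B>(1,2) countable_subset_image[of \<B> B unit_disc] by metis
  have cover: "\<exists>x\<in>X. t \<in> B x" if "t \<in> unit_disc" for t
  proof -
    have "t \<in> B t" using R[OF that] by (simp add: B_def)
    then have "t \<in> \<Union>\<B>" using that \<B>(3) by blast
    then show ?thesis using X(3) by blast
  qed
  show ?thesis
    unfolding tangent_def
  proof (intro ballI conjI fE)
    fix w0 :: complex assume w0: "w0 \<in> unit_disc"
    obtain c v where cv: "(c, v) \<in> F" "f w0 \<in> fst c" by (rule generator_exists)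
    obtain S1 where S1: "open S1" "w0 \<in> S1" "\<And>z. z \<in> S1 \<Longrightarrow> f z \<in> fst c"
      by (rule isCont_open_preimage[OF hol_curve_isCont[OF f w0] chart_homeomorphism(1)[OF generatorD(1)[OF cv(1)]] cv(2)])
         (rule that)
    have "open (S1 \<inter> unit_disc)" "w0 \<in> S1 \<inter> unit_disc" using S1 w0 by auto
    then obtain e where e: "e > 0" "ball w0 e \<subseteq> S1 \<inter> unit_disc" by (meson openE)
    have e2: "cball w0 (e/2) \<subseteq> ball w0 e" using e(1) by auto
    define K where "K = (\<lambda>x. {w \<in> cball w0 (e/2). f w \<in> \<alpha> ` cball x (\<rho> x / 2)})"
    have cb: "cball x (\<rho> x / 2) \<subseteq> ball x (\<rho> x)" if "x \<in> unit_disc" for x using R[OF that] by auto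
    have Kc: "closedin (top_of_set (cball w0 (e/2))) (K x)" if "x \<in> X" for x
    proof -
      have x: "x \<in> unit_disc" using that X(1) by blast
      have "continuous_on (cball x (\<rho> x / 2)) \<alpha>"
        using continuous_on_subset[OF hol_curve_continuous_on[OF \<alpha>D(1)]] cb[OF x] R[OF x] by blast
      then have "compact (\<alpha> ` cball x (\<rho> x / 2))" by (rule compact_continuous_image) simp
      then have "closed (\<alpha> ` cball x (\<rho> x / 2))" by (rule compact_imp_closed)
      moreover have "continuous_on (cball w0 (e/2)) f"
        using continuous_on_subset[OF hol_curve_continuous_on[OF f]] e e2 by blast
      ultimately have "closedin (top_of_set (cball w0 (e/2))) (cball w0 (e/2) \<inter> f -` (\<alpha> ` cball x (\<rho> x / 2)))"
        by (intro continuous_closedin_preimage)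
      moreover have "cball w0 (e/2) \<inter> f -` (\<alpha> ` cball x (\<rho> x / 2)) = K x" by (auto simp: K_def)
      ultimately show ?thesis by simp
    qed
    have "cball w0 (e/2) = \<Union>(K ` X)"
    proof (intro equalityI subsetI)
      fix w assume w: "w \<in> cball w0 (e/2)"
      then have "w \<in> unit_disc" using e e2 by blast
      then have "f w \<in> \<alpha> ` unit_disc" using p(2) uniformizes_image[OF \<alpha> p(1)] by blast
      then obtain t where t: "t \<in> unit_disc" "f w = \<alpha> t" by blast
      then obtain x where "x \<in> X" "t \<in> B x" using cover by blast
      then have "w \<in> K x" using w t(2) unfolding K_def B_def by auto
      then show "w \<in> \<Union>(K ` X)" using \<open>x \<in> X\<close> by blast
    qed (auto simp: K_def)
    moreover have "countable (K ` X)" "cball w0 (e/2) \<noteq> {}" using X(2) e(1) by auto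
    ultimately obtain Z where Z: "Z \<in> K ` X" "top_of_set (cball w0 (e/2)) interior_of Z \<noteq> {}"
      using interior_of_countable_closed_cover[OF closed_cball, of "K ` X" w0 "e/2"] Kc by blast
    then obtain x where x: "x \<in> X" "Z = K x" by blast
    obtain y where "y \<in> top_of_set (cball w0 (e/2)) interior_of K x" using Z(2) x(2) by blast
    then obtain Q where "openin (top_of_set (cball w0 (e/2))) Q" "y \<in> Q" "Q \<subseteq> K x"
      unfolding interior_of_def by blast
    then obtain O' where O': "open O'" "y \<in> cball w0 (e/2)" "y \<in> O'" "cball w0 (e/2) \<inter> O' \<subseteq> K x"
      unfolding openin_open by blast
    \<comment> \<open>A relatively open part of the closed disc still meets the open disc, because
      the former is the closure of the latter. The intersection V is open in the plane.\<close>
    define V where "V = ball w0 (e/2) \<inter> O'"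
    have V: "open V" "V \<subseteq> K x" "V \<subseteq> ball w0 e" "V \<noteq> {}"
    proof -
      show "open V" "V \<subseteq> K x" "V \<subseteq> ball w0 e" using O'(1,4) e2 by (auto simp: V_def)
      have "y \<in> closure (ball w0 (e/2))" using O'(2) e(1) by simp
      then show "V \<noteq> {}" using O'(1,3) open_Int_closure_eq_empty[of O' "ball w0 (e/2)"] by (auto simp: V_def)
    qed
    have xD: "x \<in> unit_disc" using x(1) X(1) by blast
    note Rx = R[OF xD]
    \<comment> \<open>Reads the parameter of \<alpha> off a coordinate of f; on V the values of f
      lie in the piece around x, so this is a holomorphic factor of f through \<alpha>.\<close>
    define \<beta> where "\<beta> = (\<lambda>w. G x (snd (C x) (f w) $ J x))"
    have \<beta>: "\<beta> w \<in> ball x (\<rho> x)" "\<alpha> (\<beta> w) = f w" if "w \<in> V" for w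
    proof -
      have "f w \<in> \<alpha> ` cball x (\<rho> x / 2)" using V(2) that unfolding K_def by blast
      then obtain t where t: "t \<in> ball x (\<rho> x)" "f w = \<alpha> t" using cb[OF xD] by blast
      then have "\<beta> w = t" unfolding \<beta>_def using Rx by simp
      then show "\<beta> w \<in> ball x (\<rho> x)" "\<alpha> (\<beta> w) = f w" using t by auto
    qed
    have fV: "hol_curve f V" by (rule hol_curve_subset[OF f]) (use V(3) e(2) in blast)
    have "(\<lambda>w. snd (C x) (f w) $ J x) holomorphic_on V"
      by (rule hol_curve_holomorphic[OF fV V(1) chart_holomorphic[of "C x"]]) (use Rx \<beta> in metis)+
    moreover have "(\<lambda>w. snd (C x) (f w) $ J x) ` V \<subseteq> (\<lambda>z. snd (C x) (\<alpha> z) $ J x) ` ball x (\<rho> x)"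
    proof
      fix q assume "q \<in> (\<lambda>w. snd (C x) (f w) $ J x) ` V"
      then obtain w where "w \<in> V" "q = snd (C x) (f w) $ J x" by blast
      then show "q \<in> (\<lambda>z. snd (C x) (\<alpha> z) $ J x) ` ball x (\<rho> x)" using \<beta>[of w] by (intro image_eqI[of _ _ "\<beta> w"]) auto
    qed
    moreover have "G x holomorphic_on ((\<lambda>z. snd (C x) (\<alpha> z) $ J x) ` ball x (\<rho> x))" using Rx by blast
    ultimately have "\<beta> holomorphic_on V"
      unfolding \<beta>_def by (intro holomorphic_on_compose_gen[of "\<lambda>w. snd (C x) (f w) $ J x" V "G x", unfolded o_def])
    then have "tangent (\<lambda>w. \<alpha> (\<beta> w)) V"
      by (rule tangent_compose[OF \<alpha>D(3) _ V(1)]) (use \<beta>(1) Rx in blast)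
    then have fV: "tangent f V" by (rule tangent_cong[OF _ V(1) \<beta>(2)])
    have fB: "hol_curve f (ball w0 e)" by (rule hol_curve_subset[OF f]) (use e(2) in blast)
    have fc: "f z \<in> fst c" if "z \<in> ball w0 e" for z using S1(3) e(2) that by blast
    have wB: "w0 \<in> ball w0 e" using e(1) by simp
    obtain l where "has_velocity f c (l *s v (f w0)) w0"
      by (rule tangent_extend[OF fB open_ball connected_ball V(1,4,3) fV cv(1) fc wB fE[OF w0]]) (assumption, rule that)
    then show "\<exists>c v l. (c, v) \<in> F \<and> has_velocity f c (l *s v (f w0)) w0" using cv(1) by blast
  qed
qed

text \<open>Any uniformization of the leaf takes the value z at some x; composing it with a disc
  automorphism that sends 0 to x moves the base point.\<close>

lemma uniformization_at:
  assumes "hyperbolic A E F" "z \<notin> E"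
  obtains \<alpha> where "\<alpha> \<in> uniformizations A E F" "\<alpha> 0 = z"
proof -
  obtain \<alpha> where \<alpha>: "uniformizes A E F \<alpha> (leaf F E z)" using assms unfolding hyperbolic_def by blast
  have "z \<in> \<alpha> ` unit_disc" using uniformizes_image[OF \<alpha> assms(2)] self_in_leaf[OF assms(2)] by simp
  then obtain x where x: "x \<in> unit_disc" "\<alpha> x = z" by blast
  obtain f g where fg: "f x = 0" "f holomorphic_on unit_disc" "f ` unit_disc \<subseteq> unit_disc"
     "g holomorphic_on unit_disc" "g ` unit_disc \<subseteq> unit_disc"
     "\<And>z. z \<in> unit_disc \<Longrightarrow> f (g z) = z" "\<And>z. z \<in> unit_disc \<Longrightarrow> g (f z) = z"
    by (rule ball_biholomorphism_exists[OF x(1)]) (rule that)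
  have "homeomorphic_maps (top_of_set unit_disc) (top_of_set unit_disc) g f"
    unfolding homeomorphic_maps_def using fg(2-7)
    by (auto simp: holomorphic_on_imp_continuous_on image_subset_iff)
  then have "homeomorphic_map (top_of_set unit_disc) (top_of_set unit_disc) g"
    by (auto simp: homeomorphic_map_maps)
  then have "covering_map (top_of_set unit_disc) (\<alpha> \<circ> g) (subtopology (leaf_topology F E) (leaf F E z))"
    by (rule covering_map_compose_homeomorphic_map[OF uniformizesD(2)[OF \<alpha>]])
  moreover have "hol_curve (\<alpha> \<circ> g) unit_disc"
    unfolding o_def by (rule hol_curve_compose[OF uniformizesD(1)[OF \<alpha>] fg(4) open_ball fg(5)])
  moreover have "(\<alpha> \<circ> g) ` unit_disc \<subseteq> leaf F E z"
    using uniformizes_image[OF \<alpha> assms(2)] fg(5) by auto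
  ultimately have "uniformizes A E F (\<alpha> \<circ> g) (leaf F E z)"
    using assms(2) unfolding uniformizes_def leaf_discs_def holomorphic_disc_iff by blast
  then have "\<alpha> \<circ> g \<in> uniformizations A E F" using assms(2) unfolding uniformizations_def by blast
  moreover have "(\<alpha> \<circ> g) 0 = z" using fg(1) fg(7)[OF x(1)] x(2) by simp
  ultimately show ?thesis by (rule that)
qed

section \<open>Speeds of discs and the modulus of uniformization\<close>

text \<open>The arbitrary choice of chart in \<open>speed0\<close> is harmless, since velocities and
  the metric transform by the same change of coordinates.\<close>

lemma speed0_eq:
  assumes g: "hermitian_metric A g" and "has_velocity f d u 0" "d \<in> A"
  shows "speed0 A g f = sqrt (Re (g d (f 0) u u))"
proof -
  define c where "c = (SOME c. c \<in> A \<and> f 0 \<in> fst c)"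
  have fd: "f 0 \<in> fst d" using assms(2) by (simp add: has_velocity_def)
  then have c: "c \<in> A" "f 0 \<in> fst c"
    using assms(3) someI[of "\<lambda>c. c \<in> A \<and> f 0 \<in> fst c" d] unfolding c_def by auto
  let ?u = "coord_change d c (f 0) u"
  have "has_velocity f c ?u 0"
    by (rule velocity_coord_change[OF assms(2) atlas_subset_charts[OF assms(3)] atlas_subset_charts[OF c(1)] c(2)])
  then have "(\<chi> i. deriv (\<lambda>z. snd c (f z) $ i) 0) = ?u"
    unfolding has_velocity_def vec_eq_iff by (auto intro: DERIV_imp_deriv)
  then have "speed0 A g f = sqrt (Re (g c (f 0) ?u ?u))" by (simp add: speed0_def Let_def flip: c_def)
  moreover have "g d (f 0) u u = g c (f 0) ?u ?u"
    using g assms(3) c fd unfolding hermitian_metric_def by blast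
  ultimately show ?thesis by simp
qed

text \<open>The velocity of f at 0 is that of \<alpha> multiplied by \<open>deriv \<beta> 0\<close>,
  which has modulus at most 1 by the Schwarz lemma.\<close>

lemma speed0_lift_le:
  assumes g: "hermitian_metric A g" and \<alpha>: "hol_curve \<alpha> unit_disc"
    and \<beta>: "\<beta> holomorphic_on unit_disc" "\<beta> ` unit_disc \<subseteq> unit_disc" "\<beta> 0 = 0"
    and f: "\<And>w. w \<in> unit_disc \<Longrightarrow> \<alpha> (\<beta> w) = f w"
  shows "speed0 A g f \<le> speed0 A g \<alpha>"
proof -
  obtain d where d: "d \<in> A" "\<alpha> 0 \<in> fst d" using chart_exists by blast
  obtain u where u: "has_velocity \<alpha> d u 0"
    by (rule hol_curve_velocity[OF \<alpha> _ atlas_subset_charts[OF d(1)] d(2)]) auto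
  define b where "b = deriv \<beta> 0"
  have "(\<beta> has_field_derivative b) (at 0)" unfolding b_def by (rule holomorphic_derivI[OF \<beta>(1) open_ball]) simp
  then have "has_velocity (\<lambda>z. \<alpha> (\<beta> z)) d (b *s u) 0" using has_velocity_comp[where f=\<alpha> and \<beta>=\<beta> and w=0 and b=b] u \<beta>(3) by simp
  then have "has_velocity f d (b *s u) 0" by (rule has_velocity_cong[where S=unit_disc, OF _ open_ball]) (use f in auto)
  then have "speed0 A g f = sqrt (Re (g d (f 0) (b *s u) (b *s u)))" by (rule speed0_eq[OF g _ d(1)])
  moreover have "speed0 A g \<alpha> = sqrt (Re (g d (\<alpha> 0) u u))" by (rule speed0_eq[OF g u d(1)])
  moreover have "f 0 = \<alpha> 0" using f[of 0] \<beta>(3) by simp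
  moreover have "Re (g d (\<alpha> 0) (b *s u) (b *s u)) \<le> Re (g d (\<alpha> 0) u u)"
  proof -
    define q where "q = g d (\<alpha> 0)"
    have lin: "q (a *s u + w) v = a * q u v + q w v" and sym: "q v u = cnj (q u v)"
      and pos: "u \<noteq> 0 \<Longrightarrow> Re (q u u) > 0" for a u v w
      using g d unfolding hermitian_metric_def q_def by blast+
    have z: "q 0 v = 0" for v using lin[of 1 0 0 v] by simp
    have s: "q (a *s u) v = a * q u v" for a u v using lin[of a u 0 v] z by simp
    have "q (b *s u) (b *s u) = b * cnj (b * q u u)" using s sym by metis
    also have "\<dots> = (b * cnj b) * q u u" using sym[of u u] by simp
    also have "b * cnj b = complex_of_real ((norm b)\<^sup>2)" by (rule complex_norm_square[symmetric])
    finally have "Re (q (b *s u) (b *s u)) = (norm b)\<^sup>2 * Re (q u u)" by simp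
    moreover have "norm b \<le> 1" unfolding b_def by (rule Schwarz_Lemma(2)[OF \<beta>(1,3), of 0]) (use \<beta>(2) in \<open>auto simp: image_subset_iff\<close>)
    then have "(norm b)\<^sup>2 \<le> 1" by (simp add: power_le_one)
    moreover have "Re (q u u) \<ge> 0" using pos[of u] z[of u] by (cases "u = 0") auto
    ultimately show ?thesis unfolding q_def by (simp add: mult_left_le_one_le)
  qed
  ultimately show ?thesis by simp
qed

lemma leaf_disc_of_tangent:
  assumes "tangent f unit_disc"
  shows "f \<in> leaf_discs A E F"
proof -
  have "f ` unit_disc \<subseteq> leaf F E (f 0)" by (rule tangent_in_leaf[OF assms open_ball connected_ball]) simp
  moreover have "f 0 \<notin> E" using assms unfolding tangent_def by simp
  ultimately show ?thesis
    using tangent_imp_hol_curve[OF assms] unfolding leaf_discs_def holomorphic_disc_iff by blast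
qed

text \<open>Asks only that tangent discs lift through h, not that h be a covering, and so covers
  uniformizations and their limits alike. The supremum is a maximum attained by h, which settles its
  boundedness too.\<close>

lemma modulus_eqI:
  assumes "hyperbolic A E F" "hermitian_metric A g" and h: "tangent h unit_disc" "h 0 = z"
    and lift: "\<And>f. tangent f unit_disc \<Longrightarrow> f 0 = z \<Longrightarrow>
      \<exists>\<beta>. \<beta> holomorphic_on unit_disc \<and> \<beta> ` unit_disc \<subseteq> unit_disc \<and> \<beta> 0 = 0 \<and> (\<forall>w\<in>unit_disc. h (\<beta> w) = f w)"
  shows "modulus_of_uniformization A g E F z = speed0 A g h"
  unfolding modulus_of_uniformization_def
proof (rule cSup_eq_maximum)
  show "speed0 A g h \<in> {speed0 A g f |f. f \<in> leaf_discs A E F \<and> f 0 = z}"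
    using leaf_disc_of_tangent[OF h(1)] h(2) by blast
  fix x assume "x \<in> {speed0 A g f |f. f \<in> leaf_discs A E F \<and> f 0 = z}"
  then obtain f where f: "x = speed0 A g f" "f \<in> leaf_discs A E F" "f 0 = z" by blast
  obtain \<beta> where "\<beta> holomorphic_on unit_disc" "\<beta> ` unit_disc \<subseteq> unit_disc" "\<beta> 0 = 0" "\<And>w. w\<in>unit_disc \<Longrightarrow> h (\<beta> w) = f w"
    using lift[OF leaf_disc_tangent[OF assms(1) f(2)] f(3)] by blast
  then show "x \<le> speed0 A g h"
    unfolding f(1) by (rule speed0_lift_le[OF assms(2) tangent_imp_hol_curve[OF h(1)]])
qed

lemma modulus_uniformization:
  assumes "hyperbolic A E F" "hermitian_metric A g" "\<alpha> \<in> uniformizations A E F" "\<alpha> 0 = z"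
  shows "modulus_of_uniformization A g E F z = speed0 A g \<alpha>"
proof (rule modulus_eqI[where h=\<alpha> and z=z, OF assms(1,2) _ assms(4)])
  show "tangent \<alpha> unit_disc" using uniformizationE[OF assms(3)] uniformizesD(3) by metis
  fix f assume f: "tangent f unit_disc" "f 0 = z"
  have "\<alpha> 0 = f 0" using f(2) assms(4) by simp
  then obtain \<beta> where "\<beta> holomorphic_on unit_disc" "\<beta> ` unit_disc \<subseteq> unit_disc" "\<beta> 0 = 0" "\<And>w. w\<in>unit_disc \<Longrightarrow> \<alpha> (\<beta> w) = f w"
    by (rule lift_through_uniformization[OF assms(3) f(1) zero_less_one centre_in_ball[THEN iffD2, OF zero_less_one]]) (rule that)
  then show "\<exists>\<beta>. \<beta> holomorphic_on unit_disc \<and> \<beta> ` unit_disc \<subseteq> unit_disc \<and> \<beta> 0 = 0 \<and> (\<forall>w\<in>unit_disc. \<alpha> (\<beta> w) = f w)"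
    by blast
qed

end

section \<open>Limits of uniformizations\<close>

lemma compact_insert_range_LIMSEQ:
  fixes X :: "nat \<Rightarrow> 'a::topological_space"
  assumes "X \<longlonglongrightarrow> l"
  shows "compact (insert l (range X))"
proof (rule compactI)
  fix C assume C: "\<forall>t\<in>C. open t" "insert l (range X) \<subseteq> \<Union>C"
  then obtain T where T: "T \<in> C" "l \<in> T" by auto
  then obtain N where N: "\<And>n. n \<ge> N \<Longrightarrow> X n \<in> T"
    using topological_tendstoD[OF assms] C(1) unfolding eventually_sequentially by metis
  have "\<forall>n. \<exists>t\<in>C. X n \<in> t" using C(2) by auto
  then obtain f where f: "\<And>n. f n \<in> C" "\<And>n. X n \<in> f n" by metis
  have "insert l (range X) \<subseteq> \<Union>(insert T (f ` {..<N}))"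
    using T(2) N f(2) by (auto simp: not_less[symmetric])
  moreover have "finite (insert T (f ` {..<N}))" "insert T (f ` {..<N}) \<subseteq> C" using T(1) f(1) by auto
  ultimately show "\<exists>C'\<subseteq>C. finite C' \<and> insert l (range X) \<subseteq> \<Union>C'" by blast
qed

text \<open>In contrast to \<^const>\<open>converges_compactly\<close>, this involves no metric on the target.\<close>

definition converges_cont :: "(nat \<Rightarrow> complex \<Rightarrow> 'm::topological_space) \<Rightarrow> (complex \<Rightarrow> 'm) \<Rightarrow> bool" where
  "converges_cont a h \<longleftrightarrow> (\<forall>r w w0. strict_mono r \<longrightarrow> (\<forall>k. w k \<in> unit_disc) \<longrightarrow> w0 \<in> unit_disc \<longrightarrow>
     w \<longlonglongrightarrow> w0 \<longrightarrow> (\<lambda>k::nat. a (r k) (w k)) \<longlonglongrightarrow> h w0)"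

lemma converges_contD:
  assumes "converges_cont a h" "strict_mono r" "\<And>k. w k \<in> unit_disc" "w0 \<in> unit_disc" "w \<longlonglongrightarrow> w0"
  shows "(\<lambda>k. a (r k) (w k)) \<longlonglongrightarrow> h w0"
  using assms unfolding converges_cont_def by blast

lemma converges_cont_pointwise:
  assumes "converges_cont a h" "w \<in> unit_disc"
  shows "(\<lambda>k. a k w) \<longlonglongrightarrow> h w"
  using converges_contD[OF assms(1) strict_mono_id, of "\<lambda>_. w" w] assms(2) by simp

lemma converges_cont_subseq:
  assumes "converges_cont a h" "strict_mono s"
  shows "converges_cont (\<lambda>n. a (s n)) h"
  unfolding converges_cont_def
proof (intro allI impI)
  fix r :: "nat \<Rightarrow> nat" and w w0 assume *: "strict_mono r" "\<forall>k. w k \<in> unit_disc" "w0 \<in> unit_disc" "w \<longlonglongrightarrow> w0"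
  show "(\<lambda>k. a (s (r k)) (w k)) \<longlonglongrightarrow> h w0"
    by (rule converges_contD[OF assms(1), of "\<lambda>k. s (r k)"])
      (use * assms(2) in \<open>auto simp: strict_mono_def\<close>)
qed

lemma converges_compactly_imp_cont:
  assumes "converges_compactly a h" "continuous_on unit_disc h"
  shows "converges_cont a h"
  unfolding converges_cont_def
proof (intro allI impI)
  fix r :: "nat \<Rightarrow> nat" and w w0
  assume r: "strict_mono r" and w: "\<forall>k. w k \<in> unit_disc" "w0 \<in> unit_disc" "w \<longlonglongrightarrow> w0"
  obtain d where d: "Metric_space UNIV d" "Metric_space.mtopology UNIV d = euclidean"
    and conv: "\<And>K \<epsilon>. compact K \<Longrightarrow> K \<subseteq> unit_disc \<Longrightarrow> \<epsilon> > 0 \<Longrightarrow> \<forall>\<^sub>F k in sequentially. \<forall>z\<in>K. d (a k z) (h z) < \<epsilon>"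
    using assms(1) unfolding converges_compactly_def by blast
  interpret M: Metric_space UNIV d by (rule d(1))
  \<comment> \<open>The moving points with their limit form a compact set, on which the convergence
    is uniform.\<close>
  let ?K = "insert w0 (range w)"
  have K: "compact ?K" "?K \<subseteq> unit_disc" using compact_insert_range_LIMSEQ[OF w(3)] w(1,2) by auto
  show "(\<lambda>k. a (r k) (w k)) \<longlonglongrightarrow> h w0"
  proof (rule topological_tendstoI)
    fix W assume W: "open W" "h w0 \<in> W"
    then have "openin M.mtopology W" by (simp add: d(2))
    then obtain e where e: "e > 0" "M.mball (h w0) e \<subseteq> W" using W(2) unfolding M.openin_mtopology by blast
    have "\<forall>\<^sub>F k in sequentially. \<forall>z\<in>?K. d (a k z) (h z) < e/2" by (rule conv[OF K]) (use e(1) in simp)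
    then have 1: "\<forall>\<^sub>F k in sequentially. \<forall>z\<in>?K. d (a (r k) z) (h z) < e/2" by (rule eventually_subseq[OF r])
    have "open (M.mball (h w0) (e/2))" using M.openin_mball[of "h w0" "e/2"] unfolding d(2) by simp
    moreover have "(\<lambda>k. h (w k)) \<longlonglongrightarrow> h w0"
      by (rule continuous_on_tendsto_compose[OF assms(2) w(3)]) (use w in auto)
    ultimately have 2: "\<forall>\<^sub>F k in sequentially. h (w k) \<in> M.mball (h w0) (e/2)"
      using e(1) by (intro topological_tendstoD) auto
    show "\<forall>\<^sub>F k in sequentially. a (r k) (w k) \<in> W"
      using 1 2
    proof eventually_elim
      case (elim k)
      have "d (h w0) (a (r k) (w k)) \<le> d (h w0) (h (w k)) + d (h (w k)) (a (r k) (w k))" by (rule M.triangle) auto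
      also have "d (h w0) (h (w k)) < e/2" using elim(2) by simp
      also have "d (h (w k)) (a (r k) (w k)) < e/2"
        using elim(1) M.commute[of "h (w k)" "a (r k) (w k)"] by simp
      finally show ?case using e(2) by auto
    qed
  qed
qed

text \<open>If this failed, there would be violating points of K along a subsequence; by compactness
  they converge along a further one, against convergence at moving points. The freedom to pass to
  subsequences is part of \<open>converges_cont\<close> for this purpose.\<close>

lemma converges_cont_uniform:
  fixes G :: "'m::t2_space \<Rightarrow> 'b::metric_space"
  assumes ah: "converges_cont a h" "continuous_on unit_disc h" and K: "compact K" "K \<subseteq> unit_disc"
    and W: "open W" "h ` K \<subseteq> W" and G: "\<And>p. p \<in> W \<Longrightarrow> isCont G p"
  shows "\<forall>\<^sub>F n in sequentially. \<forall>z\<in>K. a n z \<in> W"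
    "uniform_limit K (\<lambda>n z. G (a n z)) (\<lambda>z. G (h z)) sequentially"
proof -
  have main: "\<forall>\<^sub>F n in sequentially. \<forall>z\<in>K. a n z \<in> W \<and> dist (G (a n z)) (G (h z)) < e" if e: "e > 0" for e
  proof (rule ccontr)
    assume "\<not> ?thesis"
    from not_eventually_sequentiallyD[OF this] obtain r :: "nat \<Rightarrow> nat" where r: "strict_mono r"
      "\<And>n. \<exists>z\<in>K. \<not> (a (r n) z \<in> W \<and> dist (G (a (r n) z)) (G (h z)) < e)" by blast
    then obtain z where z: "\<And>n. z n \<in> K" "\<And>n. \<not> (a (r n) (z n) \<in> W \<and> dist (G (a (r n) (z n))) (G (h (z n))) < e)"
      by metis
    obtain s z0 where s: "strict_mono s" "z0 \<in> K" "(z \<circ> s) \<longlonglongrightarrow> z0"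
      using K(1) z(1) unfolding compact_eq_seq_compact_metric seq_compact_def by metis
    have rs: "strict_mono (\<lambda>n. r (s n))" using r(1) s(1) by (simp add: strict_mono_def)
    have zs: "(\<lambda>n. z (s n)) \<longlonglongrightarrow> z0" using s(3) by (simp add: o_def)
    have zD: "\<And>n. z (s n) \<in> unit_disc" "z0 \<in> unit_disc" using z(1) s(2) K(2) by blast+
    have 1: "(\<lambda>n. a (r (s n)) (z (s n))) \<longlonglongrightarrow> h z0" by (rule converges_contD[OF ah(1) rs zD zs])
    have 2: "(\<lambda>n. h (z (s n))) \<longlonglongrightarrow> h z0"
      by (rule continuous_on_tendsto_compose[OF ah(2) zs zD(2)]) (use zD(1) in auto)
    have hW: "h z0 \<in> W" using W(2) s(2) by blast
    have "(\<lambda>n. dist (G (a (r (s n)) (z (s n)))) (G (h (z (s n))))) \<longlonglongrightarrow> dist (G (h z0)) (G (h z0))"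
      by (intro tendsto_dist isCont_tendsto_compose[OF G[OF hW]] 1 2)
    then have "\<forall>\<^sub>F n in sequentially. dist (G (a (r (s n)) (z (s n)))) (G (h (z (s n)))) < e"
      using e by (intro order_tendstoD(2)) simp_all
    moreover have "\<forall>\<^sub>F n in sequentially. a (r (s n)) (z (s n)) \<in> W"
      by (rule topological_tendstoD[OF 1 W(1) hW])
    ultimately have "\<forall>\<^sub>F n in sequentially. False"
      by eventually_elim (use z(2) in blast)
    then show False by simp
  qed
  show "\<forall>\<^sub>F n in sequentially. \<forall>z\<in>K. a n z \<in> W" using main[OF zero_less_one] by (rule eventually_mono) blast
  show "uniform_limit K (\<lambda>n z. G (a n z)) (\<lambda>z. G (h z)) sequentially"
    unfolding uniform_limit_iff using main by (blast intro: eventually_mono)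
qed

text \<open>Either almost all \<open>f n\<close> vanish identically, and so does their limit, or
  infinitely many are free of zeros. Then Hurwitz's theorem forces g, which has a zero, to be
  constant.\<close>

lemma Hurwitz_zero:
  assumes B: "open B" "connected B" and f: "\<And>n. f n holomorphic_on B" "g holomorphic_on B"
    and ul: "\<And>K. compact K \<Longrightarrow> K \<subseteq> B \<Longrightarrow> uniform_limit K f g sequentially"
    and dich: "\<And>n::nat. (\<forall>z\<in>B. f n z = 0) \<or> (\<forall>z\<in>B. f n z \<noteq> 0)"
    and z0: "z0 \<in> B" "g z0 = 0" and z: "z \<in> B"
  shows "g z = 0"
proof (cases "\<forall>\<^sub>F n in sequentially. \<not> (\<forall>z\<in>B. f n z \<noteq> 0)")
  case True
  have "uniform_limit {z} f g sequentially" by (rule ul) (use z in auto)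
  then have "(\<lambda>n. f n z) \<longlonglongrightarrow> g z" by (rule tendsto_uniform_limitI) simp
  moreover have "\<forall>\<^sub>F n in sequentially. f n z = 0" using True by (rule eventually_mono) (use dich z in blast)
  ultimately have "(\<lambda>n. 0) \<longlonglongrightarrow> g z" using tendsto_cong by fastforce
  then show ?thesis using LIMSEQ_unique tendsto_const by blast
next
  case False
  from not_eventually_sequentiallyD[OF this] obtain r :: "nat \<Rightarrow> nat" where r: "strict_mono r" "\<And>n. \<forall>z\<in>B. f (r n) z \<noteq> 0" by blast
  have ulr: "uniform_limit K (\<lambda>n. f (r n)) g sequentially" if "compact K" "K \<subseteq> B" for K
    by (rule filterlim_compose[OF ul[OF that] filterlim_subseq[OF r(1)]])
  have "g constant_on B"
  proof (rule ccontr)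
    assume nc: "\<not> g constant_on B"
    have "g z0 \<noteq> 0"
      by (rule Hurwitz_no_zeros[where \<F>="\<lambda>n. f (r n)", OF B f(1) f(2) ulr nc _ z0(1)]) (use r(2) in auto)
    then show False using z0(2) by simp
  qed
  then show ?thesis using z z0 unfolding constant_on_def by metis
qed

context complex_mfd
begin

lemma converges_cont_deriv:
  assumes ah: "converges_cont a h" "\<And>n. hol_curve (a n) unit_disc" "hol_curve h unit_disc"
    and G: "holomorphic_fun_on A G W" "open W" and w: "w \<in> unit_disc" "h w \<in> W"
  shows "(\<lambda>n. deriv (\<lambda>z. G (a n z)) w) \<longlonglongrightarrow> deriv (\<lambda>z. G (h z)) w"
proof -
  obtain S where S: "open S" "w \<in> S" "\<And>z. z \<in> S \<Longrightarrow> h z \<in> W"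
    by (rule isCont_open_preimage[OF hol_curve_isCont[OF ah(3) w(1)] G(2) w(2)]) (rule that)
  have "open (S \<inter> unit_disc)" "w \<in> S \<inter> unit_disc" using S w by auto
  then obtain e where e: "e > 0" "cball w e \<subseteq> S \<inter> unit_disc" by (meson open_contains_cball)
  have eD: "cball w e \<subseteq> unit_disc" "h ` cball w e \<subseteq> W" using e(2) S(3) by blast+
  note hc = hol_curve_continuous_on[OF ah(3)]
  have u: "\<forall>\<^sub>F n in sequentially. \<forall>z\<in>cball w e. a n z \<in> W"
      "uniform_limit (cball w e) (\<lambda>n z. G (a n z)) (\<lambda>z. G (h z)) sequentially"
    by (rule converges_cont_uniform[OF ah(1) hc compact_cball eD(1) G(2) eD(2) holomorphic_fun_isCont[OF G(1)]], assumption)+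
  have "((\<lambda>n. (deriv ^^ 1) (\<lambda>z. G (a n z)) w) \<longlonglongrightarrow> (deriv ^^ 1) (\<lambda>z. G (h z)) w)"
  proof (rule higher_deriv_complex_uniform_limit[where A="ball w e"])
    show "uniform_limit (ball w e) (\<lambda>n z. G (a n z)) (\<lambda>z. G (h z)) sequentially"
      by (rule uniform_limit_on_subset[OF u(2) ball_subset_cball])
    show "\<forall>\<^sub>F n in sequentially. (\<lambda>z. G (a n z)) holomorphic_on ball w e"
      using u(1)
    proof eventually_elim
      case (elim n)
      have "hol_curve (a n) (ball w e)" by (rule hol_curve_subset[OF ah(2)]) (use eD(1) ball_subset_cball in blast)
      then show ?case by (rule hol_curve_holomorphic[OF _ open_ball G(1)]) (use elim in auto)
    qed
  qed (use e(1) in auto)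
  then show ?thesis by simp
qed

end

text \<open>A metric is continuous in the base point for each fixed pair of vectors. Expanding in
  matrix entries lets base point and vectors converge together.\<close>

lemma hermitian_form_expand:
  fixes q :: "complex^'n \<Rightarrow> complex^'n \<Rightarrow> complex"
  assumes lin: "\<And>a u v w. q (a *s u + w) v = a * q u v + q w v" and sym: "\<And>u v. q v u = cnj (q u v)"
  shows "q u v = (\<Sum>i\<in>UNIV. \<Sum>j\<in>UNIV. u $ i * cnj (v $ j) * q (axis i 1) (axis j 1))"
proof -
  have z: "q 0 v = 0" for v using lin[of 1 0 0 v] by simp
  have s: "q (\<Sum>i\<in>S. f i *s e i) v = (\<Sum>i\<in>S. f i * q (e i) v)" if "finite S" for S :: "'n set" and f e v
    using that by (induction S) (simp_all add: z lin)
  have l: "q u v = (\<Sum>i\<in>UNIV. u $ i * q (axis i 1) v)" for u v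
    using s[of UNIV "\<lambda>i. u $ i" "\<lambda>i. axis i 1" v] by (simp add: basis_expansion)
  have "q (axis i 1) v = (\<Sum>j\<in>UNIV. cnj (v $ j) * q (axis i 1) (axis j 1))" for i
  proof -
    have "q (axis i 1) v = cnj (q v (axis i 1))" by (rule sym)
    also have "\<dots> = (\<Sum>j\<in>UNIV. cnj (v $ j) * cnj (q (axis j 1) (axis i 1)))" by (simp add: l[of v])
    also have "\<dots> = (\<Sum>j\<in>UNIV. cnj (v $ j) * q (axis i 1) (axis j 1))" using sym by metis
    finally show ?thesis .
  qed
  then show ?thesis using l[of u v] by (simp add: sum_distrib_left mult.assoc)
qed

context foliation
begin

text \<open>All late terms are measured in one chart around \<open>h 0\<close>, whichever charts
  \<open>speed0\<close> selects. There, base points, velocities and matrix entries of the metric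
  converge.\<close>

lemma speed0_converges:
  assumes g: "hermitian_metric A g"
    and ah: "converges_cont a h" "\<And>n. hol_curve (a n) unit_disc" "hol_curve h unit_disc"
  shows "(\<lambda>n. speed0 A g (a n)) \<longlonglongrightarrow> speed0 A g h"
proof -
  have 0: "0 \<in> unit_disc" by simp
  obtain d where d: "d \<in> A" "h 0 \<in> fst d" using chart_exists by blast
  note dA = atlas_subset_charts[OF d(1)]
  define u where "u = (\<lambda>f. \<chi> i. deriv (\<lambda>z. snd d (f z) $ i) (0::complex))"
  have sp: "speed0 A g f = sqrt (Re (g d (f 0) (u f) (u f)))" if f: "hol_curve f unit_disc" "f 0 \<in> fst d" for f
  proof -
    obtain u' where u': "has_velocity f d u' 0" by (rule hol_curve_velocity[OF f(1) 0 dA f(2)])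
    then have "u f = u'" unfolding u_def has_velocity_def vec_eq_iff by (auto intro: DERIV_imp_deriv)
    then show ?thesis using speed0_eq[OF g u' d(1)] by simp
  qed
  have lim0: "(\<lambda>n. a n 0) \<longlonglongrightarrow> h 0" by (rule converges_cont_pointwise[OF ah(1) 0])
  then have ev: "\<forall>\<^sub>F n in sequentially. a n 0 \<in> fst d"
    using chart_homeomorphism(1)[OF dA] d(2) by (rule topological_tendstoD)
  have ulim: "(\<lambda>n. u (a n) $ i) \<longlonglongrightarrow> u h $ i" for i
    unfolding u_def using converges_cont_deriv[OF ah chart_holomorphic[OF dA] chart_homeomorphism(1)[OF dA] 0 d(2)] by simp
  have glim: "(\<lambda>n. g d (a n 0) v w) \<longlonglongrightarrow> g d (h 0) v w" for v w
  proof -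
    have "Ck_on 0 (\<lambda>x. g d (param d x) v w) (snd d ` fst d)" using g d(1) unfolding hermitian_metric_def by blast
    then have "continuous_on (snd d ` fst d) (\<lambda>x. g d (param d x) v w)" by simp
    then have "isCont (\<lambda>x. g d (param d x) v w) (snd d (h 0))"
      using chart_homeomorphism(2)[OF dA] d(2) by (simp add: continuous_on_eq_continuous_at)
    moreover have "(\<lambda>n. snd d (a n 0)) \<longlonglongrightarrow> snd d (h 0)"
      by (rule isCont_tendsto_compose[OF chart_isCont[OF dA d(2)] lim0])
    ultimately have "(\<lambda>n. g d (param d (snd d (a n 0))) v w) \<longlonglongrightarrow> g d (param d (snd d (h 0))) v w"
      by (rule isCont_tendsto_compose)
    moreover have "\<forall>\<^sub>F n in sequentially. g d (param d (snd d (a n 0))) v w = g d (a n 0) v w"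
      using ev by (rule eventually_mono) (simp add: dA)
    ultimately show ?thesis using tendsto_cong dA d(2) by fastforce
  qed
  define Q where "Q = (\<lambda>p u. \<Sum>i\<in>UNIV. \<Sum>j\<in>UNIV. u $ i * cnj (u $ j) * g d p (axis i 1) (axis j 1))"
  have Q: "g d p u u = Q p u" if "p \<in> fst d" for p u
    unfolding Q_def by (rule hermitian_form_expand) (use g d(1) that in \<open>unfold hermitian_metric_def, blast+\<close>)
  have "(\<lambda>n. Q (a n 0) (u (a n))) \<longlonglongrightarrow> Q (h 0) (u h)"
    unfolding Q_def by (intro tendsto_intros ulim glim)
  then have "(\<lambda>n. sqrt (Re (Q (a n 0) (u (a n))))) \<longlonglongrightarrow> sqrt (Re (Q (h 0) (u h)))"
    by (intro tendsto_intros)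
  moreover have "\<forall>\<^sub>F n in sequentially. sqrt (Re (Q (a n 0) (u (a n)))) = speed0 A g (a n)"
    using ev by (rule eventually_mono) (simp add: Q sp ah(2))
  moreover have "sqrt (Re (Q (h 0) (u h))) = speed0 A g h" using Q sp ah(3) d(2) by simp
  ultimately show ?thesis using tendsto_cong by fastforce
qed

section \<open>Tangency of the limit\<close>

text \<open>Derivatives of coordinates converge by Weierstrass, so the vanishing of the minors
  passes to the limit. Where the value of h is off E, this is tangency.\<close>

lemma limit_tangent_at:
  assumes ah: "converges_cont a h" "\<And>n. tangent (a n) unit_disc" "hol_curve h unit_disc"
    and w: "w \<in> unit_disc" "h w \<notin> E"
  shows "\<exists>c v l. (c, v) \<in> F \<and> has_velocity h c (l *s v (h w)) w"
proof -
  obtain c v where cv: "(c, v) \<in> F" "h w \<in> fst c" by (rule generator_exists)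
  note cA = generatorD(1)[OF cv(1)]
  define d where "d = (\<lambda>f i. deriv (\<lambda>z. snd c (f z) $ i) w)"
  have lim: "(\<lambda>n. a n w) \<longlonglongrightarrow> h w" by (rule converges_cont_pointwise[OF ah(1) w(1)])
  have vlim: "(\<lambda>n. v (a n w) $ i) \<longlonglongrightarrow> v (h w) $ i" for i
    by (rule isCont_tendsto_compose[OF generator_isCont[OF cv] lim])
  have dlim: "(\<lambda>n. d (a n) i) \<longlonglongrightarrow> d h i" for i
    unfolding d_def
    by (rule converges_cont_deriv[OF ah(1) tangent_imp_hol_curve[OF ah(2)] ah(3) chart_holomorphic[OF cA] chart_homeomorphism(1)[OF cA] w(1) cv(2)])
  have ev: "\<forall>\<^sub>F n in sequentially. a n w \<in> fst c"
    by (rule topological_tendstoD[OF lim chart_homeomorphism(1)[OF cA] cv(2)])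
  have eq: "d h i * v (h w) $ j = d h j * v (h w) $ i" for i j
  proof -
    have e: "\<forall>\<^sub>F n in sequentially. d (a n) i * v (a n w) $ j = d (a n) j * v (a n w) $ i"
      using ev
    proof eventually_elim
      case (elim n)
      obtain l where l: "has_velocity (a n) c (l *s v (a n w)) w" by (rule tangent_velocity[OF ah(2) w(1) cv(1) elim])
      have "d (a n) k = l * v (a n w) $ k" for k
        unfolding d_def using l unfolding has_velocity_def by (auto intro: DERIV_imp_deriv)
      then show ?case by simp
    qed
    have l: "(\<lambda>n. d (a n) i * v (a n w) $ j) \<longlonglongrightarrow> d h i * v (h w) $ j"
      "(\<lambda>n. d (a n) j * v (a n w) $ i) \<longlonglongrightarrow> d h j * v (h w) $ i" by (intro tendsto_mult dlim vlim)+
    show ?thesis by (rule LIMSEQ_unique[OF l(1)[unfolded tendsto_cong[OF e]] l(2)])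
  qed
  obtain u where u: "has_velocity h c u w" by (rule hol_curve_velocity[OF ah(3) w(1) cA cv(2)])
  have du: "d h i = u $ i" for i
    unfolding d_def using u unfolding has_velocity_def by (auto intro: DERIV_imp_deriv)
  obtain l where "has_velocity h c (l *s v (h w)) w"
    by (rule parallel_velocity[OF u cv(1) w(2) eq[unfolded du]]) (rule that)
  then show ?thesis using cv(1) by blast
qed

text \<open>Inside W each approximating disc lies in one leaf of the restricted foliation, so by
  invariance it is contained in \<Sigma> or misses it. This is the dichotomy that Hurwitz's theorem
  needs for the equation \<phi>.\<close>

lemma limit_in_hypersurface:
  assumes ah: "converges_cont a h" "\<And>n. tangent (a n) unit_disc" "hol_curve h unit_disc"
    and \<Sigma>: "invariant_hypersurface A E F W \<Sigma>" "open W" and w0: "w0 \<in> unit_disc" "h w0 \<in> \<Sigma>"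
  shows "\<forall>\<^sub>F w in nhds w0. h w \<in> \<Sigma>"
proof -
  obtain \<phi> where \<phi>: "holomorphic_fun_on A \<phi> W" "\<Sigma> = {x \<in> W. \<phi> x = 0}"
    and inv: "\<And>p. p \<in> \<Sigma> - E \<Longrightarrow> leaf (restrict_foliation F W) E p \<subseteq> \<Sigma>"
    using \<Sigma>(1) unfolding invariant_hypersurface_def by blast
  have hW: "h w0 \<in> W" "\<phi> (h w0) = 0" using w0(2) \<phi>(2) by auto
  obtain S where S: "open S" "w0 \<in> S" "\<And>z. z \<in> S \<Longrightarrow> h z \<in> W"
    by (rule isCont_open_preimage[OF hol_curve_isCont[OF ah(3) w0(1)] \<Sigma>(2) hW(1)]) (rule that)
  have "open (S \<inter> unit_disc)" "w0 \<in> S \<inter> unit_disc" using S w0 by auto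
  then obtain e where e: "e > 0" "cball w0 e \<subseteq> S \<inter> unit_disc" by (meson open_contains_cball)
  have eD: "cball w0 e \<subseteq> unit_disc" "h ` cball w0 e \<subseteq> W" using e(2) S(3) by blast+
  have bD: "ball w0 e \<subseteq> unit_disc" using eD(1) ball_subset_cball by blast
  note hc = hol_curve_continuous_on[OF ah(3)]
  have "\<forall>\<^sub>F n in sequentially. \<forall>z\<in>cball w0 e. a n z \<in> W"
    by (rule converges_cont_uniform(1)[OF ah(1) hc compact_cball eD(1) \<Sigma>(2) eD(2) holomorphic_fun_isCont[OF \<phi>(1)]])
  then obtain n0 where n0: "\<And>n z. n \<ge> n0 \<Longrightarrow> z \<in> cball w0 e \<Longrightarrow> a n z \<in> W"
    unfolding eventually_sequentially by blast
  \<comment> \<open>Drops the finitely many terms that may leave W on the disc around w0.\<close>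
  define b where "b = (\<lambda>n. a (n + n0))"
  have bh: "converges_cont b h"
    unfolding b_def by (rule converges_cont_subseq[OF ah(1)]) (simp add: strict_mono_def)
  have bW: "b n z \<in> W" if "z \<in> ball w0 e" for n z using n0[of "n + n0" z] that by (simp add: b_def)
  have bt: "tangent (b n) (ball w0 e)" for n using ah(2)[of "n + n0"] bD unfolding b_def tangent_def by blast
  have hb: "hol_curve h (ball w0 e)" by (rule hol_curve_subset[OF ah(3) bD])
  have hbW: "h z \<in> W" if "z \<in> ball w0 e" for z using eD(2) that by auto
  have "\<phi> (h z) = 0" if z: "z \<in> ball w0 e" for z
  proof (rule Hurwitz_zero[where f="\<lambda>n z. \<phi> (b n z)" and g="\<lambda>z. \<phi> (h z)" and B="ball w0 e" and ?z0.0=w0])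
    show "(\<lambda>z. \<phi> (b n z)) holomorphic_on ball w0 e" for n
      by (rule hol_curve_holomorphic[OF tangent_imp_hol_curve[OF bt] open_ball \<phi>(1) bW])
    show "(\<lambda>z. \<phi> (h z)) holomorphic_on ball w0 e"
      by (rule hol_curve_holomorphic[OF hb open_ball \<phi>(1) hbW])
    show "uniform_limit K (\<lambda>n z. \<phi> (b n z)) (\<lambda>z. \<phi> (h z)) sequentially" if "compact K" "K \<subseteq> ball w0 e" for K
      by (rule converges_cont_uniform(2)[OF bh hc that(1) _ \<Sigma>(2) _ holomorphic_fun_isCont[OF \<phi>(1)]])
        (use that(2) bD hbW in blast)+
    show "(\<forall>z\<in>ball w0 e. \<phi> (b n z) = 0) \<or> (\<forall>z\<in>ball w0 e. \<phi> (b n z) \<noteq> 0)" for n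
    proof (rule disjCI)
      assume "\<not> (\<forall>z\<in>ball w0 e. \<phi> (b n z) \<noteq> 0)"
      then obtain z1 where z1: "z1 \<in> ball w0 e" "\<phi> (b n z1) = 0" by blast
      have "b n z1 \<in> \<Sigma> - E" using z1 bW bt \<phi>(2) unfolding tangent_def by blast
      then have "leaf (restrict_foliation F W) E (b n z1) \<subseteq> \<Sigma>" by (rule inv)
      moreover have "b n ` ball w0 e \<subseteq> leaf (restrict_foliation F W) E (b n z1)"
        by (rule tangent_in_leaf_restrict[OF bt open_ball connected_ball \<Sigma>(2) _ z1(1)]) (use bW in blast)
      ultimately show "\<forall>z\<in>ball w0 e. \<phi> (b n z) = 0" using \<phi>(2) by blast
    qed
  qed (use e(1) hW z in auto)
  then have "h z \<in> \<Sigma>" if "z \<in> ball w0 e" for z using \<phi>(2) hbW that by blast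
  then show ?thesis using e(1) unfolding eventually_nhds by (intro exI[of _ "ball w0 e"]) auto
qed

text \<open>At a point of smallest modulus that \<open>h\<close> maps into \<open>E\<close>, the limit \<open>h\<close> runs inside all the
  hypersurfaces through its value, while its earlier values still lie on the leaf of \<open>h 0\<close>.\<close>

lemma limit_tangent:
  assumes ah: "converges_cont a h" "\<And>n. tangent (a n) unit_disc" "hol_curve h unit_disc"
    and U: "\<And>q. q \<in> E \<Longrightarrow> open (U q)"
    and \<Sigma>: "\<And>q i. q \<in> E \<Longrightarrow> i \<in> {1..k q} \<Longrightarrow> invariant_hypersurface A E F (U q) (\<Sigma> q i)"
    and q\<Sigma>: "\<And>q. q \<in> E \<Longrightarrow> q \<in> (\<Inter>i\<in>{1..k q}. \<Sigma> q i)"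
    and z: "h 0 \<notin> E" "\<And>q p. q \<in> E \<Longrightarrow> p \<in> (\<Inter>i\<in>{1..k q::nat}. \<Sigma> q i) \<Longrightarrow> h 0 \<notin> leaf F E p"
  shows "tangent h unit_disc"
proof -
  have "h w \<notin> E" if w: "w \<in> unit_disc" for w
  proof
    assume wE: "h w \<in> E"
    \<comment> \<open>The closed disc through w is compact and E is closed, so among the points
      mapped into E there is one of smallest modulus.\<close>
    define K where "K = cball 0 (norm w) \<inter> h -` E"
    have cD: "cball 0 (norm w) \<subseteq> unit_disc" using w by auto
    have "continuous_on (cball 0 (norm w)) h" using continuous_on_subset[OF hol_curve_continuous_on[OF ah(3)] cD] .
    then have "closed K" unfolding K_def using closed_singular_set by (intro continuous_closed_preimage) auto
    then have "compact K" unfolding K_def by (metis Int_commute closed_Int_compact compact_Int_closed compact_cball inf.right_idem)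
    moreover have "w \<in> K" using wE by (simp add: K_def)
    ultimately obtain w0 where w0: "w0 \<in> K" "\<And>y. y \<in> K \<Longrightarrow> norm w0 \<le> norm y"
      using continuous_attains_inf[of K norm] by (metis continuous_on_norm_id empty_iff)
    define r where "r = norm w0"
    have w0E: "h w0 \<in> E" "w0 \<in> unit_disc" using w0(1) cD unfolding K_def by auto
    then have r: "r > 0" using z(1) unfolding r_def by (metis norm_eq_zero zero_less_norm_iff)
    have rw: "r \<le> norm w" using w0(1) by (simp add: K_def r_def)
    have rD: "ball 0 r \<subseteq> unit_disc" using rw w by auto
    have "h y \<notin> E" if "y \<in> ball 0 r" for y
      using w0(2)[of y] that rw unfolding K_def r_def by auto
    then have th: "tangent h (ball 0 r)" unfolding tangent_def using limit_tangent_at[OF ah] rD by blast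
    have in_leaf: "h ` ball 0 r \<subseteq> leaf F E (h 0)"
      by (rule tangent_in_leaf[OF th open_ball connected_ball]) (use r in simp)
    have "\<forall>\<^sub>F y in nhds w0. h y \<in> \<Sigma> (h w0) i" if "i \<in> {1..k (h w0)}" for i
      by (rule limit_in_hypersurface[OF ah \<Sigma>[OF w0E(1) that] U[OF w0E(1)] w0E(2)]) (use q\<Sigma>[OF w0E(1)] that in blast)
    then have "\<forall>\<^sub>F y in nhds w0. \<forall>i\<in>{1..k (h w0)}. h y \<in> \<Sigma> (h w0) i"
      by (simp add: eventually_ball_finite_distrib)
    then obtain N where N: "open N" "w0 \<in> N" "\<And>y i. y \<in> N \<Longrightarrow> i \<in> {1..k (h w0)} \<Longrightarrow> h y \<in> \<Sigma> (h w0) i"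
      unfolding eventually_nhds by blast
    have "w0 \<in> closure (ball 0 r)" using r by (simp add: r_def)
    then have "N \<inter> ball 0 r \<noteq> {}" using N(1,2) open_Int_closure_eq_empty[OF N(1), of "ball 0 r"] by blast
    then obtain y where y: "y \<in> N" "y \<in> ball 0 r" by blast
    have yl: "h y \<in> leaf F E (h 0)" using in_leaf y(2) by blast
    \<comment> \<open>Lying on the same leaf is symmetric: \<open>h 0\<close> is on the leaf of
      \<open>h y\<close>, and \<open>h y\<close> is in the intersection of the hypersurfaces
      attached to \<open>h w0\<close>, so \<open>h 0\<close> would belong to the excluded
      set.\<close>
    have "h 0 \<in> leaf F E (h y)" using leaf_memD(2)[OF yl z(1)] self_in_leaf[OF z(1)] by simp
    moreover have "h y \<in> (\<Inter>i\<in>{1..k (h w0)}. \<Sigma> (h w0) i)" using N(3) y(1) by blast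
    ultimately show False using z(2)[OF w0E(1)] by blast
  qed
  then show ?thesis unfolding tangent_def using limit_tangent_at[OF ah] by blast
qed

section \<open>Lifting through the limit\<close>

text \<open>The plaques through \<open>a n x\<close> lift through \<open>a n\<close> with starting
  point x, for late n all on the time disc of radius \<rho>. Montel's theorem gives a limit of the
  lifts; convergence at moving points and continuity of the flow in y identify its image under
  h.\<close>

lemma limit_plaque_lift:
  assumes ah: "converges_cont a h" "\<And>n. a n \<in> uniformizations A E F" and x: "x \<in> unit_disc"
    and N: "open N" "h x \<in> N" "\<rho> > 0" "\<And>y. y \<in> N \<Longrightarrow> \<Phi> y 0 = y" "\<And>y. y \<in> N \<Longrightarrow> integral_curve F E (\<Phi> y) \<rho>"
      "\<And>t. t \<in> ball 0 \<rho> \<Longrightarrow> continuous_on N (\<lambda>y. \<Phi> y t)"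
  obtains \<psi> where "\<psi> holomorphic_on ball 0 \<rho>" "\<psi> ` ball 0 \<rho> \<subseteq> unit_disc" "\<psi> 0 = x"
    "\<And>t. t \<in> ball 0 \<rho> \<Longrightarrow> h (\<psi> t) = \<Phi> (h x) t"
proof -
  have lim: "(\<lambda>n. a n x) \<longlonglongrightarrow> h x" by (rule converges_cont_pointwise[OF ah(1) x])
  then have "\<forall>\<^sub>F n in sequentially. a n x \<in> N" using N(1,2) by (rule topological_tendstoD)
  then obtain n0 where n0: "\<And>n. n \<ge> n0 \<Longrightarrow> a n x \<in> N" unfolding eventually_sequentially by blast
  define b where "b = (\<lambda>n. a (n + n0))"
  have bh: "converges_cont b h"
    unfolding b_def by (rule converges_cont_subseq[OF ah(1)]) (simp add: strict_mono_def)
  have bN: "b n x \<in> N" for n using n0[of "n + n0"] by (simp add: b_def)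
  have "\<exists>\<psi>. \<psi> holomorphic_on ball 0 \<rho> \<and> \<psi> ` ball 0 \<rho> \<subseteq> unit_disc \<and> \<psi> 0 = x \<and> (\<forall>t\<in>ball 0 \<rho>. b n (\<psi> t) = \<Phi> (b n x) t)" for n
  proof -
    have "b n \<in> uniformizations A E F" using ah(2) by (simp add: b_def)
    moreover have "b n x = \<Phi> (b n x) 0" using N(4)[OF bN] by simp
    ultimately obtain \<beta> where "\<beta> holomorphic_on ball 0 \<rho>" "\<beta> ` ball 0 \<rho> \<subseteq> unit_disc" "\<beta> 0 = x"
      "\<And>t. t\<in>ball 0 \<rho> \<Longrightarrow> b n (\<beta> t) = \<Phi> (b n x) t"
      using lift_through_uniformization[OF _ integral_curve_tangent[OF N(5)[OF bN]] N(3) x] by metis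
    then show ?thesis by blast
  qed
  then obtain \<psi> where \<psi>: "\<And>n. \<psi> n holomorphic_on ball 0 \<rho>" "\<And>n. \<psi> n ` ball 0 \<rho> \<subseteq> unit_disc" "\<And>n. \<psi> n 0 = x"
     "\<And>n t. t\<in>ball 0 \<rho> \<Longrightarrow> b n (\<psi> n t) = \<Phi> (b n x) t" by metis
  obtain \<xi> r where \<xi>: "\<xi> holomorphic_on ball 0 \<rho>" "strict_mono r"
    "\<And>t. t \<in> ball 0 \<rho> \<Longrightarrow> (\<lambda>n. \<psi> (r n) t) \<longlonglongrightarrow> \<xi> t"
  proof (rule Montel[of "ball 0 \<rho>" "{f. f holomorphic_on ball 0 \<rho> \<and> f ` ball 0 \<rho> \<subseteq> unit_disc}" \<psi>])
    fix K :: "complex set" assume K: "compact K" "K \<subseteq> ball 0 \<rho>"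
    show "\<exists>B. \<forall>f\<in>{f. f holomorphic_on ball 0 \<rho> \<and> f ` ball 0 \<rho> \<subseteq> unit_disc}. \<forall>z\<in>K. norm (f z) \<le> B"
    proof (intro exI[of _ 1] ballI)
      fix f z assume f: "f \<in> {f. f holomorphic_on ball 0 \<rho> \<and> f ` ball 0 \<rho> \<subseteq> unit_disc}" and z: "z \<in> K"
      then have "f z \<in> unit_disc" using K(2) by blast
      then show "norm (f z) \<le> 1" by simp
    qed
  qed (use \<psi>(1,2) that in \<open>auto simp: image_subset_iff\<close>)
  have 0: "0 \<in> ball (0::complex) \<rho>" using N(3) by simp
  have \<xi>0: "\<xi> 0 = x" using \<xi>(3)[OF 0] \<psi>(3) LIMSEQ_unique[OF _ tendsto_const] by fastforce
  have \<psi>D: "\<psi> n t \<in> unit_disc" if "t \<in> ball 0 \<rho>" for n t using \<psi>(2) that by blast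
  have \<xi>1: "norm (\<xi> t) \<le> 1" if "t \<in> ball 0 \<rho>" for t
    by (rule LIMSEQ_le_const2[OF tendsto_norm[OF \<xi>(3)[OF that]]]) (use \<psi>D[OF that] in \<open>auto intro!: less_imp_le\<close>)
  have \<xi>D: "\<xi> t \<in> unit_disc" if t: "t \<in> ball 0 \<rho>" for t
  proof (rule ccontr)
    assume "\<xi> t \<notin> unit_disc"
    then have t1: "norm (\<xi> t) = 1" using \<xi>1[OF t] by simp
    \<comment> \<open>A limit of maps into the open disc might touch the circle; the maximum
      principle would make it constant, equal to its value x at 0, which has modulus below
      1.\<close>
    have "\<xi> constant_on ball 0 \<rho>"
      by (rule maximum_modulus_principle[OF \<xi>(1) open_ball connected_ball open_ball subset_refl t]) (use \<xi>1 t1 in simp)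
    then have "\<xi> t = \<xi> 0" using t 0 unfolding constant_on_def by metis
    then show False using t1 \<xi>0 x by simp
  qed
  have "h (\<xi> t) = \<Phi> (h x) t" if t: "t \<in> ball 0 \<rho>" for t
  proof -
    have 1: "(\<lambda>n. b (r n) (\<psi> (r n) t)) \<longlonglongrightarrow> h (\<xi> t)"
      by (rule converges_contD[OF bh \<xi>(2) \<psi>D[OF t] \<xi>D[OF t] \<xi>(3)[OF t]])
    have "(\<lambda>n. b (r n) x) \<longlonglongrightarrow> h x"
      by (rule converges_contD[OF bh \<xi>(2) x x tendsto_const])
    then have "(\<lambda>n. \<Phi> (b (r n) x) t) \<longlonglongrightarrow> \<Phi> (h x) t"
      by (rule continuous_on_tendsto_compose[OF N(6)[OF t] _ N(2)]) (use bN in auto)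
    then show ?thesis using 1 \<psi>(4)[OF t] LIMSEQ_unique by simp
  qed
  moreover have "\<xi> ` ball 0 \<rho> \<subseteq> unit_disc" using \<xi>D by blast
  ultimately show ?thesis using that[OF \<xi>(1) _ \<xi>0] by blast
qed

text \<open>By the chain rule the nonzero generator at \<open>h x\<close> is a multiple of the
  velocity of h at x, because the flow through \<open>h x\<close> factors through h. In particular
  the limit is not constant.\<close>

lemma limit_immersed:
  assumes ah: "converges_cont a h" "\<And>n. a n \<in> uniformizations A E F" "tangent h unit_disc"
  shows "immersed h unit_disc"
  unfolding immersed_def
proof
  fix x :: complex assume x: "x \<in> unit_disc"
  have hE: "h x \<notin> E" using ah(3) x unfolding tangent_def by blast
  obtain c v where cv: "(c, v) \<in> F" "h x \<in> fst c" by (rule generator_exists)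
  obtain N \<rho> \<Phi> where N: "open N" "h x \<in> N" "\<rho> > 0" "\<And>y. y \<in> N \<Longrightarrow> \<Phi> y 0 = y"
      "\<And>y. y \<in> N \<Longrightarrow> integral_curve F E (\<Phi> y) \<rho>" "\<And>t. t \<in> ball 0 \<rho> \<Longrightarrow> continuous_on N (\<lambda>y. \<Phi> y t)"
      "\<And>y t. y \<in> N \<Longrightarrow> t \<in> ball 0 \<rho> \<Longrightarrow> has_velocity (\<Phi> y) c (v (\<Phi> y t)) t"
    by (rule flow_box[OF hE cv]) (rule that)
  obtain \<psi> where \<psi>: "\<psi> holomorphic_on ball 0 \<rho>" "\<psi> 0 = x" "\<And>t. t \<in> ball 0 \<rho> \<Longrightarrow> h (\<psi> t) = \<Phi> (h x) t"
    by (rule limit_plaque_lift[OF ah(1,2) x N(1-6)]) (assumption+, rule that)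
  have 0: "0 \<in> ball (0::complex) \<rho>" using N(3) by simp
  obtain u where u: "has_velocity h c u x"
    by (rule hol_curve_velocity[OF tangent_imp_hol_curve[OF ah(3)] x generatorD(1)[OF cv(1)] cv(2)])
  have "has_velocity (\<lambda>t. h (\<psi> t)) c (deriv \<psi> 0 *s u) 0"
    by (rule has_velocity_comp[OF _ holomorphic_derivI[OF \<psi>(1) open_ball 0]]) (use u \<psi>(2) in simp)
  then have 1: "has_velocity (\<Phi> (h x)) c (deriv \<psi> 0 *s u) 0"
    by (rule has_velocity_cong[OF _ open_ball 0]) (rule \<psi>(3))
  have "has_velocity (\<Phi> (h x)) c (v (h x)) 0" using N(7)[OF N(2) 0] N(4)[OF N(2)] by simp
  then have "v (h x) = deriv \<psi> 0 *s u" using 1 by (rule has_velocity_unique)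
  moreover have "v (h x) \<noteq> 0" using generatorD(3)[OF cv] hE by blast
  ultimately have "u \<noteq> 0" by auto
  then show "\<exists>c\<in>charts A. \<exists>u. u \<noteq> 0 \<and> has_velocity h c u x" using u generatorD(1)[OF cv(1)] by blast
qed

text \<open>Near w0 the disc f is a flow line run with elapsed time C, and flow lines lift from
  every point over the flow box with the same time \<rho>. So one radius \<epsilon> works for all
  points over f, which is the hypothesis of \<open>disc_lifting\<close>; immersion of h supplies
  local injectivity.\<close>

lemma limit_lift:
  assumes ah: "converges_cont a h" "\<And>n. a n \<in> uniformizations A E F" "tangent h unit_disc"
    and f: "tangent f unit_disc" "f 0 = h 0"
  obtains \<beta> where "\<beta> holomorphic_on unit_disc" "\<beta> ` unit_disc \<subseteq> unit_disc" "\<beta> 0 = 0" "\<And>w. w \<in> unit_disc \<Longrightarrow> h (\<beta> w) = f w"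
proof -
  note im = limit_immersed[OF ah]
  have D0: "0 \<in> unit_disc" by simp
  have loc: "\<exists>\<epsilon>>0. ball w0 \<epsilon> \<subseteq> unit_disc \<and> (\<forall>w\<in>ball w0 \<epsilon>. \<forall>x\<in>unit_disc. h x = f w \<longrightarrow>
      (\<exists>\<psi>. lift_on h unit_disc f (ball w0 \<epsilon>) \<psi> \<and> \<psi> w = x))"
    if w0: "w0 \<in> unit_disc" for w0
  proof -
    have fE: "f w0 \<notin> E" using f(1) w0 unfolding tangent_def by blast
    obtain c v where cv: "(c, v) \<in> F" "f w0 \<in> fst c" by (rule generator_exists)
    obtain N \<rho> \<Phi> where N: "open N" "f w0 \<in> N" "\<rho> > 0" "\<And>y. y \<in> N \<Longrightarrow> \<Phi> y 0 = y"
        "\<And>y. y \<in> N \<Longrightarrow> integral_curve F E (\<Phi> y) \<rho>" "\<And>t. t \<in> ball 0 \<rho> \<Longrightarrow> continuous_on N (\<lambda>y. \<Phi> y t)"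
        "\<And>y t. y \<in> N \<Longrightarrow> t \<in> ball 0 \<rho> \<Longrightarrow> has_velocity (\<Phi> y) c (v (\<Phi> y t)) t"
      by (rule flow_box[OF fE cv]) (rule that)
    obtain \<epsilon>0 l C where C: "\<epsilon>0 > 0" "ball w0 \<epsilon>0 \<subseteq> unit_disc" "l holomorphic_on ball w0 \<epsilon>0"
      "\<And>w. w \<in> ball w0 \<epsilon>0 \<Longrightarrow> has_velocity f c (l w *s v (f w)) w"
      "\<And>w. w \<in> ball w0 \<epsilon>0 \<Longrightarrow> (C has_field_derivative l w) (at w)" "C w0 = 0"
      by (rule tangent_speed[OF f(1) open_ball w0 cv]) (rule that)
    obtain S1 where S1: "open S1" "w0 \<in> S1" "\<And>z. z \<in> S1 \<Longrightarrow> f z \<in> N"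
      by (rule isCont_open_preimage[OF hol_curve_isCont[OF tangent_imp_hol_curve[OF f(1)] w0] N(1,2)]) (rule that)
    have "isCont C w0" by (rule DERIV_isCont[OF C(5)]) (use C(1) in simp)
    \<comment> \<open>Half of \<rho>, because the flow is restarted at w and the time that matters
      is the difference \<open>C z - C w\<close>.\<close>
    then obtain S2 where S2: "open S2" "w0 \<in> S2" "\<And>z. z \<in> S2 \<Longrightarrow> C z \<in> ball 0 (\<rho>/2)"
      by (rule isCont_open_preimage[where B="ball 0 (\<rho>/2)", OF _ open_ball]) (simp add: C(6) N(3), rule that)
    have "open (S1 \<inter> S2 \<inter> ball w0 \<epsilon>0)" "w0 \<in> S1 \<inter> S2 \<inter> ball w0 \<epsilon>0" using S1 S2 C(1) by auto
    then obtain \<epsilon> where \<epsilon>: "\<epsilon> > 0" "ball w0 \<epsilon> \<subseteq> S1 \<inter> S2 \<inter> ball w0 \<epsilon>0" by (meson openE)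
    have "\<exists>\<psi>. lift_on h unit_disc f (ball w0 \<epsilon>) \<psi> \<and> \<psi> w = x"
      if w: "w \<in> ball w0 \<epsilon>" and x: "x \<in> unit_disc" "h x = f w" for w x
    proof -
      have hN: "h x \<in> N" using x(2) S1(3) w \<epsilon>(2) by auto
      obtain \<psi> where \<psi>: "\<psi> holomorphic_on ball 0 \<rho>" "\<psi> ` ball 0 \<rho> \<subseteq> unit_disc" "\<psi> 0 = x"
          "\<And>t. t \<in> ball 0 \<rho> \<Longrightarrow> h (\<psi> t) = \<Phi> (h x) t"
        by (rule limit_plaque_lift[OF ah(1,2) x(1) N(1) hN N(3-6)]) (assumption+, rule that)
      have C\<rho>: "C z - C w \<in> ball 0 \<rho>" if "z \<in> ball w0 \<epsilon>" for z
      proof -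
        have "norm (C z) < \<rho>/2" "norm (C w) < \<rho>/2" using S2(3)[of z] S2(3)[of w] \<epsilon>(2) that w by auto
        then show ?thesis using norm_triangle_ineq4[of "C z" "C w"] by simp
      qed
      have Cd: "((\<lambda>z. C z - C w) has_field_derivative l z) (at z)" if "z \<in> ball w0 \<epsilon>" for z
        using DERIV_diff[OF C(5) DERIV_const, of z "C w"] \<epsilon>(2) that by auto
      have eq: "f z = \<Phi> (h x) (C z - C w)" if z: "z \<in> ball w0 \<epsilon>" for z
      proof (rule leafwise_unique[OF cv(1) open_ball connected_ball, of l w0 \<epsilon> f "\<lambda>z. \<Phi> (h x) (C z - C w)" w z])
        show "l holomorphic_on ball w0 \<epsilon>" using C(3) \<epsilon>(2) holomorphic_on_subset by blast
        fix z assume z: "z \<in> ball w0 \<epsilon>"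
        show "has_velocity f c (l z *s v (f z)) z" using C(4) \<epsilon>(2) z by blast
        show "has_velocity (\<lambda>z. \<Phi> (h x) (C z - C w)) c (l z *s v (\<Phi> (h x) (C z - C w))) z"
          by (rule has_velocity_comp[OF N(7)[OF hN C\<rho>[OF z]] Cd[OF z]])
      qed (use w z x(2) N(4)[OF hN] in auto)
      show ?thesis
      proof (intro exI[of _ "\<lambda>z. \<psi> (C z - C w)"] conjI)
        have "continuous_on (ball w0 \<epsilon>) (\<lambda>z. C z - C w)"
          using Cd by (intro continuous_at_imp_continuous_on ballI DERIV_isCont)
        then have "continuous_on (ball w0 \<epsilon>) (\<lambda>z. \<psi> (C z - C w))"
          by (rule continuous_on_compose2[OF holomorphic_on_imp_continuous_on[OF \<psi>(1)]]) (use C\<rho> in blast)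
        moreover have "(\<lambda>z. \<psi> (C z - C w)) ` ball w0 \<epsilon> \<subseteq> unit_disc" using C\<rho> \<psi>(2) by blast
        moreover have "h (\<psi> (C z - C w)) = f z" if "z \<in> ball w0 \<epsilon>" for z using \<psi>(4)[OF C\<rho>[OF that]] eq[OF that] by simp
        ultimately show "lift_on h unit_disc f (ball w0 \<epsilon>) (\<lambda>z. \<psi> (C z - C w))" by (simp add: lift_on_def)
        show "\<psi> (C w - C w) = x" using \<psi>(3) by simp
      qed
    qed
    moreover have "ball w0 \<epsilon> \<subseteq> unit_disc" using \<epsilon>(2) C(2) by blast
    ultimately show ?thesis using \<epsilon>(1) by blast
  qed
  obtain \<beta> where l: "lift_on h unit_disc f unit_disc \<beta>" "\<beta> 0 = 0"
    by (rule disc_lifting[where r=1 and T=unit_disc and \<alpha>=h and f=f and ?x0.0=0, OF loc immersed_local_inj[OF im open_ball] D0 f(2)[symmetric] zero_less_one])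
      (assumption | rule that)+
  then have \<beta>: "continuous_on unit_disc \<beta>" "\<beta> ` unit_disc \<subseteq> unit_disc" "\<And>w. w \<in> unit_disc \<Longrightarrow> h (\<beta> w) = f w"
    by (simp_all add: lift_on_def)
  from \<beta>(1) have "\<beta> holomorphic_on unit_disc"
    by (rule lift_holomorphic[OF im open_ball tangent_imp_hol_curve[OF f(1)] open_ball _ \<beta>(2,3)])
  then show ?thesis using \<beta>(2) l(2) \<beta>(3) by (rule that)
qed

section \<open>Continuity of the modulus\<close>

lemma modulus_continuous:
  assumes hyp: "hyperbolic A E F" and g: "hermitian_metric A g" and ncp: "NCP A (uniformizations A E F)"
    and U: "\<And>q. q \<in> E \<Longrightarrow> open (U q)"
    and \<Sigma>: "\<And>q i. q \<in> E \<Longrightarrow> i \<in> {1..k q} \<Longrightarrow> invariant_hypersurface A E F (U q) (\<Sigma> q i)"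
    and q\<Sigma>: "\<And>q. q \<in> E \<Longrightarrow> q \<in> (\<Inter>i\<in>{1..k q}. \<Sigma> q i)"
    and z: "z \<notin> E" "\<And>q p. q \<in> E \<Longrightarrow> p \<in> (\<Inter>i\<in>{1..k q::nat}. \<Sigma> q i) \<Longrightarrow> z \<notin> leaf F E p"
  shows "continuous (at z within - E) (modulus_of_uniformization A g E F)"
  unfolding continuous_within tendsto_at_iff_sequentially
proof (intro allI impI)
  let ?\<eta> = "modulus_of_uniformization A g E F"
  fix X assume X: "\<forall>i. X i \<in> - E - {z}" "X \<longlonglongrightarrow> z"
  show "(?\<eta> \<circ> X) \<longlonglongrightarrow> ?\<eta> z"
  proof (rule ccontr)
    assume "\<not> ?thesis"
    then obtain e where e: "e > 0" "\<not> (\<forall>\<^sub>F n in sequentially. dist (?\<eta> (X n)) (?\<eta> z) < e)"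
      unfolding tendsto_iff by auto
    from not_eventually_sequentiallyD[OF e(2)]
    obtain r :: "nat \<Rightarrow> nat" where r: "strict_mono r" "\<And>n. \<not> dist (?\<eta> (X (r n))) (?\<eta> z) < e" by blast
    have "\<exists>\<alpha>. \<alpha> \<in> uniformizations A E F \<and> \<alpha> 0 = X (r n)" for n
    proof -
      have "X (r n) \<notin> E" using X(1) by blast
      then show ?thesis using uniformization_at[OF hyp] by metis
    qed
    then obtain a where a: "\<And>n. a n \<in> uniformizations A E F" "\<And>n. a n 0 = X (r n)" by metis
    have Xr: "(\<lambda>n. X (r n)) \<longlonglongrightarrow> z" using LIMSEQ_subseq_LIMSEQ[OF X(2) r(1)] by (simp add: o_def)
    \<comment> \<open>The base points converge to z and therefore lie in a compact set, so NCP
      applies to this sequence of uniformizations.\<close>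
    have "compact (closure ((\<lambda>\<alpha>. \<alpha> 0) ` range a))"
    proof -
      let ?K = "insert z (range (\<lambda>n. X (r n)))"
      have K: "compact ?K" by (rule compact_insert_range_LIMSEQ[OF Xr])
      have "(\<lambda>\<alpha>. \<alpha> 0) ` range a \<subseteq> ?K" using a(2) by auto
      then have "closure ((\<lambda>\<alpha>. \<alpha> 0) ` range a) \<subseteq> ?K" using compact_imp_closed[OF K] by (rule closure_minimal)
      then show ?thesis using compact_Int_closed[OF K closed_closure] by (metis Int_absorb1)
    qed
    moreover have "range a \<subseteq> uniformizations A E F" using a(1) by blast
    ultimately have "normal_discs A (range a)" using ncp unfolding NCP_def by blast
    then obtain s h where s: "strict_mono s" "holomorphic_disc A h" "converges_compactly (a \<circ> s) h"
      unfolding normal_discs_def by blast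
    have h: "hol_curve h unit_disc" using s(2) by (simp add: holomorphic_disc_iff)
    define b where "b = (\<lambda>n. a (s n))"
    have bh: "converges_cont b h"
      using converges_compactly_imp_cont[OF s(3) hol_curve_continuous_on[OF h]] by (simp add: b_def o_def)
    have bU: "b n \<in> uniformizations A E F" for n using a(1) by (simp add: b_def)
    have bt: "tangent (b n) unit_disc" for n using uniformizationE[OF bU] uniformizesD(3) by metis
    have D0: "0 \<in> unit_disc" by simp
    have "(\<lambda>n. X (r (s n))) \<longlonglongrightarrow> z" using LIMSEQ_subseq_LIMSEQ[OF Xr s(1)] by (simp add: o_def)
    moreover have "(\<lambda>n. X (r (s n))) \<longlonglongrightarrow> h 0" using converges_cont_pointwise[OF bh D0] a(2) by (simp add: b_def)
    ultimately have h0: "h 0 = z" using LIMSEQ_unique by blast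
    have th: "tangent h unit_disc"
      by (rule limit_tangent[OF bh bt h U \<Sigma> q\<Sigma>]) (use z h0 in simp_all)
    \<comment> \<open>The same identity that holds for uniformizations, now for the limit h;
      convergence of speeds then contradicts the choice of the subsequence r.\<close>
    have "?\<eta> z = speed0 A g h"
      by (rule modulus_eqI[OF hyp g th h0]) (metis limit_lift[OF bh bU th] h0)
    moreover have "?\<eta> (X (r (s n))) = speed0 A g (b n)" for n
      by (rule modulus_uniformization[OF hyp g bU]) (simp add: b_def a(2))
    ultimately have "(\<lambda>n. ?\<eta> (X (r (s n)))) \<longlonglongrightarrow> ?\<eta> z"
      using speed0_converges[OF g bh tangent_imp_hol_curve[OF bt] h] by simp
    then have "\<forall>\<^sub>F n in sequentially. dist (?\<eta> (X (r (s n)))) (?\<eta> z) < e" using e(1) by (rule tendstoD)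
    then show False using r(2) by (simp add: eventually_False)
  qed
qed

end

theorem corollary1p12:
  fixes A :: "('m::{t2_space, second_countable_topology}, 'n::finite) chart set"
    and E :: "'m set"
    and F :: "('m, 'n) generator set"
    and g :: "('m, 'n) local_forms"
    and U :: "'m \<Rightarrow> 'm set"
    and k :: "'m \<Rightarrow> nat"
    and \<Sigma> :: "'m \<Rightarrow> nat \<Rightarrow> 'm set"
  assumes "complex_atlas A"
    and "shfc A E F"
    and "hyperbolic A E F"
    and "hermitian_metric A g"
    and "NCP A (uniformizations A E F)"
    and "\<And>q. q \<in> E \<Longrightarrow> open (U q) \<and> q \<in> U q"
    and "\<And>q. q \<in> E \<Longrightarrow> k q \<ge> 1"
    and "\<And>q i. q \<in> E \<Longrightarrow> i \<in> {1..k q} \<Longrightarrow> invariant_hypersurface A E F (U q) (\<Sigma> q i)"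
    and "\<And>q. q \<in> E \<Longrightarrow> q \<in> (\<Inter>i\<in>{1..k q}. \<Sigma> q i) \<and> (\<Inter>i\<in>{1..k q}. \<Sigma> q i) \<subseteq> U q"
  shows "\<forall>z \<in> UNIV - (\<Union>p \<in> (\<Union>q\<in>E. \<Inter>i\<in>{1..k q}. \<Sigma> q i). leaf F E p).
           continuous (at z within - E) (modulus_of_uniformization A g E F)"
proof
  interpret foliation A E F by unfold_locales (rule assms(1,2))+
  fix z assume "z \<in> UNIV - (\<Union>p \<in> (\<Union>q\<in>E. \<Inter>i\<in>{1..k q}. \<Sigma> q i). leaf F E p)"
  then have z: "z \<notin> leaf F E p" if "q \<in> E" "p \<in> (\<Inter>i\<in>{1..k q}. \<Sigma> q i)" for q p
    using that by blast
  \<comment> \<open>Every q in E lies in its own intersection of hypersurfaces, and its leaf is {q}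
    by convention, so E is part of the excluded set.\<close>
  have zE: "z \<notin> E"
  proof
    assume "z \<in> E"
    then have "z \<in> leaf F E z" by (simp add: leaf_def)
    then show False using z[OF \<open>z \<in> E\<close>] assms(9)[OF \<open>z \<in> E\<close>] by blast
  qed
  show "continuous (at z within - E) (modulus_of_uniformization A g E F)"
    by (rule modulus_continuous[OF assms(3,4,5) _ assms(8) _ zE z]) (use assms(6,9) in blast)+
qed

end
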